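(* Let $G$ be a non-trivial solvable group and let $A$ be a non-trivial abelian group with an arbitrary $G$-module structure. Define $$\Delta=\{\gamma\in H^2(G,A)\mid \overline{\kappa}(\overline{\sigma}(\gamma))\text{ is surjective}\}.$$ (a) $\Delta$ is invariant under the action of $\mathrm{Comp}(G,A)$ on $H^2(G,A)$. Let $\Omega$ denote a set of orbit representatives of the action of $\mathrm{Comp}(G,A)$ on $\Delta$. (b) The extensions of $A$ by $G$ defined by the elements of $\Omega$ form a complete and irredundant set of isomorphism type representatives of the derived series extensions of $A$ by $G$; that is, each of them is a derived series extension of $A$ by $G$, every derived series extension of $A$ by $G$ is isomorphic (as a group) to one of them, and extensions defined by distinct elements of $\Omega$ are not isomorphic as groups. (c) For $\delta\in Z^2(G,A)$ with $[\delta]\in\Delta$ denote the corresponding extension by $E$. Then $\mathrm{Aut}(E)=\mathrm{Aut}_A(E)$, and there exists a short exact sequence of groups $$1\to Z^1(G,A)\to \mathrm{Aut}(E)\to \mathrm{Stab}_{\mathrm{Comp}(G,A)}([\delta])\to 1.$$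
   Context: $G$ is written multiplicatively and $A$ additively; the (right) action of $g\in G$ on $a\in A$ is written $a^g$, and automorphisms are written as exponents (acting on the right). $Z^2(G,A)$ is the group of normalized 2-cocycles $\delta : G\times G\to A$: $\delta(g,h)^k+\delta(gh,k)=\delta(h,k)+\delta(g,hk)$ and $\delta(g,1)=\delta(1,g)=0$ for all $g,h,k\in G$. $B^2(G,A)$ is the subgroup of coboundaries $(g,h)\mapsto\epsilon(g)^h+\epsilon(h)-\epsilon(gh)$ with $\epsilon:G\to A$, $\epsilon(1)=0$; $H^2(G,A)=Z^2(G,A)/B^2(G,A)$ and $[\delta]=\delta+B^2(G,A)$. $Z^1(G,A)$ is the group of maps $\epsilon:G\to A$ with $\epsilon(gh)=\epsilon(g)^h+\epsilon(h)$. An extension of $A$ by $G$ is a group $E$ with a short exact sequence $A\hookrightarrow E\twoheadrightarrow G$ such that conjugation in $E$ (that is, $e^{-1}ae$) induces the given $G$-module structure on $A$. For $\delta\in Z^2(G,A)$, the corresponding extension is the set $G\times A$ with multiplication $(g,a)(g',a')=(gg',a^{g'}+a'+\delta(g,g'))$, with $A$ embedded via $a\mapsto(1,a)$ and projection $(g,a)\mapsto g$; $A$ is identified with its image $\overline{A}=\{(1,a)\mid a\in A\}$. The extension defined by a class in $H^2(G,A)$ is the one given by any representing cocycle (well defined up to equivalence of extensions). $\mathrm{Aut}_A(E)=\{\alpha\in\mathrm{Aut}(E)\mid A^\alpha=A\}$. An extension $E$ of $A$ by $G$, with image $\overline{A}$ of $A$ in $E$, is a derived series extension if $\overline{A}$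 equals the smallest non-trivial term of the derived series of $E$. The group of compatible pairs is $\mathrm{Comp}(G,A)=\{(\eta,\nu)\in\mathrm{Aut}(G)\times\mathrm{Aut}(A)\mid (a^\nu)^{(g^\eta)}=(a^g)^\nu\text{ for all }g\in G,a\in A\}$. It acts on $Z^2(G,A)$ by $\delta^{(\eta,\nu)}(g,h)=\left(\delta(g^{\eta^{-1}},h^{\eta^{-1}})\right)^\nu$, and this induces an action on $H^2(G,A)$ by $[\delta]^{(\eta,\nu)}=[\delta^{(\eta,\nu)}]$; $\mathrm{Stab}_{\mathrm{Comp}(G,A)}([\delta])$ is the stabilizer of $[\delta]$. For a non-trivial solvable group $G$, $\gamma(G)$ denotes the smallest non-trivial term of the derived series of $G$; it is an abelian normal subgroup. Put $U=[A,\gamma(G)]$, the subgroup of $A$ generated by all $a^g-a$ with $a\in A$, $g\in\gamma(G)$; it is a $G$-submodule, and $\gamma(G)$ acts trivially on $A/U$. The map $\overline{\sigma}:H^2(G,A)\to H^2(\gamma(G),A/U)$ is induced by $\sigma:Z^2(G,A)\to Z^2(\gamma(G),A/U)$, $\sigma(\delta)(g,h)=\delta(g,h)+U$ for $g,h\in\gamma(G)$. Let $N=\gamma(G)$ (abelian). The non-abelian exterior product $N\wedge N$ is the group generated by symbols $g\wedge h$ ($g,h\in N$) subject to $gg'\wedge h=({}^g g'\wedge{}^g h)(g\wedge h)$, $g\wedge hh'=(g\wedge h)({}^h g\wedge{}^h h')$ and $h\wedge h=1$, where ${}^h g=hgh^{-1}$. The Schur multiplier $M(N)$ is the kernel of $N\wedge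 N\to[N,N]$, $g\wedge h\mapsto ghg^{-1}h^{-1}$; since $N$ is abelian, $M(N)=N\wedge N$ (the usual abelian exterior square). The map $\overline{\kappa}:H^2(N,A/U)\to\mathrm{Hom}(M(N),A/U)$ sends $[\epsilon]$ to the homomorphism determined by $g\wedge h\mapsto\epsilon(g,h)-\epsilon(h,g)$ for $g,h\in N$ (it is well defined). *)

theory Defs
  imports "HOL-Algebra.Group_Action" "HOL-Algebra.Solvable_Groups"
begin

text \<open>
  The module \<open>A\<close> is an abelian group in the multiplicative notation of the library, so sums and
  differences of elements of \<open>A\<close> appear as products \<open>a \<otimes>\<^bsub>A\<^esub> b\<close> and quotients
  \<open>a \<otimes>\<^bsub>A\<^esub> inv\<^bsub>A\<^esub> b\<close>. The value \<open>act a g\<close> is the right action usually written as an exponent.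
\<close>

locale gmodule =
  fixes G :: "('g, 'm) monoid_scheme" and A :: "('a, 'n) monoid_scheme"
    and act :: "'a \<Rightarrow> 'g \<Rightarrow> 'a"
  assumes group_G: "group G"
    and comm_group_A: "comm_group A"
    and act_hom: "g \<in> carrier G \<Longrightarrow> (\<lambda>a. act a g) \<in> hom A A"
    and act_one: "a \<in> carrier A \<Longrightarrow> act a \<one>\<^bsub>G\<^esub> = a"
    and act_mult: "\<lbrakk>a \<in> carrier A; g \<in> carrier G; h \<in> carrier G\<rbrakk>
        \<Longrightarrow> act a (g \<otimes>\<^bsub>G\<^esub> h) = act (act a g) h"


section \<open>Cocycles and cohomology\<close>

text \<open>Cochains are extensional functions, so that equality of cochains means equality on the carrier.\<close>

definition cocycles2 ::
  "('g, 'm) monoid_scheme \<Rightarrow> ('a, 'n) monoid_scheme \<Rightarrow> ('a \<Rightarrow> 'g \<Rightarrow> 'a) \<Rightarrow> ('g \<times> 'g \<Rightarrow> 'a) set"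
  where "cocycles2 G A act =
    {\<delta> \<in> (carrier G \<times> carrier G) \<rightarrow>\<^sub>E carrier A.
      (\<forall>g\<in>carrier G. \<forall>h\<in>carrier G. \<forall>k\<in>carrier G.
         act (\<delta> (g, h)) k \<otimes>\<^bsub>A\<^esub> \<delta> (g \<otimes>\<^bsub>G\<^esub> h, k) = \<delta> (h, k) \<otimes>\<^bsub>A\<^esub> \<delta> (g, h \<otimes>\<^bsub>G\<^esub> k)) \<and>
      (\<forall>g\<in>carrier G. \<delta> (g, \<one>\<^bsub>G\<^esub>) = \<one>\<^bsub>A\<^esub> \<and> \<delta> (\<one>\<^bsub>G\<^esub>, g) = \<one>\<^bsub>A\<^esub>)}"

definition Z2 ::
  "('g, 'm) monoid_scheme \<Rightarrow> ('a, 'n) monoid_scheme \<Rightarrow> ('a \<Rightarrow> 'g \<Rightarrow> 'a) \<Rightarrow> ('g \<times> 'g \<Rightarrow> 'a) monoid"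
  where "Z2 G A act =
    \<lparr>carrier = cocycles2 G A act,
     mult = \<lambda>\<delta> \<delta>'. \<lambda>x\<in>carrier G \<times> carrier G. \<delta> x \<otimes>\<^bsub>A\<^esub> \<delta>' x,
     one = \<lambda>x\<in>carrier G \<times> carrier G. \<one>\<^bsub>A\<^esub>\<rparr>"

definition coboundary ::
  "('g, 'm) monoid_scheme \<Rightarrow> ('a, 'n) monoid_scheme \<Rightarrow> ('a \<Rightarrow> 'g \<Rightarrow> 'a) \<Rightarrow> ('g \<Rightarrow> 'a) \<Rightarrow> ('g \<times> 'g \<Rightarrow> 'a)"
  where "coboundary G A act \<epsilon> =
    (\<lambda>(g, h)\<in>carrier G \<times> carrier G.
       act (\<epsilon> g) h \<otimes>\<^bsub>A\<^esub> \<epsilon> h \<otimes>\<^bsub>A\<^esub> inv\<^bsub>A\<^esub> \<epsilon> (g \<otimes>\<^bsub>G\<^esub> h))"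

definition B2 ::
  "('g, 'm) monoid_scheme \<Rightarrow> ('a, 'n) monoid_scheme \<Rightarrow> ('a \<Rightarrow> 'g \<Rightarrow> 'a) \<Rightarrow> ('g \<times> 'g \<Rightarrow> 'a) set"
  where "B2 G A act = {coboundary G A act \<epsilon> | \<epsilon>. \<epsilon> \<in> carrier G \<rightarrow> carrier A \<and> \<epsilon> \<one>\<^bsub>G\<^esub> = \<one>\<^bsub>A\<^esub>}"

definition H2 ::
  "('g, 'm) monoid_scheme \<Rightarrow> ('a, 'n) monoid_scheme \<Rightarrow> ('a \<Rightarrow> 'g \<Rightarrow> 'a) \<Rightarrow> ('g \<times> 'g \<Rightarrow> 'a) set monoid"
  where "H2 G A act = Z2 G A act Mod B2 G A act"

definition coh_class ::
  "('g, 'm) monoid_scheme \<Rightarrow> ('a, 'n) monoid_scheme \<Rightarrow> ('a \<Rightarrow> 'g \<Rightarrow> 'a)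
    \<Rightarrow> ('g \<times> 'g \<Rightarrow> 'a) \<Rightarrow> ('g \<times> 'g \<Rightarrow> 'a) set"
  where "coh_class G A act \<delta> = B2 G A act #>\<^bsub>Z2 G A act\<^esub> \<delta>"

definition Z1 ::
  "('g, 'm) monoid_scheme \<Rightarrow> ('a, 'n) monoid_scheme \<Rightarrow> ('a \<Rightarrow> 'g \<Rightarrow> 'a) \<Rightarrow> ('g \<Rightarrow> 'a) monoid"
  where "Z1 G A act =
    \<lparr>carrier = {\<epsilon> \<in> carrier G \<rightarrow>\<^sub>E carrier A.
        \<forall>g\<in>carrier G. \<forall>h\<in>carrier G. \<epsilon> (g \<otimes>\<^bsub>G\<^esub> h) = act (\<epsilon> g) h \<otimes>\<^bsub>A\<^esub> \<epsilon> h},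
     mult = \<lambda>\<epsilon> \<epsilon>'. \<lambda>g\<in>carrier G. \<epsilon> g \<otimes>\<^bsub>A\<^esub> \<epsilon>' g,
     one = \<lambda>g\<in>carrier G. \<one>\<^bsub>A\<^esub>\<rparr>"


section \<open>Extensions\<close>

text \<open>The library's \<open>exact_seq\<close> forces all groups of a sequence to live on one type.\<close>

definition short_exact ::
  "('k, 'm) monoid_scheme \<Rightarrow> ('e, 'n) monoid_scheme \<Rightarrow> ('q, 'o) monoid_scheme
    \<Rightarrow> ('k \<Rightarrow> 'e) \<Rightarrow> ('e \<Rightarrow> 'q) \<Rightarrow> bool"
  where "short_exact K E Q \<iota> \<pi> \<longleftrightarrow>
    group K \<and> group E \<and> group Q \<and>
    \<iota> \<in> hom K E \<and> inj_on \<iota> (carrier K) \<and>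
    \<pi> \<in> hom E Q \<and> \<pi> ` carrier E = carrier Q \<and>
    \<iota> ` carrier K = kernel E Q \<pi>"

definition extension ::
  "('g, 'm) monoid_scheme \<Rightarrow> ('a, 'n) monoid_scheme \<Rightarrow> ('a \<Rightarrow> 'g \<Rightarrow> 'a)
    \<Rightarrow> ('e, 'o) monoid_scheme \<Rightarrow> ('a \<Rightarrow> 'e) \<Rightarrow> ('e \<Rightarrow> 'g) \<Rightarrow> bool"
  where "extension G A act E \<iota> \<pi> \<longleftrightarrow>
    short_exact A E G \<iota> \<pi> \<and>
    (\<forall>e\<in>carrier E. \<forall>a\<in>carrier A. inv\<^bsub>E\<^esub> e \<otimes>\<^bsub>E\<^esub> \<iota> a \<otimes>\<^bsub>E\<^esub> e = \<iota> (act a (\<pi> e)))"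

definition cocycle_ext ::
  "('g, 'm) monoid_scheme \<Rightarrow> ('a, 'n) monoid_scheme \<Rightarrow> ('a \<Rightarrow> 'g \<Rightarrow> 'a)
    \<Rightarrow> ('g \<times> 'g \<Rightarrow> 'a) \<Rightarrow> ('g \<times> 'a) monoid"
  where "cocycle_ext G A act \<delta> =
    \<lparr>carrier = carrier G \<times> carrier A,
     mult = \<lambda>(g, a) (g', a'). (g \<otimes>\<^bsub>G\<^esub> g', act a g' \<otimes>\<^bsub>A\<^esub> a' \<otimes>\<^bsub>A\<^esub> \<delta> (g, g')),
     one = (\<one>\<^bsub>G\<^esub>, \<one>\<^bsub>A\<^esub>)\<rparr>"

definition ext_embed :: "('g, 'm) monoid_scheme \<Rightarrow> 'a \<Rightarrow> 'g \<times> 'a"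
  where "ext_embed G a = (\<one>\<^bsub>G\<^esub>, a)"

definition is_last_derived :: "('e, 'm) monoid_scheme \<Rightarrow> 'e set \<Rightarrow> bool"
  where "is_last_derived E K \<longleftrightarrow>
    (\<exists>n. K = (derived E ^^ n) (carrier E)) \<and> K \<noteq> {\<one>\<^bsub>E\<^esub>} \<and>
    (\<forall>n. (derived E ^^ n) (carrier E) \<noteq> {\<one>\<^bsub>E\<^esub>} \<longrightarrow> K \<subseteq> (derived E ^^ n) (carrier E))"

definition derived_series_extension ::
  "('g, 'm) monoid_scheme \<Rightarrow> ('a, 'n) monoid_scheme \<Rightarrow> ('a \<Rightarrow> 'g \<Rightarrow> 'a)
    \<Rightarrow> ('e, 'o) monoid_scheme \<Rightarrow> ('a \<Rightarrow> 'e) \<Rightarrow> ('e \<Rightarrow> 'g) \<Rightarrow> bool"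
  where "derived_series_extension G A act E \<iota> \<pi> \<longleftrightarrow>
    extension G A act E \<iota> \<pi> \<and> is_last_derived E (\<iota> ` carrier A)"

definition auto_stabilizing :: "('e, 'm) monoid_scheme \<Rightarrow> 'e set \<Rightarrow> ('e \<Rightarrow> 'e) set"
  where "auto_stabilizing E S = {\<alpha> \<in> auto E. \<alpha> ` S = S}"


section \<open>Compatible pairs\<close>

text \<open>
  The product in \<^const>\<open>AutoGroup\<close> is composition of functions (right factor first), so
  \<^const>\<open>AutoGroup\<close> is the opposite of the automorphism group acting from the right. Since this
  applies to all automorphism groups below, right actions of \<open>Comp(G,A)\<close> become the left actions of
  the library, with the same orbits and stabilizers, and exact sequences correspond to each other.
\<close>

definition Comp ::
  "('g, 'm) monoid_scheme \<Rightarrow> ('a, 'n) monoid_scheme \<Rightarrow> ('a \<Rightarrow> 'g \<Rightarrow> 'a)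
    \<Rightarrow> (('g \<Rightarrow> 'g) \<times> ('a \<Rightarrow> 'a)) monoid"
  where "Comp G A act = (AutoGroup G \<times>\<times> AutoGroup A)
    \<lparr>carrier := {(\<eta>, \<nu>) \<in> auto G \<times> auto A.
       \<forall>g\<in>carrier G. \<forall>a\<in>carrier A. act (\<nu> a) (\<eta> g) = \<nu> (act a g)}\<rparr>"

definition Z2_act ::
  "('g, 'm) monoid_scheme \<Rightarrow> ('g \<Rightarrow> 'g) \<times> ('a \<Rightarrow> 'a) \<Rightarrow> ('g \<times> 'g \<Rightarrow> 'a) \<Rightarrow> ('g \<times> 'g \<Rightarrow> 'a)"
  where "Z2_act G = (\<lambda>(\<eta>, \<nu>) \<delta>. \<lambda>(g, h)\<in>carrier G \<times> carrier G.
    \<nu> (\<delta> (inv_into (carrier G) \<eta> g, inv_into (carrier G) \<eta> h)))"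

text \<open>
  A map on cocycles that respects cohomology is lifted to classes as the union, over all
  representatives, of the classes of their images; all these classes coincide.
\<close>

definition H2_act ::
  "('g, 'm) monoid_scheme \<Rightarrow> ('a, 'n) monoid_scheme \<Rightarrow> ('a \<Rightarrow> 'g \<Rightarrow> 'a)
    \<Rightarrow> ('g \<Rightarrow> 'g) \<times> ('a \<Rightarrow> 'a) \<Rightarrow> ('g \<times> 'g \<Rightarrow> 'a) set \<Rightarrow> ('g \<times> 'g \<Rightarrow> 'a) set"
  where "H2_act G A act p =
    (\<lambda>C\<in>carrier (H2 G A act). \<Union>\<delta>\<in>C. coh_class G A act (Z2_act G p \<delta>))"

definition Stab ::
  "('g, 'm) monoid_scheme \<Rightarrow> ('a, 'n) monoid_scheme \<Rightarrow> ('a \<Rightarrow> 'g \<Rightarrow> 'a)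
    \<Rightarrow> ('g \<times> 'g \<Rightarrow> 'a) set \<Rightarrow> (('g \<Rightarrow> 'g) \<times> ('a \<Rightarrow> 'a)) monoid"
  where "Stab G A act C =
    (Comp G A act)\<lparr>carrier := stabilizer (Comp G A act) (H2_act G A act) C\<rparr>"

definition orbit_representatives ::
  "('p, 'm) monoid_scheme \<Rightarrow> ('p \<Rightarrow> 'x \<Rightarrow> 'x) \<Rightarrow> 'x set \<Rightarrow> 'x set \<Rightarrow> bool"
  where "orbit_representatives P \<phi> S \<Omega> \<longleftrightarrow>
    \<Omega> \<subseteq> S \<and> (\<forall>Y\<in>orbits P S \<phi>. \<exists>!\<omega>. \<omega> \<in> \<Omega> \<inter> Y)"


section \<open>Restriction to the last derived subgroup\<close>

definition gam :: "('g, 'm) monoid_scheme \<Rightarrow> 'g set"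
  where "gam G = (THE K. is_last_derived G K)"

definition gam_group :: "('g, 'm) monoid_scheme \<Rightarrow> ('g, 'm) monoid_scheme"
  where "gam_group G = G\<lparr>carrier := gam G\<rparr>"

definition commU ::
  "('g, 'm) monoid_scheme \<Rightarrow> ('a, 'n) monoid_scheme \<Rightarrow> ('a \<Rightarrow> 'g \<Rightarrow> 'a) \<Rightarrow> 'a set"
  where "commU G A act =
    generate A {act a g \<otimes>\<^bsub>A\<^esub> inv\<^bsub>A\<^esub> a | a g. a \<in> carrier A \<and> g \<in> gam G}"

definition quot_A ::
  "('g, 'm) monoid_scheme \<Rightarrow> ('a, 'n) monoid_scheme \<Rightarrow> ('a \<Rightarrow> 'g \<Rightarrow> 'a) \<Rightarrow> 'a set monoid"
  where "quot_A G A act = A Mod commU G A act"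

definition quot_act ::
  "('g, 'm) monoid_scheme \<Rightarrow> ('a, 'n) monoid_scheme \<Rightarrow> ('a \<Rightarrow> 'g \<Rightarrow> 'a) \<Rightarrow> 'a set \<Rightarrow> 'g \<Rightarrow> 'a set"
  where "quot_act G A act S g = (\<Union>a\<in>S. commU G A act #>\<^bsub>A\<^esub> act a g)"

definition sigma ::
  "('g, 'm) monoid_scheme \<Rightarrow> ('a, 'n) monoid_scheme \<Rightarrow> ('a \<Rightarrow> 'g \<Rightarrow> 'a)
    \<Rightarrow> ('g \<times> 'g \<Rightarrow> 'a) \<Rightarrow> ('g \<times> 'g \<Rightarrow> 'a set)"
  where "sigma G A act \<delta> =
    (\<lambda>(g, h)\<in>gam G \<times> gam G. commU G A act #>\<^bsub>A\<^esub> \<delta> (g, h))"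

definition sigma_bar ::
  "('g, 'm) monoid_scheme \<Rightarrow> ('a, 'n) monoid_scheme \<Rightarrow> ('a \<Rightarrow> 'g \<Rightarrow> 'a)
    \<Rightarrow> ('g \<times> 'g \<Rightarrow> 'a) set \<Rightarrow> ('g \<times> 'g \<Rightarrow> 'a set) set"
  where "sigma_bar G A act C =
    (\<Union>\<delta>\<in>C. coh_class (gam_group G) (quot_A G A act) (quot_act G A act) (sigma G A act \<delta>))"


section \<open>Non-abelian exterior square and Schur multiplier\<close>

text \<open>
  Group presentations: the letter \<open>(True, x)\<close> stands for the generator \<open>x\<close> and \<open>(False, x)\<close> for its
  inverse. The presented group consists of the words over \<open>S\<close> modulo the least congruence of the
  word monoid that contains the cancellations and the relations \<open>R\<close>.
\<close>

type_synonym 'x word = "(bool \<times> 'x) list"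

inductive_set pres_cong :: "'x set \<Rightarrow> ('x word \<times> 'x word) set \<Rightarrow> ('x word \<times> 'x word) set"
  for S :: "'x set" and R :: "('x word \<times> 'x word) set" where
  refl: "w \<in> lists (UNIV \<times> S) \<Longrightarrow> (w, w) \<in> pres_cong S R"
| sym: "(u, v) \<in> pres_cong S R \<Longrightarrow> (v, u) \<in> pres_cong S R"
| trans: "\<lbrakk>(u, v) \<in> pres_cong S R; (v, w) \<in> pres_cong S R\<rbrakk> \<Longrightarrow> (u, w) \<in> pres_cong S R"
| app: "\<lbrakk>(u, v) \<in> pres_cong S R; (u', v') \<in> pres_cong S R\<rbrakk> \<Longrightarrow> (u @ u', v @ v') \<in> pres_cong S R"
| cancel: "x \<in> S \<Longrightarrow> ([(b, x), (\<not> b, x)], []) \<in> pres_cong S R"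
| rel: "\<lbrakk>(u, v) \<in> R; u \<in> lists (UNIV \<times> S); v \<in> lists (UNIV \<times> S)\<rbrakk> \<Longrightarrow> (u, v) \<in> pres_cong S R"

definition presented_group :: "'x set \<Rightarrow> ('x word \<times> 'x word) set \<Rightarrow> 'x word set monoid"
  where "presented_group S R =
    \<lparr>carrier = lists (UNIV \<times> S) // pres_cong S R,
     mult = \<lambda>P Q. \<Union>u\<in>P. \<Union>v\<in>Q. pres_cong S R `` {u @ v},
     one = pres_cong S R `` {[]}\<rparr>"

definition conj_by :: "('g, 'm) monoid_scheme \<Rightarrow> 'g \<Rightarrow> 'g \<Rightarrow> 'g"
  where "conj_by N h g = h \<otimes>\<^bsub>N\<^esub> g \<otimes>\<^bsub>N\<^esub> inv\<^bsub>N\<^esub> h"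

definition ext_rels :: "('g, 'm) monoid_scheme \<Rightarrow> (('g \<times> 'g) word \<times> ('g \<times> 'g) word) set"
  where "ext_rels N =
    {([(True, (g \<otimes>\<^bsub>N\<^esub> g', h))], [(True, (conj_by N g g', conj_by N g h)), (True, (g, h))]) | g g' h.
       g \<in> carrier N \<and> g' \<in> carrier N \<and> h \<in> carrier N} \<union>
    {([(True, (g, h \<otimes>\<^bsub>N\<^esub> h'))], [(True, (g, h)), (True, (conj_by N h g, conj_by N h h'))]) | g h h'.
       g \<in> carrier N \<and> h \<in> carrier N \<and> h' \<in> carrier N} \<union>
    {([(True, (h, h))], []) | h. h \<in> carrier N}"

definition ext_square :: "('g, 'm) monoid_scheme \<Rightarrow> ('g \<times> 'g) word set monoid"
  where "ext_square N = presented_group (carrier N \<times> carrier N) (ext_rels N)"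

definition wedge :: "('g, 'm) monoid_scheme \<Rightarrow> 'g \<Rightarrow> 'g \<Rightarrow> ('g \<times> 'g) word set"
  where "wedge N g h = pres_cong (carrier N \<times> carrier N) (ext_rels N) `` {[(True, (g, h))]}"

definition comm_map :: "('g, 'm) monoid_scheme \<Rightarrow> ('g \<times> 'g) word set \<Rightarrow> 'g"
  where "comm_map N =
    (THE f. f \<in> hom (ext_square N) (N\<lparr>carrier := derived N (carrier N)\<rparr>) \<and>
            f \<in> extensional (carrier (ext_square N)) \<and>
            (\<forall>g\<in>carrier N. \<forall>h\<in>carrier N.
               f (wedge N g h) = g \<otimes>\<^bsub>N\<^esub> h \<otimes>\<^bsub>N\<^esub> inv\<^bsub>N\<^esub> g \<otimes>\<^bsub>N\<^esub> inv\<^bsub>N\<^esub> h))"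

definition schur_multiplier :: "('g, 'm) monoid_scheme \<Rightarrow> ('g \<times> 'g) word set monoid"
  where "schur_multiplier N = (ext_square N)
    \<lparr>carrier := kernel (ext_square N) (N\<lparr>carrier := derived N (carrier N)\<rparr>) (comm_map N)\<rparr>"

text \<open>
  For abelian \<open>N\<close> acting trivially on \<open>Q\<close>, the symbols \<open>wedge N g h\<close> generate the Schur multiplier,
  so the homomorphism described is unique.
\<close>

definition kappa_bar ::
  "('g, 'm) monoid_scheme \<Rightarrow> ('q, 'n) monoid_scheme \<Rightarrow> ('g \<times> 'g \<Rightarrow> 'q) set
    \<Rightarrow> (('g \<times> 'g) word set \<Rightarrow> 'q)"
  where "kappa_bar N Q C =
    (THE f. f \<in> hom (schur_multiplier N) Q \<and>
            f \<in> extensional (carrier (schur_multiplier N)) \<and>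
            (\<forall>\<epsilon>\<in>C. \<forall>g\<in>carrier N. \<forall>h\<in>carrier N.
               f (wedge N g h) = \<epsilon> (g, h) \<otimes>\<^bsub>Q\<^esub> inv\<^bsub>Q\<^esub> \<epsilon> (h, g)))"

definition Delta ::
  "('g, 'm) monoid_scheme \<Rightarrow> ('a, 'n) monoid_scheme \<Rightarrow> ('a \<Rightarrow> 'g \<Rightarrow> 'a) \<Rightarrow> ('g \<times> 'g \<Rightarrow> 'a) set set"
  where "Delta G A act =
    {C \<in> carrier (H2 G A act).
       kappa_bar (gam_group G) (quot_A G A act) (sigma_bar G A act C)
         ` carrier (schur_multiplier (gam_group G)) = carrier (quot_A G A act)}"

end

theory Submission
  imports Defs
begin

text \<open>
  Let \<open>E\<close> be an extension of \<open>A\<close> by \<open>G\<close> and let \<open>P\<close> be the preimage of \<open>\<gamma>(G)\<close> in \<open>E\<close>. The term of the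
  derived series of \<open>E\<close> lying above \<open>\<gamma>(G)\<close> is a subgroup of \<open>P\<close>, and it is all of \<open>P\<close> as soon as
  \<open>P' = A\<close>; hence \<open>E\<close> is a derived series extension if and only if \<open>P' = A\<close>. Modulo \<open>U = [A, \<gamma>(G)]\<close>, which
  is contained in \<open>P'\<close>, the group \<open>P\<close> is a central extension of \<open>\<gamma>(G)\<close>, and its commutators are the values
  \<open>\<delta>(g, h) - \<delta>(h, g)\<close>, which generate the image of the homomorphism on the exterior square. So \<open>\<Delta>\<close>
  consists of the classes of derived series extensions. As \<open>A\<close> is characteristic in those, their
  isomorphisms are the maps sending \<open>(g, a)\<close> to \<open>(\<eta> g, \<nu> a + \<epsilon> g)\<close> with \<open>(\<eta>, \<nu>)\<close> a compatible pair
  that carries one class to the other.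
\<close>

section \<open>The last non-trivial term of the derived series\<close>

text \<open>One relation, \<open>twist\<close>, carries all of the cohomology. For the identity pair
  it says that two cocycles differ by a coboundary. For a compatible pair it says that the pair
  moves one class to the other, and equally that a map above this pair is a homomorphism of
  extensions. Classes, orbits and isomorphisms are therefore compared by composing and cancelling
  twists, and the unions over representatives in \<open>H2_act\<close> collapse. The image of
  \<open>kappa_bar\<close> has to be found although \<open>kappa_bar\<close> is a definite
  description on a presented group. The exterior square is never computed: a homomorphism out of a
  presented group is evaluation of words, so its image is the subgroup generated by the values on
  the symbols. The commutator of (g, a) and (h, b) is not simply the difference c of the second
  components of the two products, but c moved by the inverse of hg. Since hg lies in \<gamma>(G),
  this changes c by an element of U only, and U is itself produced by commutators.\<close>

lemma is_last_derived_unique: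
  "is_last_derived E K \<Longrightarrow> is_last_derived E K' \<Longrightarrow> K = K'"
  unfolding is_last_derived_def by blast

lemma gam_eqI: "is_last_derived G K \<Longrightarrow> gam G = K"
  unfolding gam_def by (rule the_equality, assumption, rule is_last_derived_unique)

lemma (in group) derived_one: "derived G {\<one>} = {\<one>}"
proof -
  have "derived G {\<one>} \<subseteq> {\<one>}"
    by (rule derived_incl[OF subset_refl triv_subgroup])
  moreover have "\<one> \<in> derived G {\<one>}"
    using subgroup.one_closed[OF derived_is_subgroup[of "{\<one>}"]] by simp
  ultimately show ?thesis by blast
qed

lemma (in group) derived_series_antimono:
  assumes "m \<le> n"
  shows "(derived G ^^ n) (carrier G) \<subseteq> (derived G ^^ m) (carrier G)"
  using assms
proof (induction n rule: dec_induct)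
  case (step n)
  have "derived G ((derived G ^^ n) (carrier G)) \<subseteq> (derived G ^^ n) (carrier G)"
    by (rule derived_incl[OF subset_refl exp_of_derived_is_subgroup[OF subgroup_self]])
  with step.IH show ?case by simp
qed simp

lemma (in group) derived_series_trivial_mono:
  assumes "m \<le> n" "(derived G ^^ m) (carrier G) = {\<one>}"
  shows "(derived G ^^ n) (carrier G) = {\<one>}"
  using assms by (induction n rule: dec_induct) (simp_all add: derived_one)

text \<open>Once trivial, the series stays trivial, so every non-trivial term has index at most
  \<open>n\<close> and hence contains the \<open>n\<close>-th term.\<close>

lemma (in group) is_last_derivedI:
  assumes "(derived G ^^ n) (carrier G) \<noteq> {\<one>}" "(derived G ^^ Suc n) (carrier G) = {\<one>}"
  shows "is_last_derived G ((derived G ^^ n) (carrier G))"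
  unfolding is_last_derived_def
proof (intro conjI allI impI)
  fix m assume "(derived G ^^ m) (carrier G) \<noteq> {\<one>}"
  then have "\<not> Suc n \<le> m" using derived_series_trivial_mono assms(2) by blast
  then show "(derived G ^^ n) (carrier G) \<subseteq> (derived G ^^ m) (carrier G)"
    by (intro derived_series_antimono) simp
qed (use assms in auto)

lemma (in group) solvable_last_derived:
  assumes "solvable G" "carrier G \<noteq> {\<one>}"
  obtains n where "(derived G ^^ n) (carrier G) = gam G" "derived G (gam G) = {\<one>}"
    "gam G \<noteq> {\<one>}" "is_last_derived G (gam G)"
proof -
  \<comment> \<open>The least index of a trivial term is positive because the group is non-trivial,
    so its predecessor \<open>n\<close> is the index of the last non-trivial term.\<close>
  define k where "k = (LEAST k. (derived G ^^ k) (carrier G) = {\<one>})"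
  have "\<exists>k. (derived G ^^ k) (carrier G) = {\<one>}"
    using assms(1) solvable_imp_trivial_derived_seq unfolding solvable_def by blast
  then have k: "(derived G ^^ k) (carrier G) = {\<one>}"
    unfolding k_def by (rule LeastI_ex)
  then have "k \<noteq> 0" using assms(2) by (metis funpow_0)
  then obtain n where n: "k = Suc n" by (cases k) auto
  then have ne: "(derived G ^^ n) (carrier G) \<noteq> {\<one>}"
    using not_less_Least[of n "\<lambda>k. (derived G ^^ k) (carrier G) = {\<one>}"] k_def by auto
  have last: "is_last_derived G ((derived G ^^ n) (carrier G))"
    using is_last_derivedI ne k n by blast
  have gam: "gam G = (derived G ^^ n) (carrier G)" by (rule gam_eqI[OF last])
  show ?thesis
  proof (rule that)
    show "(derived G ^^ n) (carrier G) = gam G" by (simp only: gam)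
    show "derived G (gam G) = {\<one>}" using k n by (simp only: gam funpow.simps o_apply)
    show "gam G \<noteq> {\<one>}" using ne by (simp only: gam not_False_eq_True)
    show "is_last_derived G (gam G)" using last by (simp only: gam)
  qed
qed

text \<open>A homomorphism maps derived subgroups to derived subgroups of images, so the two series
  correspond index by index, and injectivity reflects triviality. With the uniqueness of the last
  term this makes isomorphisms respect \<open>A\<close>.\<close>

lemma is_last_derived_iso:
  assumes "group E" "group F" "f \<in> iso E F" "is_last_derived E K"
  shows "is_last_derived F (f ` K)"
proof -
  interpret group_hom E F f
    using assms(1-3) by (simp add: group_hom_def group_hom_axioms_def iso_def)
  have f: "f ` carrier E = carrier F" "inj_on f (carrier E)"
    using assms(3) by (auto simp: iso_def bij_betw_def)
  have im: "(derived F ^^ n) (carrier F) = f ` (derived E ^^ n) (carrier E)" for n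
    using exp_of_derived_img[OF subset_refl, of n] f by simp
  have triv: "f ` S = {\<one>\<^bsub>F\<^esub>} \<longleftrightarrow> S = {\<one>\<^bsub>E\<^esub>}" if "S \<subseteq> carrier E" for S
  proof -
    have "f ` S = {\<one>\<^bsub>F\<^esub>} \<longleftrightarrow> f ` S = f ` {\<one>\<^bsub>E\<^esub>}" by simp
    also have "\<dots> \<longleftrightarrow> S = {\<one>\<^bsub>E\<^esub>}"
      by (rule inj_on_image_eq_iff[OF f(2) that]) simp
    finally show ?thesis .
  qed
  have sub: "(derived E ^^ n) (carrier E) \<subseteq> carrier E" for n
    by (rule G.exp_of_derived_in_carrier) simp
  show ?thesis
    unfolding is_last_derived_def
  proof (intro conjI allI impI)
    obtain n where n: "K = (derived E ^^ n) (carrier E)"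
      using assms(4) unfolding is_last_derived_def by blast
    then show "\<exists>n. f ` K = (derived F ^^ n) (carrier F)" using im by blast
    show "f ` K \<noteq> {\<one>\<^bsub>F\<^esub>}"
      using assms(4) triv[OF sub, of n] n unfolding is_last_derived_def by simp
    fix m assume "(derived F ^^ m) (carrier F) \<noteq> {\<one>\<^bsub>F\<^esub>}"
    then have "(derived E ^^ m) (carrier E) \<noteq> {\<one>\<^bsub>E\<^esub>}" using im triv[OF sub] by simp
    then have "K \<subseteq> (derived E ^^ m) (carrier E)"
      using assms(4) unfolding is_last_derived_def by simp
    then show "f ` K \<subseteq> (derived F ^^ m) (carrier F)" unfolding im by (rule image_mono)
  qed
qed


section \<open>The extension defined by a cocycle\<close>

sublocale gmodule \<subseteq> G: group G
  by (rule group_G)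

sublocale gmodule \<subseteq> A: comm_group A
  by (rule comm_group_A)

context gmodule
begin

lemma act_closed [simp, intro]: "\<lbrakk>a \<in> carrier A; g \<in> carrier G\<rbrakk> \<Longrightarrow> act a g \<in> carrier A"
  using act_hom hom_in_carrier by fastforce

lemma act_mult_distrib:
  "\<lbrakk>a \<in> carrier A; b \<in> carrier A; g \<in> carrier G\<rbrakk>
    \<Longrightarrow> act (a \<otimes>\<^bsub>A\<^esub> b) g = act a g \<otimes>\<^bsub>A\<^esub> act b g"
  using act_hom[of g] by (simp add: hom_def)

lemma act_group_hom: "g \<in> carrier G \<Longrightarrow> group_hom A A (\<lambda>a. act a g)"
  using act_hom by (simp add: group_hom_def group_hom_axioms_def)

lemma act_one_left [simp]: "g \<in> carrier G \<Longrightarrow> act \<one>\<^bsub>A\<^esub> g = \<one>\<^bsub>A\<^esub>"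
  using group_hom.hom_one[OF act_group_hom] .

lemma act_inv: "\<lbrakk>a \<in> carrier A; g \<in> carrier G\<rbrakk> \<Longrightarrow> act (inv\<^bsub>A\<^esub> a) g = inv\<^bsub>A\<^esub> act a g"
  using group_hom.hom_inv[OF act_group_hom] .

lemma act_cancel [simp]:
  assumes "a \<in> carrier A" "g \<in> carrier G"
  shows "act (act a (inv\<^bsub>G\<^esub> g)) g = a" "act (act a g) (inv\<^bsub>G\<^esub> g) = a"
  using assms act_mult[of a "inv\<^bsub>G\<^esub> g" g] act_mult[of a g "inv\<^bsub>G\<^esub> g"] act_one by simp_all

abbreviation ext where "ext \<delta> \<equiv> cocycle_ext G A act \<delta>"

lemma cocycle_closed [simp, intro]:
  "\<lbrakk>\<delta> \<in> cocycles2 G A act; g \<in> carrier G; h \<in> carrier G\<rbrakk> \<Longrightarrow> \<delta> (g, h) \<in> carrier A"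
  unfolding cocycles2_def by (auto dest: PiE_mem)

lemma cocycle_eq:
  "\<lbrakk>\<delta> \<in> cocycles2 G A act; g \<in> carrier G; h \<in> carrier G; k \<in> carrier G\<rbrakk>
    \<Longrightarrow> act (\<delta> (g, h)) k \<otimes>\<^bsub>A\<^esub> \<delta> (g \<otimes>\<^bsub>G\<^esub> h, k) = \<delta> (h, k) \<otimes>\<^bsub>A\<^esub> \<delta> (g, h \<otimes>\<^bsub>G\<^esub> k)"
  unfolding cocycles2_def by auto

lemma cocycle_one [simp]:
  assumes "\<delta> \<in> cocycles2 G A act" "g \<in> carrier G"
  shows "\<delta> (g, \<one>\<^bsub>G\<^esub>) = \<one>\<^bsub>A\<^esub>" "\<delta> (\<one>\<^bsub>G\<^esub>, g) = \<one>\<^bsub>A\<^esub>"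
  using assms unfolding cocycles2_def by auto

lemma ext_simps [simp]:
  "carrier (ext \<delta>) = carrier G \<times> carrier A"
  "(g, a) \<otimes>\<^bsub>ext \<delta>\<^esub> (h, b) = (g \<otimes>\<^bsub>G\<^esub> h, act a h \<otimes>\<^bsub>A\<^esub> b \<otimes>\<^bsub>A\<^esub> \<delta> (g, h))"
  "\<one>\<^bsub>ext \<delta>\<^esub> = (\<one>\<^bsub>G\<^esub>, \<one>\<^bsub>A\<^esub>)"
  by (simp_all add: cocycle_ext_def)

text \<open>Associativity is the cocycle identity, and normalisation makes the pair of units
  neutral.\<close>

lemma group_ext:
  assumes d: "\<delta> \<in> cocycles2 G A act"
  shows "group (ext \<delta>)"
proof (rule groupI)
  fix x y assume "x \<in> carrier (ext \<delta>)" "y \<in> carrier (ext \<delta>)"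
  then show "x \<otimes>\<^bsub>ext \<delta>\<^esub> y \<in> carrier (ext \<delta>)"
    using d by (cases x; cases y) auto
next
  fix x y z assume "x \<in> carrier (ext \<delta>)" "y \<in> carrier (ext \<delta>)" "z \<in> carrier (ext \<delta>)"
  moreover obtain g a h b k c where "x = (g, a)" "y = (h, b)" "z = (k, c)"
    by (cases x; cases y; cases z) auto
  ultimately show "x \<otimes>\<^bsub>ext \<delta>\<^esub> y \<otimes>\<^bsub>ext \<delta>\<^esub> z = x \<otimes>\<^bsub>ext \<delta>\<^esub> (y \<otimes>\<^bsub>ext \<delta>\<^esub> z)"
    using d cocycle_eq[OF d, of g h k]
    by (simp add: G.m_assoc act_mult_distrib act_mult A.m_assoc A.m_lcomm)
next
  show "\<one>\<^bsub>ext \<delta>\<^esub> \<in> carrier (ext \<delta>)" by simp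
next
  fix x assume "x \<in> carrier (ext \<delta>)"
  then show "\<one>\<^bsub>ext \<delta>\<^esub> \<otimes>\<^bsub>ext \<delta>\<^esub> x = x"
    using d by (cases x) auto
next
  fix x assume "x \<in> carrier (ext \<delta>)"
  moreover obtain g a where x: "x = (g, a)" by (cases x)
  ultimately have ga: "g \<in> carrier G" "a \<in> carrier A" by auto
  \<comment> \<open>The solution of b^g + a + \<delta>(g^-1, g) = 0, which is the condition on the
    second component of a left inverse.\<close>
  define b where "b = act (inv\<^bsub>A\<^esub> (a \<otimes>\<^bsub>A\<^esub> \<delta> (inv\<^bsub>G\<^esub> g, g))) (inv\<^bsub>G\<^esub> g)"
  have "act b g \<otimes>\<^bsub>A\<^esub> a \<otimes>\<^bsub>A\<^esub> \<delta> (inv\<^bsub>G\<^esub> g, g) = \<one>\<^bsub>A\<^esub>"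
    unfolding b_def using d ga by (simp add: A.m_assoc)
  then have "(inv\<^bsub>G\<^esub> g, b) \<otimes>\<^bsub>ext \<delta>\<^esub> x = \<one>\<^bsub>ext \<delta>\<^esub>" using ga x by simp
  moreover have "(inv\<^bsub>G\<^esub> g, b) \<in> carrier (ext \<delta>)" using d ga by (simp add: b_def)
  ultimately show "\<exists>y\<in>carrier (ext \<delta>). y \<otimes>\<^bsub>ext \<delta>\<^esub> x = \<one>\<^bsub>ext \<delta>\<^esub>" by blast
qed

lemma fst_group_hom: "\<delta> \<in> cocycles2 G A act \<Longrightarrow> group_hom (ext \<delta>) G fst"
  using group_ext by (auto simp: group_hom_def group_hom_axioms_def hom_def)

lemma ext_embed_group_hom: "\<delta> \<in> cocycles2 G A act \<Longrightarrow> group_hom A (ext \<delta>) (ext_embed G)"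
  using group_ext by (auto simp: group_hom_def group_hom_axioms_def hom_def ext_embed_def act_one)

lemma image_ext_embed: "ext_embed G ` S = {\<one>\<^bsub>G\<^esub>} \<times> S"
  by (auto simp: ext_embed_def)

lemma extension_ext:
  assumes d: "\<delta> \<in> cocycles2 G A act"
  shows "extension G A act (ext \<delta>) (ext_embed G) fst"
proof -
  interpret E: group "ext \<delta>" using group_ext[OF d] .
  have "ext_embed G ` carrier A = kernel (ext \<delta>) G fst"
    unfolding image_ext_embed kernel_def by auto
  moreover have "fst ` carrier (ext \<delta>) = carrier G"
    using A.one_closed by (auto simp: image_iff)
  moreover have "inv\<^bsub>ext \<delta>\<^esub> e \<otimes>\<^bsub>ext \<delta>\<^esub> ext_embed G a \<otimes>\<^bsub>ext \<delta>\<^esub> e = ext_embed G (act a (fst e))"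
    if e: "e \<in> carrier (ext \<delta>)" and a: "a \<in> carrier A" for e a
  proof -
    obtain g b where gb: "e = (g, b)" "g \<in> carrier G" "b \<in> carrier A" using e by auto
    \<comment> \<open>Written as a commutation rule, conjugation needs no formula for inverses in
      the extension.\<close>
    have "ext_embed G a \<otimes>\<^bsub>ext \<delta>\<^esub> e = e \<otimes>\<^bsub>ext \<delta>\<^esub> ext_embed G (act a g)"
      using gb a d by (simp add: ext_embed_def act_one A.m_comm)
    moreover have "ext_embed G a \<in> carrier (ext \<delta>)" "ext_embed G (act a (fst e)) \<in> carrier (ext \<delta>)"
      using gb a by (simp_all add: ext_embed_def)
    ultimately show ?thesis
      using e gb by (simp add: E.m_assoc E.inv_solve_left' del: ext_simps)
  qed
  ultimately show ?thesis
    using fst_group_hom[OF d] ext_embed_group_hom[OF d]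
    unfolding extension_def short_exact_def group_hom_def group_hom_axioms_def
    by (auto simp: inj_on_def ext_embed_def)
qed

end


section \<open>Isomorphisms of extensions and cohomology classes\<close>

context gmodule
begin

lemma CompD:
  assumes "(\<eta>, \<nu>) \<in> carrier (Comp G A act)"
  shows "\<eta> \<in> auto G" "\<nu> \<in> auto A"
    "group_hom G G \<eta>" "group_hom A A \<nu>"
    "bij_betw \<eta> (carrier G) (carrier G)" "bij_betw \<nu> (carrier A) (carrier A)"
    "\<lbrakk>g \<in> carrier G; a \<in> carrier A\<rbrakk> \<Longrightarrow> act (\<nu> a) (\<eta> g) = \<nu> (act a g)"
  using assms unfolding Comp_def auto_def Bij_def
  by (auto simp: group_hom_def group_hom_axioms_def)

lemma Comp_surj:
  assumes "(\<eta>, \<nu>) \<in> carrier (Comp G A act)"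
  shows "k \<in> carrier G \<Longrightarrow> \<exists>g\<in>carrier G. k = \<eta> g" "b \<in> carrier A \<Longrightarrow> \<exists>a\<in>carrier A. b = \<nu> a"
  using bij_betw_imp_surj_on[OF CompD(5)[OF assms]] bij_betw_imp_surj_on[OF CompD(6)[OF assms]]
  by (simp_all only: set_eq_iff image_iff)

text \<open>Members of \<open>auto\<close> are extensional, so the neutral pair consists of
  restricted identities; \<open>cohom\<close> is built from the same two functions so that results
  on \<open>twist\<close> apply to it.\<close>

lemma id_Comp: "(\<lambda>x\<in>carrier G. x, \<lambda>x\<in>carrier A. x) \<in> carrier (Comp G A act)"
  unfolding Comp_def using G.id_in_auto A.id_in_auto by auto

text \<open>The condition under which the map sending \<open>(g, a)\<close> to \<open>(\<eta> g, \<nu> a \<otimes> \<epsilon> g)\<close> is a homomorphism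
  from the extension of \<open>\<delta>\<close> to that of \<open>\<delta>'\<close>.\<close>

definition twist where
  "twist \<eta> \<nu> \<epsilon> \<delta> \<delta>' \<longleftrightarrow> \<epsilon> \<in> carrier G \<rightarrow> carrier A \<and>
    (\<forall>g\<in>carrier G. \<forall>h\<in>carrier G.
      \<nu> (\<delta> (g, h)) \<otimes>\<^bsub>A\<^esub> \<epsilon> (g \<otimes>\<^bsub>G\<^esub> h) = act (\<epsilon> g) (\<eta> h) \<otimes>\<^bsub>A\<^esub> \<epsilon> h \<otimes>\<^bsub>A\<^esub> \<delta>' (\<eta> g, \<eta> h))"

abbreviation cohom where "cohom \<equiv> twist (\<lambda>x\<in>carrier G. x) (\<lambda>x\<in>carrier A. x)"

lemma twistD:
  assumes "twist \<eta> \<nu> \<epsilon> \<delta> \<delta>'"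
  shows "\<epsilon> \<in> carrier G \<rightarrow> carrier A" "g \<in> carrier G \<Longrightarrow> \<epsilon> g \<in> carrier A"
    "\<lbrakk>g \<in> carrier G; h \<in> carrier G\<rbrakk> \<Longrightarrow>
      \<nu> (\<delta> (g, h)) \<otimes>\<^bsub>A\<^esub> \<epsilon> (g \<otimes>\<^bsub>G\<^esub> h) = act (\<epsilon> g) (\<eta> h) \<otimes>\<^bsub>A\<^esub> \<epsilon> h \<otimes>\<^bsub>A\<^esub> \<delta>' (\<eta> g, \<eta> h)"
  using assms unfolding twist_def by auto

text \<open>Composing with a restricted identity gives back a pair only up to agreement on the
  carriers; this lemma repairs that.\<close>

lemma twist_cong:
  assumes "twist \<eta> \<nu> \<epsilon> \<delta> \<delta>'" "\<delta> \<in> cocycles2 G A act"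
    and "\<And>g. g \<in> carrier G \<Longrightarrow> \<eta> g = \<eta>' g" "\<And>a. a \<in> carrier A \<Longrightarrow> \<nu> a = \<nu>' a"
  shows "twist \<eta>' \<nu>' \<epsilon> \<delta> \<delta>'"
  using assms(1,2) unfolding twist_def by (simp add: assms(3,4))

text \<open>The new cochain is read off from composing the two maps: the second component \<nu> a +
  \<epsilon> g is sent to \<mu> (\<nu> a) + \<mu> (\<epsilon> g) + \<zeta> (\<eta> g).\<close>

lemma twist_comp:
  assumes p: "(\<eta>, \<nu>) \<in> carrier (Comp G A act)" and q: "(\<theta>, \<mu>) \<in> carrier (Comp G A act)"
    and d: "\<delta> \<in> cocycles2 G A act" "\<delta>' \<in> cocycles2 G A act" "\<delta>'' \<in> cocycles2 G A act"
    and t: "twist \<eta> \<nu> \<epsilon> \<delta> \<delta>'" "twist \<theta> \<mu> \<zeta> \<delta>' \<delta>''"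
  shows "twist (\<theta> \<circ> \<eta>) (\<mu> \<circ> \<nu>) (\<lambda>g. \<mu> (\<epsilon> g) \<otimes>\<^bsub>A\<^esub> \<zeta> (\<eta> g)) \<delta> \<delta>''"
proof -
  interpret \<eta>: group_hom G G \<eta> by (rule CompD(3)[OF p])
  interpret \<nu>: group_hom A A \<nu> by (rule CompD(4)[OF p])
  interpret \<theta>: group_hom G G \<theta> by (rule CompD(3)[OF q])
  interpret \<mu>: group_hom A A \<mu> by (rule CompD(4)[OF q])
  have e: "\<epsilon> g \<in> carrier A" "\<zeta> g \<in> carrier A" if "g \<in> carrier G" for g
    using t that by (auto dest: twistD(2))
  have "\<mu> (\<nu> (\<delta> (g, h))) \<otimes>\<^bsub>A\<^esub> (\<mu> (\<epsilon> (g \<otimes>\<^bsub>G\<^esub> h)) \<otimes>\<^bsub>A\<^esub> \<zeta> (\<eta> (g \<otimes>\<^bsub>G\<^esub> h)))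
      = act (\<mu> (\<epsilon> g) \<otimes>\<^bsub>A\<^esub> \<zeta> (\<eta> g)) (\<theta> (\<eta> h)) \<otimes>\<^bsub>A\<^esub> (\<mu> (\<epsilon> h) \<otimes>\<^bsub>A\<^esub> \<zeta> (\<eta> h))
        \<otimes>\<^bsub>A\<^esub> \<delta>'' (\<theta> (\<eta> g), \<theta> (\<eta> h))"
    if gh: "g \<in> carrier G" "h \<in> carrier G" for g h
  proof -
    \<comment> \<open>The first condition pushed through \<mu>, where compatibility of (\<theta>,
      \<mu>) moves \<mu> inside the action.\<close>
    have 1: "\<mu> (\<nu> (\<delta> (g, h))) \<otimes>\<^bsub>A\<^esub> \<mu> (\<epsilon> (g \<otimes>\<^bsub>G\<^esub> h))
        = act (\<mu> (\<epsilon> g)) (\<theta> (\<eta> h)) \<otimes>\<^bsub>A\<^esub> \<mu> (\<epsilon> h) \<otimes>\<^bsub>A\<^esub> \<mu> (\<delta>' (\<eta> g, \<eta> h))"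
      using arg_cong[OF twistD(3)[OF t(1) gh], of \<mu>] gh d e by (simp add: CompD(7)[OF q])
    have 2: "\<mu> (\<delta>' (\<eta> g, \<eta> h)) \<otimes>\<^bsub>A\<^esub> \<zeta> (\<eta> g \<otimes>\<^bsub>G\<^esub> \<eta> h)
        = act (\<zeta> (\<eta> g)) (\<theta> (\<eta> h)) \<otimes>\<^bsub>A\<^esub> \<zeta> (\<eta> h) \<otimes>\<^bsub>A\<^esub> \<delta>'' (\<theta> (\<eta> g), \<theta> (\<eta> h))"
      using twistD(3)[OF t(2), of "\<eta> g" "\<eta> h"] gh by simp
    have "\<mu> (\<nu> (\<delta> (g, h))) \<otimes>\<^bsub>A\<^esub> (\<mu> (\<epsilon> (g \<otimes>\<^bsub>G\<^esub> h)) \<otimes>\<^bsub>A\<^esub> \<zeta> (\<eta> (g \<otimes>\<^bsub>G\<^esub> h)))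
        = (act (\<mu> (\<epsilon> g)) (\<theta> (\<eta> h)) \<otimes>\<^bsub>A\<^esub> \<mu> (\<epsilon> h)) \<otimes>\<^bsub>A\<^esub> (\<mu> (\<delta>' (\<eta> g, \<eta> h)) \<otimes>\<^bsub>A\<^esub> \<zeta> (\<eta> g \<otimes>\<^bsub>G\<^esub> \<eta> h))"
      using gh d e 1 by (simp add: A.m_assoc[symmetric])
    then show ?thesis
      unfolding 2 using gh d e by (simp add: act_mult_distrib A.m_ac)
  qed
  then show ?thesis
    using e unfolding twist_def by auto
qed

text \<open>For independence of representatives: whether a pair admits a twist depends on the class
  of the source only. Its mirror image \<open>twist_comp_cohom_right\<close> does the same for the
  target.\<close>

lemma twist_comp_cohom_left:
  assumes "(\<eta>, \<nu>) \<in> carrier (Comp G A act)"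
    "\<delta> \<in> cocycles2 G A act" "\<delta>' \<in> cocycles2 G A act" "\<delta>'' \<in> cocycles2 G A act"
    "cohom \<epsilon> \<delta> \<delta>'" "twist \<eta> \<nu> \<zeta> \<delta>' \<delta>''"
  shows "\<exists>\<xi>. twist \<eta> \<nu> \<xi> \<delta> \<delta>''"
  using twist_cong[OF twist_comp[OF id_Comp assms] assms(2), of \<eta> \<nu>] by auto

lemma twist_comp_cohom_right:
  assumes "(\<eta>, \<nu>) \<in> carrier (Comp G A act)"
    "\<delta> \<in> cocycles2 G A act" "\<delta>' \<in> cocycles2 G A act" "\<delta>'' \<in> cocycles2 G A act"
    "twist \<eta> \<nu> \<epsilon> \<delta> \<delta>'" "cohom \<zeta> \<delta>' \<delta>''"
  shows "\<exists>\<xi>. twist \<eta> \<nu> \<xi> \<delta> \<delta>''"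
proof -
  interpret \<eta>: group_hom G G \<eta> by (rule CompD(3)[OF assms(1)])
  interpret \<nu>: group_hom A A \<nu> by (rule CompD(4)[OF assms(1)])
  show ?thesis
    using twist_cong[OF twist_comp[OF assms(1) id_Comp assms(2-)] assms(2), of \<eta> \<nu>] by auto
qed

text \<open>Following one of the two maps backwards and the other forwards gives a map above the
  identity pair. Its cochain is the difference of the two cochains, transported along the inverse of
  \<eta>. Taken at the identity pair, this yields the symmetry of \<open>cohom\<close>.\<close>

lemma twist_twist_imp_cohom:
  assumes p: "(\<eta>, \<nu>) \<in> carrier (Comp G A act)"
    and d: "\<delta> \<in> cocycles2 G A act" "\<delta>' \<in> cocycles2 G A act" "\<delta>'' \<in> cocycles2 G A act"
    and t: "twist \<eta> \<nu> \<epsilon> \<delta> \<delta>'" "twist \<eta> \<nu> \<zeta> \<delta> \<delta>''"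
  shows "\<exists>\<xi>. cohom \<xi> \<delta>' \<delta>''"
proof -
  interpret \<eta>: group_hom G G \<eta> by (rule CompD(3)[OF p])
  interpret \<nu>: group_hom A A \<nu> by (rule CompD(4)[OF p])
  have e: "\<epsilon> g \<in> carrier A" "\<zeta> g \<in> carrier A" if "g \<in> carrier G" for g
    using t that by (auto dest: twistD(2))
  define \<psi> where "\<psi> = inv_into (carrier G) \<eta>"
  have inj: "inj_on \<eta> (carrier G)"
    using CompD(5)[OF p] by (auto simp: bij_betw_def)
  define \<xi> where "\<xi> k = \<zeta> (\<psi> k) \<otimes>\<^bsub>A\<^esub> inv\<^bsub>A\<^esub> \<epsilon> (\<psi> k)" for k
  have \<psi>: "\<psi> (\<eta> g) = g" if "g \<in> carrier G" for g
    using inj that by (simp add: \<psi>_def)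
  have \<xi>: "\<xi> (\<eta> g) \<otimes>\<^bsub>A\<^esub> \<epsilon> g = \<zeta> g" "\<xi> (\<eta> g) \<in> carrier A" if "g \<in> carrier G" for g
    using that e[OF that] by (simp_all add: \<xi>_def \<psi> A.m_assoc)
  have main: "\<delta>' (\<eta> g, \<eta> h) \<otimes>\<^bsub>A\<^esub> \<xi> (\<eta> g \<otimes>\<^bsub>G\<^esub> \<eta> h)
      = act (\<xi> (\<eta> g)) (\<eta> h) \<otimes>\<^bsub>A\<^esub> \<xi> (\<eta> h) \<otimes>\<^bsub>A\<^esub> \<delta>'' (\<eta> g, \<eta> h)"
    if gh: "g \<in> carrier G" "h \<in> carrier G" for g h
  proof -
    \<comment> \<open>The \<epsilon>-part of the first condition. Both sides of the goal are
      computed with \<open>c\<close> added, and it is cancelled at the end.\<close>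
    define c where "c = act (\<epsilon> g) (\<eta> h) \<otimes>\<^bsub>A\<^esub> \<epsilon> h"
    have c: "c \<in> carrier A" using gh e by (simp add: c_def)
    have "c \<otimes>\<^bsub>A\<^esub> \<delta>' (\<eta> g, \<eta> h) \<otimes>\<^bsub>A\<^esub> \<xi> (\<eta> (g \<otimes>\<^bsub>G\<^esub> h))
        = \<nu> (\<delta> (g, h)) \<otimes>\<^bsub>A\<^esub> \<epsilon> (g \<otimes>\<^bsub>G\<^esub> h) \<otimes>\<^bsub>A\<^esub> \<xi> (\<eta> (g \<otimes>\<^bsub>G\<^esub> h))"
      using twistD(3)[OF t(1) gh] gh unfolding c_def by simp
    also have "\<dots> = \<nu> (\<delta> (g, h)) \<otimes>\<^bsub>A\<^esub> (\<xi> (\<eta> (g \<otimes>\<^bsub>G\<^esub> h)) \<otimes>\<^bsub>A\<^esub> \<epsilon> (g \<otimes>\<^bsub>G\<^esub> h))"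
      using gh d e \<xi>(2)[of "g \<otimes>\<^bsub>G\<^esub> h"] by (simp add: A.m_ac)
    also have "\<dots> = \<nu> (\<delta> (g, h)) \<otimes>\<^bsub>A\<^esub> \<zeta> (g \<otimes>\<^bsub>G\<^esub> h)"
      using gh by (simp only: \<xi>(1) G.m_closed)
    also have "\<dots> = act (\<zeta> g) (\<eta> h) \<otimes>\<^bsub>A\<^esub> \<zeta> h \<otimes>\<^bsub>A\<^esub> \<delta>'' (\<eta> g, \<eta> h)"
      using twistD(3)[OF t(2) gh] .
    also have "\<dots> = act (\<xi> (\<eta> g) \<otimes>\<^bsub>A\<^esub> \<epsilon> g) (\<eta> h) \<otimes>\<^bsub>A\<^esub> (\<xi> (\<eta> h) \<otimes>\<^bsub>A\<^esub> \<epsilon> h) \<otimes>\<^bsub>A\<^esub> \<delta>'' (\<eta> g, \<eta> h)"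
      using gh by (simp only: \<xi>(1))
    also have "\<dots> = c \<otimes>\<^bsub>A\<^esub> (act (\<xi> (\<eta> g)) (\<eta> h) \<otimes>\<^bsub>A\<^esub> \<xi> (\<eta> h) \<otimes>\<^bsub>A\<^esub> \<delta>'' (\<eta> g, \<eta> h))"
      unfolding c_def using gh d e \<xi>(2) by (simp add: act_mult_distrib A.m_ac)
    finally have "c \<otimes>\<^bsub>A\<^esub> (\<delta>' (\<eta> g, \<eta> h) \<otimes>\<^bsub>A\<^esub> \<xi> (\<eta> (g \<otimes>\<^bsub>G\<^esub> h)))
        = c \<otimes>\<^bsub>A\<^esub> (act (\<xi> (\<eta> g)) (\<eta> h) \<otimes>\<^bsub>A\<^esub> \<xi> (\<eta> h) \<otimes>\<^bsub>A\<^esub> \<delta>'' (\<eta> g, \<eta> h))"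
      by (subst (asm) A.m_assoc) (use c gh d \<xi>(2) \<xi>(2)[of "g \<otimes>\<^bsub>G\<^esub> h"] in simp_all)
    then have "\<delta>' (\<eta> g, \<eta> h) \<otimes>\<^bsub>A\<^esub> \<xi> (\<eta> (g \<otimes>\<^bsub>G\<^esub> h))
        = act (\<xi> (\<eta> g)) (\<eta> h) \<otimes>\<^bsub>A\<^esub> \<xi> (\<eta> h) \<otimes>\<^bsub>A\<^esub> \<delta>'' (\<eta> g, \<eta> h)"
      by (subst (asm) A.Units_l_cancel) (use c gh d \<xi>(2) \<xi>(2)[of "g \<otimes>\<^bsub>G\<^esub> h"] in simp_all)
    then show ?thesis using gh by simp
  qed
  have c: "cohom \<xi> \<delta>' \<delta>''"
    unfolding twist_def
  proof (intro conjI ballI funcsetI)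
    fix k assume "k \<in> carrier G"
    from Comp_surj(1)[OF p this] show "\<xi> k \<in> carrier A" using \<xi>(2) by auto
  next
    fix k l assume "k \<in> carrier G" "l \<in> carrier G"
    moreover from this obtain g h where "k = \<eta> g" "l = \<eta> h" "g \<in> carrier G" "h \<in> carrier G"
      using Comp_surj(1)[OF p] by metis
    ultimately show "(\<lambda>x\<in>carrier A. x) (\<delta>' (k, l)) \<otimes>\<^bsub>A\<^esub> \<xi> (k \<otimes>\<^bsub>G\<^esub> l)
      = act (\<xi> k) ((\<lambda>x\<in>carrier G. x) l) \<otimes>\<^bsub>A\<^esub> \<xi> l
        \<otimes>\<^bsub>A\<^esub> \<delta>'' ((\<lambda>x\<in>carrier G. x) k, (\<lambda>x\<in>carrier G. x) l)"
      using main d by simp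
  qed
  show ?thesis by (rule exI, rule c)
qed

section \<open>Cohomology as an equivalence relation on cocycles\<close>

lemma cohom_refl: "\<delta> \<in> cocycles2 G A act \<Longrightarrow> cohom (\<lambda>g. \<one>\<^bsub>A\<^esub>) \<delta> \<delta>"
  unfolding twist_def by simp

lemma cohom_sym:
  assumes "\<delta> \<in> cocycles2 G A act" "\<delta>' \<in> cocycles2 G A act" "cohom \<epsilon> \<delta> \<delta>'"
  shows "\<exists>\<xi>. cohom \<xi> \<delta>' \<delta>"
  using twist_twist_imp_cohom[OF id_Comp] cohom_refl assms by blast

text \<open>At the pair of units the condition reads e = e + e for e = \<epsilon>(1), because both
  cocycles are normalised. This provides the normalisation that \<open>B2\<close> asks of its
  cochains.\<close>

lemma twist_one:
  assumes p: "(\<eta>, \<nu>) \<in> carrier (Comp G A act)"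
    and d: "\<delta> \<in> cocycles2 G A act" "\<delta>' \<in> cocycles2 G A act" and t: "twist \<eta> \<nu> \<epsilon> \<delta> \<delta>'"
  shows "\<epsilon> \<one>\<^bsub>G\<^esub> = \<one>\<^bsub>A\<^esub>"
proof -
  interpret \<eta>: group_hom G G \<eta> by (rule CompD(3)[OF p])
  interpret \<nu>: group_hom A A \<nu> by (rule CompD(4)[OF p])
  have "\<epsilon> \<one>\<^bsub>G\<^esub> \<in> carrier A" using twistD(2)[OF t] by simp
  moreover have "\<nu> (\<delta> (\<one>\<^bsub>G\<^esub>, \<one>\<^bsub>G\<^esub>)) \<otimes>\<^bsub>A\<^esub> \<epsilon> (\<one>\<^bsub>G\<^esub> \<otimes>\<^bsub>G\<^esub> \<one>\<^bsub>G\<^esub>)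
    = act (\<epsilon> \<one>\<^bsub>G\<^esub>) (\<eta> \<one>\<^bsub>G\<^esub>) \<otimes>\<^bsub>A\<^esub> \<epsilon> \<one>\<^bsub>G\<^esub> \<otimes>\<^bsub>A\<^esub> \<delta>' (\<eta> \<one>\<^bsub>G\<^esub>, \<eta> \<one>\<^bsub>G\<^esub>)"
    by (rule twistD(3)[OF t]) simp_all
  ultimately show ?thesis using d by (simp add: act_one)
qed

lemma coboundary_cocycle:
  assumes d: "\<delta> \<in> cocycles2 G A act" and e: "\<epsilon> \<in> carrier G \<rightarrow> carrier A" "\<epsilon> \<one>\<^bsub>G\<^esub> = \<one>\<^bsub>A\<^esub>"
  shows "coboundary G A act \<epsilon> \<otimes>\<^bsub>Z2 G A act\<^esub> \<delta> \<in> cocycles2 G A act"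
proof -
  have e': "\<epsilon> g \<in> carrier A" if "g \<in> carrier G" for g using e that by auto
  let ?D = "coboundary G A act \<epsilon> \<otimes>\<^bsub>Z2 G A act\<^esub> \<delta>"
  have D: "?D (g, h) = act (\<epsilon> g) h \<otimes>\<^bsub>A\<^esub> \<epsilon> h \<otimes>\<^bsub>A\<^esub> inv\<^bsub>A\<^esub> \<epsilon> (g \<otimes>\<^bsub>G\<^esub> h) \<otimes>\<^bsub>A\<^esub> \<delta> (g, h)"
    if "g \<in> carrier G" "h \<in> carrier G" for g h
    using that by (simp add: Z2_def coboundary_def)
  show ?thesis
    unfolding cocycles2_def
  proof (intro CollectI conjI ballI)
    show "?D \<in> carrier G \<times> carrier G \<rightarrow>\<^sub>E carrier A"
    proof (rule PiE_I)
      fix x assume "x \<in> carrier G \<times> carrier G"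
      then show "?D x \<in> carrier A" using e' d by (cases x) (simp add: D)
    qed (simp add: Z2_def)
  next
    fix g h k assume g: "g \<in> carrier G" "h \<in> carrier G" "k \<in> carrier G"
    \<comment> \<open>The contribution of \<epsilon> that both sides of the cocycle identity share:
      on the left the two terms with \<epsilon>(gh) cancel, on the right those with
      \<epsilon>(hk).\<close>
    define x where "x = act (act (\<epsilon> g) h) k \<otimes>\<^bsub>A\<^esub> act (\<epsilon> h) k \<otimes>\<^bsub>A\<^esub> \<epsilon> k
      \<otimes>\<^bsub>A\<^esub> inv\<^bsub>A\<^esub> \<epsilon> (g \<otimes>\<^bsub>G\<^esub> h \<otimes>\<^bsub>G\<^esub> k)"
    have x: "x \<in> carrier A" using g e' by (simp add: x_def)
    have cancel: "a \<otimes>\<^bsub>A\<^esub> (inv\<^bsub>A\<^esub> a \<otimes>\<^bsub>A\<^esub> b) = b" "inv\<^bsub>A\<^esub> a \<otimes>\<^bsub>A\<^esub> (a \<otimes>\<^bsub>A\<^esub> b) = b"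
      if "a \<in> carrier A" "b \<in> carrier A" for a b
      using that by (simp_all add: A.m_assoc[symmetric])
    have cancel': "a \<otimes>\<^bsub>A\<^esub> (b \<otimes>\<^bsub>A\<^esub> (inv\<^bsub>A\<^esub> a \<otimes>\<^bsub>A\<^esub> c)) = b \<otimes>\<^bsub>A\<^esub> c"
      if "a \<in> carrier A" "b \<in> carrier A" "c \<in> carrier A" for a b c
      using that cancel A.m_lcomm[of a b "inv\<^bsub>A\<^esub> a \<otimes>\<^bsub>A\<^esub> c"] by simp
    have "act (act (\<epsilon> g) h \<otimes>\<^bsub>A\<^esub> \<epsilon> h \<otimes>\<^bsub>A\<^esub> inv\<^bsub>A\<^esub> \<epsilon> (g \<otimes>\<^bsub>G\<^esub> h) \<otimes>\<^bsub>A\<^esub> \<delta> (g, h)) k \<otimes>\<^bsub>A\<^esub>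
        (act (\<epsilon> (g \<otimes>\<^bsub>G\<^esub> h)) k \<otimes>\<^bsub>A\<^esub> \<epsilon> k \<otimes>\<^bsub>A\<^esub> inv\<^bsub>A\<^esub> \<epsilon> (g \<otimes>\<^bsub>G\<^esub> h \<otimes>\<^bsub>G\<^esub> k) \<otimes>\<^bsub>A\<^esub> \<delta> (g \<otimes>\<^bsub>G\<^esub> h, k))
      = x \<otimes>\<^bsub>A\<^esub> (act (\<delta> (g, h)) k \<otimes>\<^bsub>A\<^esub> \<delta> (g \<otimes>\<^bsub>G\<^esub> h, k))"
      using g e' d by (simp add: x_def act_mult_distrib act_inv A.m_ac cancel)
    also have "\<dots> = x \<otimes>\<^bsub>A\<^esub> (\<delta> (h, k) \<otimes>\<^bsub>A\<^esub> \<delta> (g, h \<otimes>\<^bsub>G\<^esub> k))"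
      using cocycle_eq[OF d] g by simp
    also have "\<dots> = act (\<epsilon> h) k \<otimes>\<^bsub>A\<^esub> \<epsilon> k \<otimes>\<^bsub>A\<^esub> inv\<^bsub>A\<^esub> \<epsilon> (h \<otimes>\<^bsub>G\<^esub> k) \<otimes>\<^bsub>A\<^esub> \<delta> (h, k) \<otimes>\<^bsub>A\<^esub>
        (act (\<epsilon> g) (h \<otimes>\<^bsub>G\<^esub> k) \<otimes>\<^bsub>A\<^esub> \<epsilon> (h \<otimes>\<^bsub>G\<^esub> k) \<otimes>\<^bsub>A\<^esub> inv\<^bsub>A\<^esub> \<epsilon> (g \<otimes>\<^bsub>G\<^esub> (h \<otimes>\<^bsub>G\<^esub> k))
          \<otimes>\<^bsub>A\<^esub> \<delta> (g, h \<otimes>\<^bsub>G\<^esub> k))"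
      using g e' d by (simp add: x_def act_mult G.m_assoc A.m_ac cancel cancel')
    finally show "act (?D (g, h)) k \<otimes>\<^bsub>A\<^esub> ?D (g \<otimes>\<^bsub>G\<^esub> h, k) = ?D (h, k) \<otimes>\<^bsub>A\<^esub> ?D (g, h \<otimes>\<^bsub>G\<^esub> k)"
      using g by (simp add: D)
  next
    fix g assume "g \<in> carrier G"
    then show "?D (g, \<one>\<^bsub>G\<^esub>) = \<one>\<^bsub>A\<^esub>" "?D (\<one>\<^bsub>G\<^esub>, g) = \<one>\<^bsub>A\<^esub>"
      using e' e(2) d by (simp_all add: D act_one)
  qed
qed

text \<open>Moving the subtracted term of a coboundary to the other side turns membership in a coset
  into \<open>cohom\<close>, so that classes can be compared by composing twists.\<close>

lemma coh_class_eq: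
  assumes d: "\<delta> \<in> cocycles2 G A act"
  shows "coh_class G A act \<delta> = {\<delta>' \<in> cocycles2 G A act. \<exists>\<epsilon>. cohom \<epsilon> \<delta>' \<delta>}"
proof (intro equalityI subsetI)
  fix \<delta>' assume "\<delta>' \<in> coh_class G A act \<delta>"
  then obtain \<epsilon> where e: "\<epsilon> \<in> carrier G \<rightarrow> carrier A" "\<epsilon> \<one>\<^bsub>G\<^esub> = \<one>\<^bsub>A\<^esub>"
    and d': "\<delta>' = coboundary G A act \<epsilon> \<otimes>\<^bsub>Z2 G A act\<^esub> \<delta>"
    unfolding coh_class_def B2_def r_coset_def by blast
  have "\<delta>' \<in> cocycles2 G A act" unfolding d' by (rule coboundary_cocycle[OF d e])
  moreover have "cohom \<epsilon> \<delta>' \<delta>"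
    unfolding twist_def
  proof (intro conjI ballI)
    fix g h assume g: "g \<in> carrier G" "h \<in> carrier G"
    have e': "\<epsilon> g \<in> carrier A" if "g \<in> carrier G" for g using e that by auto
    have "\<delta>' (g, h) = act (\<epsilon> g) h \<otimes>\<^bsub>A\<^esub> \<epsilon> h \<otimes>\<^bsub>A\<^esub> inv\<^bsub>A\<^esub> \<epsilon> (g \<otimes>\<^bsub>G\<^esub> h) \<otimes>\<^bsub>A\<^esub> \<delta> (g, h)"
      using g by (simp add: d' Z2_def coboundary_def)
    moreover have "inv\<^bsub>A\<^esub> \<epsilon> (g \<otimes>\<^bsub>G\<^esub> h) \<otimes>\<^bsub>A\<^esub> (\<delta> (g, h) \<otimes>\<^bsub>A\<^esub> \<epsilon> (g \<otimes>\<^bsub>G\<^esub> h)) = \<delta> (g, h)"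
      using g e' d by (simp add: A.m_comm[of "\<delta> (g, h)"] A.m_assoc[symmetric])
    ultimately show "(\<lambda>x\<in>carrier A. x) (\<delta>' (g, h)) \<otimes>\<^bsub>A\<^esub> \<epsilon> (g \<otimes>\<^bsub>G\<^esub> h)
      = act (\<epsilon> g) ((\<lambda>x\<in>carrier G. x) h) \<otimes>\<^bsub>A\<^esub> \<epsilon> h
        \<otimes>\<^bsub>A\<^esub> \<delta> ((\<lambda>x\<in>carrier G. x) g, (\<lambda>x\<in>carrier G. x) h)"
      using g e' d by (simp add: A.m_assoc)
  qed (rule e(1))
  ultimately show "\<delta>' \<in> {\<delta>' \<in> cocycles2 G A act. \<exists>\<epsilon>. cohom \<epsilon> \<delta>' \<delta>}" by blast
next
  fix \<delta>' assume "\<delta>' \<in> {\<delta>' \<in> cocycles2 G A act. \<exists>\<epsilon>. cohom \<epsilon> \<delta>' \<delta>}"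
  then obtain \<epsilon> where d': "\<delta>' \<in> cocycles2 G A act" and t: "cohom \<epsilon> \<delta>' \<delta>" by blast
  have e: "\<epsilon> \<in> carrier G \<rightarrow> carrier A" "\<epsilon> \<one>\<^bsub>G\<^esub> = \<one>\<^bsub>A\<^esub>"
    using twistD(1)[OF t] twist_one[OF id_Comp d' d t] by auto
  have "\<delta>' = coboundary G A act \<epsilon> \<otimes>\<^bsub>Z2 G A act\<^esub> \<delta>"
  proof (rule extensionalityI)
    show "\<delta>' \<in> extensional (carrier G \<times> carrier G)"
      using d' unfolding cocycles2_def by (auto simp: PiE_def)
    show "coboundary G A act \<epsilon> \<otimes>\<^bsub>Z2 G A act\<^esub> \<delta> \<in> extensional (carrier G \<times> carrier G)"
      by (simp add: Z2_def)
    fix x assume "x \<in> carrier G \<times> carrier G"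
    then obtain g h where x: "x = (g, h)" "g \<in> carrier G" "h \<in> carrier G" by blast
    have e': "\<epsilon> g \<in> carrier A" if "g \<in> carrier G" for g using e that by auto
    have "\<delta>' (g, h) \<otimes>\<^bsub>A\<^esub> \<epsilon> (g \<otimes>\<^bsub>G\<^esub> h) = act (\<epsilon> g) h \<otimes>\<^bsub>A\<^esub> \<epsilon> h \<otimes>\<^bsub>A\<^esub> \<delta> (g, h)"
      using twistD(3)[OF t x(2,3)] x d' by simp
    then have "\<delta>' (g, h) = act (\<epsilon> g) h \<otimes>\<^bsub>A\<^esub> \<epsilon> h \<otimes>\<^bsub>A\<^esub> \<delta> (g, h) \<otimes>\<^bsub>A\<^esub> inv\<^bsub>A\<^esub> \<epsilon> (g \<otimes>\<^bsub>G\<^esub> h)"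
      using x d d' e' by (simp add: A.inv_solve_right)
    then show "\<delta>' x = (coboundary G A act \<epsilon> \<otimes>\<^bsub>Z2 G A act\<^esub> \<delta>) x"
      using x e' d by (simp add: Z2_def coboundary_def A.m_ac)
  qed
  then show "\<delta>' \<in> coh_class G A act \<delta>"
    using e unfolding coh_class_def B2_def r_coset_def by blast
qed

lemma coh_class_self: "\<delta> \<in> cocycles2 G A act \<Longrightarrow> \<delta> \<in> coh_class G A act \<delta>"
  unfolding coh_class_eq using cohom_refl by blast

lemma coh_class_repr:
  assumes d: "\<delta> \<in> cocycles2 G A act" and d': "\<delta>' \<in> coh_class G A act \<delta>"
  shows "coh_class G A act \<delta>' = coh_class G A act \<delta>"
proof -
  from d' obtain \<epsilon> where c: "\<delta>' \<in> cocycles2 G A act" and e: "cohom \<epsilon> \<delta>' \<delta>"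
    unfolding coh_class_eq[OF d] by blast
  obtain \<xi> where x: "cohom \<xi> \<delta> \<delta>'" using cohom_sym[OF c d e] by blast
  show ?thesis
    unfolding coh_class_eq[OF d] coh_class_eq[OF c]
    using twist_comp_cohom_left[OF id_Comp _ c d _ e] twist_comp_cohom_left[OF id_Comp _ d c _ x]
    by blast
qed

section \<open>The action of compatible pairs on cohomology classes\<close>

lemma H2_carrier: "carrier (H2 G A act) = coh_class G A act ` cocycles2 G A act"
  unfolding H2_def FactGroup_def RCOSETS_def coh_class_def by (auto simp: Z2_def)

lemma H2_repr:
  assumes "C \<in> carrier (H2 G A act)" "\<delta> \<in> C"
  shows "\<delta> \<in> cocycles2 G A act" "C = coh_class G A act \<delta>"
proof -
  obtain \<delta>0 where d: "\<delta>0 \<in> cocycles2 G A act" "C = coh_class G A act \<delta>0"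
    using assms(1) unfolding H2_carrier by blast
  show "\<delta> \<in> cocycles2 G A act" using assms(2) unfolding d(2) coh_class_eq[OF d(1)] by blast
  show "C = coh_class G A act \<delta>" using coh_class_repr[OF d(1)] assms(2) d(2) by simp
qed

text \<open>Every element of \<open>G\<close> is a value of \<eta>, and at such arguments the
  transformed cocycle is just \<nu> of \<delta>. The identities are checked there, where no inverse
  of \<eta> occurs. The zero cochain then links \<delta> to its transform.\<close>

lemma Z2_act_cocycle:
  assumes p: "(\<eta>, \<nu>) \<in> carrier (Comp G A act)" and d: "\<delta> \<in> cocycles2 G A act"
  shows "Z2_act G (\<eta>, \<nu>) \<delta> \<in> cocycles2 G A act"
    and "twist \<eta> \<nu> (\<lambda>g. \<one>\<^bsub>A\<^esub>) \<delta> (Z2_act G (\<eta>, \<nu>) \<delta>)"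
proof -
  interpret \<eta>: group_hom G G \<eta> by (rule CompD(3)[OF p])
  interpret \<nu>: group_hom A A \<nu> by (rule CompD(4)[OF p])
  have surj: "\<eta> ` carrier G = carrier G" and inj: "inj_on \<eta> (carrier G)"
    using CompD(5)[OF p] by (auto simp: bij_betw_def)
  let ?D = "Z2_act G (\<eta>, \<nu>) \<delta>"
  have D: "?D (\<eta> g, \<eta> h) = \<nu> (\<delta> (g, h))" if "g \<in> carrier G" "h \<in> carrier G" for g h
    using that inj by (simp add: Z2_act_def)
  show "twist \<eta> \<nu> (\<lambda>g. \<one>\<^bsub>A\<^esub>) \<delta> ?D"
    unfolding twist_def using d by (simp add: D)
  have "?D \<in> extensional (carrier G \<times> carrier G)" by (simp add: Z2_act_def)
  moreover have "\<forall>x\<in>\<eta> ` carrier G. \<forall>y\<in>\<eta> ` carrier G. ?D (x, y) \<in> carrier A"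
    using d by (simp add: D)
  moreover have "\<forall>x\<in>\<eta> ` carrier G. ?D (x, \<eta> \<one>\<^bsub>G\<^esub>) = \<one>\<^bsub>A\<^esub> \<and> ?D (\<eta> \<one>\<^bsub>G\<^esub>, x) = \<one>\<^bsub>A\<^esub>"
    using d by (simp add: D del: \<eta>.hom_one)
  moreover have "\<forall>x\<in>\<eta> ` carrier G. \<forall>y\<in>\<eta> ` carrier G. \<forall>z\<in>\<eta> ` carrier G.
    act (?D (x, y)) z \<otimes>\<^bsub>A\<^esub> ?D (x \<otimes>\<^bsub>G\<^esub> y, z) = ?D (y, z) \<otimes>\<^bsub>A\<^esub> ?D (x, y \<otimes>\<^bsub>G\<^esub> z)"
    using d by (simp add: D CompD(7)[OF p] cocycle_eq[OF d] flip: \<eta>.hom_mult \<nu>.hom_mult)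
  ultimately show "?D \<in> cocycles2 G A act"
    unfolding surj cocycles2_def by (auto simp: PiE_def)
qed

text \<open>Any two cocycles reached from one class by the same pair are cohomologous, so all sets
  in the union that defines \<open>H2_act\<close> are equal. This settles that the action is well
  defined and turns questions on orbits and stabilizers into the existence of twists.\<close>

lemma H2_act_eq_iff:
  assumes p: "(\<eta>, \<nu>) \<in> carrier (Comp G A act)"
    and d: "\<delta> \<in> cocycles2 G A act" "\<delta>' \<in> cocycles2 G A act"
  shows "H2_act G A act (\<eta>, \<nu>) (coh_class G A act \<delta>) = coh_class G A act \<delta>'
    \<longleftrightarrow> (\<exists>\<epsilon>. twist \<eta> \<nu> \<epsilon> \<delta> \<delta>')"
proof -
  have const: "coh_class G A act (Z2_act G (\<eta>, \<nu>) \<delta>1) = coh_class G A act \<delta>2"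
    if c: "\<delta>1 \<in> coh_class G A act \<delta>" "\<delta>2 \<in> cocycles2 G A act" "twist \<eta> \<nu> \<epsilon> \<delta> \<delta>2" for \<delta>1 \<delta>2 \<epsilon>
  proof -
    from c(1) obtain \<zeta> where d1: "\<delta>1 \<in> cocycles2 G A act" and "cohom \<zeta> \<delta>1 \<delta>"
      unfolding coh_class_eq[OF d(1)] by blast
    then obtain \<xi> where "twist \<eta> \<nu> \<xi> \<delta>1 \<delta>2"
      using twist_comp_cohom_left[OF p _ d(1) c(2)] c(3) by blast
    then have "\<exists>\<xi>. cohom \<xi> (Z2_act G (\<eta>, \<nu>) \<delta>1) \<delta>2"
      using twist_twist_imp_cohom[OF p d1] Z2_act_cocycle[OF p d1] c(2) by blast
    then show ?thesis
      using coh_class_repr c(2) Z2_act_cocycle[OF p d1] coh_class_eq by blast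
  qed
  have H: "H2_act G A act (\<eta>, \<nu>) (coh_class G A act \<delta>) = coh_class G A act \<delta>2"
    if "\<delta>2 \<in> cocycles2 G A act" "twist \<eta> \<nu> \<epsilon> \<delta> \<delta>2" for \<delta>2 \<epsilon>
    using const[OF _ that] coh_class_self[OF d(1)] d(1) unfolding H2_act_def H2_carrier by auto
  show ?thesis
  proof
    assume "H2_act G A act (\<eta>, \<nu>) (coh_class G A act \<delta>) = coh_class G A act \<delta>'"
    then have "coh_class G A act (Z2_act G (\<eta>, \<nu>) \<delta>) = coh_class G A act \<delta>'"
      using H Z2_act_cocycle[OF p d(1)] by simp
    then have "\<exists>\<zeta>. cohom \<zeta> (Z2_act G (\<eta>, \<nu>) \<delta>) \<delta>'"
      using coh_class_self Z2_act_cocycle[OF p d(1)] coh_class_eq[OF d(2)] by blast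
    then show "\<exists>\<epsilon>. twist \<eta> \<nu> \<epsilon> \<delta> \<delta>'"
      using twist_comp_cohom_right[OF p d(1) _ d(2)] Z2_act_cocycle[OF p d(1)] by blast
  qed (use H d(2) in blast)
qed

text \<open>The twist condition is what multiplicativity demands of the second components. For
  bijectivity, \<eta> recovers g, and \<nu> recovers a once \<epsilon> g is subtracted.
  \<open>A\<close> is preserved because \<epsilon> vanishes at the unit.\<close>

lemma iso_of_twist:
  assumes p: "(\<eta>, \<nu>) \<in> carrier (Comp G A act)"
    and d: "\<delta> \<in> cocycles2 G A act" "\<delta>' \<in> cocycles2 G A act" and t: "twist \<eta> \<nu> \<epsilon> \<delta> \<delta>'"
  defines "f \<equiv> \<lambda>(g, a)\<in>carrier G \<times> carrier A. (\<eta> g, \<nu> a \<otimes>\<^bsub>A\<^esub> \<epsilon> g)"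
  shows "f \<in> iso (ext \<delta>) (ext \<delta>')" "f ` ext_embed G ` carrier A = ext_embed G ` carrier A"
proof -
  interpret \<eta>: group_hom G G \<eta> by (rule CompD(3)[OF p])
  interpret \<nu>: group_hom A A \<nu> by (rule CompD(4)[OF p])
  have e: "\<epsilon> g \<in> carrier A" if "g \<in> carrier G" for g
    using t that by (auto dest: twistD(2))
  have surj: "\<eta> ` carrier G = carrier G" "\<nu> ` carrier A = carrier A"
    and inj: "inj_on \<eta> (carrier G)" "inj_on \<nu> (carrier A)"
    using CompD(5,6)[OF p] by (auto simp: bij_betw_def)
  have f: "f (g, a) = (\<eta> g, \<nu> a \<otimes>\<^bsub>A\<^esub> \<epsilon> g)" if "g \<in> carrier G" "a \<in> carrier A" for g a
    using that by (simp add: f_def)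
  have hom: "f \<in> hom (ext \<delta>) (ext \<delta>')"
  proof (rule homI)
    fix x assume "x \<in> carrier (ext \<delta>)"
    then show "f x \<in> carrier (ext \<delta>')" using e by (auto simp: f)
  next
    fix x y assume "x \<in> carrier (ext \<delta>)" "y \<in> carrier (ext \<delta>)"
    moreover obtain g a h b where xy: "x = (g, a)" "y = (h, b)" by (cases x; cases y) auto
    ultimately have g: "g \<in> carrier G" "a \<in> carrier A" "h \<in> carrier G" "b \<in> carrier A" by auto
    have "\<nu> (\<delta> (g, h)) \<otimes>\<^bsub>A\<^esub> \<epsilon> (g \<otimes>\<^bsub>G\<^esub> h) = act (\<epsilon> g) (\<eta> h) \<otimes>\<^bsub>A\<^esub> \<epsilon> h \<otimes>\<^bsub>A\<^esub> \<delta>' (\<eta> g, \<eta> h)"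
      by (rule twistD(3)[OF t g(1,3)])
    then show "f (x \<otimes>\<^bsub>ext \<delta>\<^esub> y) = f x \<otimes>\<^bsub>ext \<delta>'\<^esub> f y"
      using xy g d e by (simp add: f act_mult_distrib CompD(7)[OF p] A.m_assoc)
        (simp add: A.m_ac)
  qed
  moreover have "bij_betw f (carrier (ext \<delta>)) (carrier (ext \<delta>'))"
    unfolding bij_betw_def
  proof
    show "inj_on f (carrier (ext \<delta>))"
    proof (rule inj_onI)
      fix x y assume "x \<in> carrier (ext \<delta>)" "y \<in> carrier (ext \<delta>)" and eq: "f x = f y"
      then obtain g a h b where xy: "x = (g, a)" "y = (h, b)"
        and g: "g \<in> carrier G" "a \<in> carrier A" "h \<in> carrier G" "b \<in> carrier A" by auto
      have "\<eta> g = \<eta> h" and \<nu>: "\<nu> a \<otimes>\<^bsub>A\<^esub> \<epsilon> g = \<nu> b \<otimes>\<^bsub>A\<^esub> \<epsilon> h"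
        using eq g by (simp_all add: xy f)
      then have gh: "g = h" using inj_onD[OF inj(1)] g by simp
      then have "\<nu> a = \<nu> b" using \<nu> g e by simp
      then show "x = y" using inj_onD[OF inj(2)] g gh xy by simp
    qed
    show "f ` carrier (ext \<delta>) = carrier (ext \<delta>')"
    proof (intro equalityI subsetI)
      fix y assume "y \<in> carrier (ext \<delta>')"
      then obtain k b where y: "y = (k, b)" "k \<in> carrier G" "b \<in> carrier A" by auto
      obtain g where g: "g \<in> carrier G" "k = \<eta> g" using Comp_surj(1)[OF p y(2)] by blast
      obtain a where a: "a \<in> carrier A" "b \<otimes>\<^bsub>A\<^esub> inv\<^bsub>A\<^esub> \<epsilon> g = \<nu> a"
        using Comp_surj(2)[OF p, of "b \<otimes>\<^bsub>A\<^esub> inv\<^bsub>A\<^esub> \<epsilon> g"] y e g by auto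
      have "f (g, a) = y" using a(1) g y e by (simp add: f a(2)[symmetric] A.m_assoc)
      then show "y \<in> f ` carrier (ext \<delta>)" using a g by (intro image_eqI[of _ _ "(g, a)"]) auto
    qed (use e in \<open>auto simp: f\<close>)
  qed
  ultimately show "f \<in> iso (ext \<delta>) (ext \<delta>')" by (simp add: iso_def)
  have "f (\<one>\<^bsub>G\<^esub>, a) = (\<one>\<^bsub>G\<^esub>, \<nu> a)" if "a \<in> carrier A" for a
    using that twist_one[OF p d t] by (simp add: f)
  then show "f ` ext_embed G ` carrier A = ext_embed G ` carrier A"
    using surj(2) by (auto simp: ext_embed_def image_image)
qed

text \<open>Every element splits as (g, 0)(1, a), so f is known from its values on these two kinds
  of elements; since f preserves \<open>A\<close>, the first component of f (1, a) is trivial.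
  Products of two elements (g, 0) and (h, 0) give the twist condition, and (1, a)(g, 0) gives
  compatibility.\<close>

lemma twist_of_iso:
  assumes d: "\<delta> \<in> cocycles2 G A act" "\<delta>' \<in> cocycles2 G A act"
    and f: "f \<in> iso (ext \<delta>) (ext \<delta>')" "f ` ext_embed G ` carrier A = ext_embed G ` carrier A"
  defines "\<eta> \<equiv> \<lambda>g\<in>carrier G. fst (f (g, \<one>\<^bsub>A\<^esub>))" and "\<nu> \<equiv> \<lambda>a\<in>carrier A. snd (f (\<one>\<^bsub>G\<^esub>, a))"
    and "\<epsilon> \<equiv> \<lambda>g\<in>carrier G. snd (f (g, \<one>\<^bsub>A\<^esub>))"
  shows "(\<eta>, \<nu>) \<in> carrier (Comp G A act)" "twist \<eta> \<nu> \<epsilon> \<delta> \<delta>'"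
    "\<lbrakk>g \<in> carrier G; a \<in> carrier A\<rbrakk> \<Longrightarrow> f (g, a) = (\<eta> g, \<nu> a \<otimes>\<^bsub>A\<^esub> \<epsilon> g)"
proof -
  interpret f: group_hom "ext \<delta>" "ext \<delta>'" f
    using f(1) group_ext d by (simp add: group_hom_def group_hom_axioms_def iso_def)
  have inj: "inj_on f (carrier G \<times> carrier A)" and surj: "f ` (carrier G \<times> carrier A) = carrier G \<times> carrier A"
    using f(1) by (auto simp: iso_def bij_betw_def)
  have img: "f ` ({\<one>\<^bsub>G\<^esub>} \<times> carrier A) = {\<one>\<^bsub>G\<^esub>} \<times> carrier A"
    using f(2) by (simp add: image_ext_embed)
  have fg: "f (g, \<one>\<^bsub>A\<^esub>) = (\<eta> g, \<epsilon> g)" if "g \<in> carrier G" for g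
    using that by (simp add: \<eta>_def \<epsilon>_def)
  have fa: "f (\<one>\<^bsub>G\<^esub>, a) = (\<one>\<^bsub>G\<^esub>, \<nu> a)" "\<nu> a \<in> carrier A" if "a \<in> carrier A" for a
  proof -
    have "f (\<one>\<^bsub>G\<^esub>, a) \<in> {\<one>\<^bsub>G\<^esub>} \<times> carrier A" using that img by blast
    then show "f (\<one>\<^bsub>G\<^esub>, a) = (\<one>\<^bsub>G\<^esub>, \<nu> a)" "\<nu> a \<in> carrier A"
      using that by (auto simp: \<nu>_def)
  qed
  have \<nu>1: "\<nu> \<one>\<^bsub>A\<^esub> = \<one>\<^bsub>A\<^esub>"
    using f.hom_one fa(1)[OF A.one_closed] by simp
  have cl: "\<eta> g \<in> carrier G" "\<epsilon> g \<in> carrier A" if "g \<in> carrier G" for g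
    using f.hom_closed[of "(g, \<one>\<^bsub>A\<^esub>)"] that by (simp_all add: fg)
  have fmult: "f (g \<otimes>\<^bsub>G\<^esub> h, act a h \<otimes>\<^bsub>A\<^esub> b \<otimes>\<^bsub>A\<^esub> \<delta> (g, h)) = f (g, a) \<otimes>\<^bsub>ext \<delta>'\<^esub> f (h, b)"
    if "g \<in> carrier G" "a \<in> carrier A" "h \<in> carrier G" "b \<in> carrier A" for g a h b
    using f.hom_mult[of "(g, a)" "(h, b)"] that by simp
  show split: "f (g, a) = (\<eta> g, \<nu> a \<otimes>\<^bsub>A\<^esub> \<epsilon> g)" if "g \<in> carrier G" "a \<in> carrier A" for g a
    using fmult[of g "\<one>\<^bsub>A\<^esub>" "\<one>\<^bsub>G\<^esub>" a] that d
    by (simp add: fg fa cl act_one A.m_comm)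
  have tw: "\<eta> (g \<otimes>\<^bsub>G\<^esub> h) = \<eta> g \<otimes>\<^bsub>G\<^esub> \<eta> h"
    "\<nu> (\<delta> (g, h)) \<otimes>\<^bsub>A\<^esub> \<epsilon> (g \<otimes>\<^bsub>G\<^esub> h) = act (\<epsilon> g) (\<eta> h) \<otimes>\<^bsub>A\<^esub> \<epsilon> h \<otimes>\<^bsub>A\<^esub> \<delta>' (\<eta> g, \<eta> h)"
    if "g \<in> carrier G" "h \<in> carrier G" for g h
    using fmult[of g "\<one>\<^bsub>A\<^esub>" h "\<one>\<^bsub>A\<^esub>"] that d cl by (simp_all add: split \<nu>1)
  then show "twist \<eta> \<nu> \<epsilon> \<delta> \<delta>'" unfolding twist_def using cl by auto
  have \<eta>hom: "\<eta> \<in> hom G G" using cl tw by (auto simp: hom_def)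
  have \<nu>hom: "\<nu> \<in> hom A A"
  proof (rule homI)
    fix a b assume ab: "a \<in> carrier A" "b \<in> carrier A"
    show "\<nu> (a \<otimes>\<^bsub>A\<^esub> b) = \<nu> a \<otimes>\<^bsub>A\<^esub> \<nu> b"
      using fmult[of "\<one>\<^bsub>G\<^esub>" a "\<one>\<^bsub>G\<^esub>" b] ab d by (simp add: fa act_one)
  qed (rule fa)
  have \<eta>1: "\<eta> \<one>\<^bsub>G\<^esub> = \<one>\<^bsub>G\<^esub>"
    using hom_one[OF \<eta>hom] by simp
  have "inj_on \<eta> (carrier G)"
  proof (rule inj_onI)
    fix g h assume g: "g \<in> carrier G" "h \<in> carrier G" "\<eta> g = \<eta> h"
    \<comment> \<open>The gap between f (g, 0) and f (h, 0) lies in \<open>A\<close>, hence is \<nu>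
      of some a, and then (g, a) and (h, 0) have the same image.\<close>
    define c where "c = \<epsilon> h \<otimes>\<^bsub>A\<^esub> inv\<^bsub>A\<^esub> \<epsilon> g"
    have "(\<one>\<^bsub>G\<^esub>, c) \<in> f ` ({\<one>\<^bsub>G\<^esub>} \<times> carrier A)" unfolding img using cl g by (simp add: c_def)
    then obtain a where a: "a \<in> carrier A" "\<nu> a = c" using fa by force
    have "f (g, a) = f (h, \<one>\<^bsub>A\<^esub>)"
      using g a(1) cl by (simp add: split[of g] fg a(2)) (simp add: c_def A.m_assoc)
    then have "(g, a) = (h, \<one>\<^bsub>A\<^esub>)" by (rule inj_onD[OF inj]) (use g a in auto)
    then show "g = h" by simp
  qed
  moreover have "\<eta> ` carrier G = carrier G"
  proof (intro equalityI subsetI)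
    fix k assume "k \<in> carrier G"
    then have "(k, \<one>\<^bsub>A\<^esub>) \<in> f ` (carrier G \<times> carrier A)" unfolding surj by simp
    then show "k \<in> \<eta> ` carrier G" using split by auto
  qed (use cl in blast)
  moreover have "inj_on \<nu> (carrier A)"
  proof (rule inj_onI)
    fix a b assume a: "a \<in> carrier A" "b \<in> carrier A" "\<nu> a = \<nu> b"
    have "(\<one>\<^bsub>G\<^esub>, a) = (\<one>\<^bsub>G\<^esub>, b)" by (rule inj_onD[OF inj]) (use a fa in auto)
    then show "a = b" by simp
  qed
  moreover have "\<nu> ` carrier A = carrier A"
  proof (intro equalityI subsetI)
    fix b assume "b \<in> carrier A"
    then have "(\<one>\<^bsub>G\<^esub>, b) \<in> f ` ({\<one>\<^bsub>G\<^esub>} \<times> carrier A)" unfolding img by simp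
    then show "b \<in> \<nu> ` carrier A" using fa by auto
  qed (use fa in blast)
  moreover have "act (\<nu> a) (\<eta> g) = \<nu> (act a g)" if "a \<in> carrier A" "g \<in> carrier G" for a g
    using fmult[of "\<one>\<^bsub>G\<^esub>" a g "\<one>\<^bsub>A\<^esub>"] that d cl fa
    by (simp add: split \<nu>1 \<eta>1)
  ultimately show "(\<eta>, \<nu>) \<in> carrier (Comp G A act)"
    using \<eta>hom \<nu>hom unfolding Comp_def auto_def Bij_def
    by (auto simp: bij_betw_def \<eta>_def \<nu>_def)
qed

text \<open>Schreier's construction: a transversal \<open>t\<close> of the projection fails to be
  multiplicative by a cocycle, and the products of t g and \<iota> a are normal forms for the
  elements of \<open>E\<close>.\<close>

lemma extension_iso_ext:
  assumes "extension G A act E \<iota> \<pi>"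
  shows "\<exists>\<delta>\<in>cocycles2 G A act. \<exists>f\<in>iso (ext \<delta>) E. f ` ext_embed G ` carrier A = \<iota> ` carrier A"
proof -
  interpret E: group E using assms unfolding extension_def short_exact_def by blast
  interpret \<iota>: group_hom A E \<iota>
    using assms unfolding extension_def short_exact_def group_hom_def group_hom_axioms_def by blast
  interpret \<pi>: group_hom E G \<pi>
    using assms unfolding extension_def short_exact_def group_hom_def group_hom_axioms_def by blast
  have inj: "inj_on \<iota> (carrier A)" and surj: "\<pi> ` carrier E = carrier G"
    and ker: "\<iota> ` carrier A = kernel E G \<pi>"
    and conj: "\<And>e a. e \<in> carrier E \<Longrightarrow> a \<in> carrier A \<Longrightarrow>
      inv\<^bsub>E\<^esub> e \<otimes>\<^bsub>E\<^esub> \<iota> a \<otimes>\<^bsub>E\<^esub> e = \<iota> (act a (\<pi> e))"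
    using assms unfolding extension_def short_exact_def by auto
  have swap: "\<iota> a \<otimes>\<^bsub>E\<^esub> e = e \<otimes>\<^bsub>E\<^esub> \<iota> (act a (\<pi> e))" if "e \<in> carrier E" "a \<in> carrier A" for e a
    using conj[OF that] that by (metis E.inv_solve_left' E.m_assoc E.m_closed E.inv_closed \<iota>.hom_closed)
  have \<pi>\<iota>: "\<pi> (\<iota> a) = \<one>\<^bsub>G\<^esub>" if "a \<in> carrier A" for a
    using that ker by (auto simp: kernel_def)
  have \<iota>_comm: "\<iota> a \<otimes>\<^bsub>E\<^esub> \<iota> b = \<iota> b \<otimes>\<^bsub>E\<^esub> \<iota> a" if "a \<in> carrier A" "b \<in> carrier A" for a b
    using that A.m_comm[OF that] by (simp flip: \<iota>.hom_mult)
  \<comment> \<open>The unit is its own representative, which makes the cocycle normalised.\<close>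
  define t where "t g = (if g = \<one>\<^bsub>G\<^esub> then \<one>\<^bsub>E\<^esub> else inv_into (carrier E) \<pi> g)" for g
  have t: "t g \<in> carrier E" "\<pi> (t g) = g" if "g \<in> carrier G" for g
    using that surj by (auto simp: t_def inv_into_into f_inv_into_f)
  have t1: "t \<one>\<^bsub>G\<^esub> = \<one>\<^bsub>E\<^esub>" by (simp add: t_def)
  have diff: "\<exists>a\<in>carrier A. e = t (\<pi> e) \<otimes>\<^bsub>E\<^esub> \<iota> a" if "e \<in> carrier E" for e
  proof -
    have "inv\<^bsub>E\<^esub> t (\<pi> e) \<otimes>\<^bsub>E\<^esub> e \<in> kernel E G \<pi>"
      using that t[of "\<pi> e"] by (simp add: kernel_def)
    then obtain a where "a \<in> carrier A" "\<iota> a = inv\<^bsub>E\<^esub> t (\<pi> e) \<otimes>\<^bsub>E\<^esub> e" unfolding ker[symmetric] by force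
    then show ?thesis
      using that t[of "\<pi> e"] by (intro bexI[of _ a]) (simp_all add: E.m_assoc[symmetric])
  qed
  define \<delta> where "\<delta> = (\<lambda>(g, h)\<in>carrier G \<times> carrier G.
    SOME a. a \<in> carrier A \<and> t g \<otimes>\<^bsub>E\<^esub> t h = t (g \<otimes>\<^bsub>G\<^esub> h) \<otimes>\<^bsub>E\<^esub> \<iota> a)"
  have \<delta>: "\<delta> (g, h) \<in> carrier A" "t g \<otimes>\<^bsub>E\<^esub> t h = t (g \<otimes>\<^bsub>G\<^esub> h) \<otimes>\<^bsub>E\<^esub> \<iota> (\<delta> (g, h))"
    if "g \<in> carrier G" "h \<in> carrier G" for g h
  proof -
    have "\<exists>a. a \<in> carrier A \<and> t g \<otimes>\<^bsub>E\<^esub> t h = t (g \<otimes>\<^bsub>G\<^esub> h) \<otimes>\<^bsub>E\<^esub> \<iota> a"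
      using diff[of "t g \<otimes>\<^bsub>E\<^esub> t h"] that t by auto
    from someI_ex[OF this] show "\<delta> (g, h) \<in> carrier A"
      "t g \<otimes>\<^bsub>E\<^esub> t h = t (g \<otimes>\<^bsub>G\<^esub> h) \<otimes>\<^bsub>E\<^esub> \<iota> (\<delta> (g, h))"
      using that by (simp_all add: \<delta>_def)
  qed
  have uniq: "a = b" if "t g \<otimes>\<^bsub>E\<^esub> \<iota> a = t g \<otimes>\<^bsub>E\<^esub> \<iota> b" "g \<in> carrier G" "a \<in> carrier A" "b \<in> carrier A" for g a b
    using that t inj by (simp add: inj_on_eq_iff)
  have cocycle: "\<delta> \<in> cocycles2 G A act"
    unfolding cocycles2_def
  proof (intro CollectI conjI ballI)
    show "\<delta> \<in> carrier G \<times> carrier G \<rightarrow>\<^sub>E carrier A"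
      using \<delta>(1) by (auto simp: \<delta>_def)
  next
    fix g h k assume g: "g \<in> carrier G" "h \<in> carrier G" "k \<in> carrier G"
    \<comment> \<open>Both sides are read off from the product of t g, t h and t k, bracketed in two
      ways.\<close>
    have "t (g \<otimes>\<^bsub>G\<^esub> h \<otimes>\<^bsub>G\<^esub> k) \<otimes>\<^bsub>E\<^esub> \<iota> (act (\<delta> (g, h)) k \<otimes>\<^bsub>A\<^esub> \<delta> (g \<otimes>\<^bsub>G\<^esub> h, k))
        = t (g \<otimes>\<^bsub>G\<^esub> h \<otimes>\<^bsub>G\<^esub> k) \<otimes>\<^bsub>E\<^esub> \<iota> (\<delta> (g \<otimes>\<^bsub>G\<^esub> h, k)) \<otimes>\<^bsub>E\<^esub> \<iota> (act (\<delta> (g, h)) k)"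
      using g t \<delta>(1) \<iota>_comm[of "act (\<delta> (g, h)) k" "\<delta> (g \<otimes>\<^bsub>G\<^esub> h, k)"] by (simp add: E.m_assoc)
    also have "\<dots> = t (g \<otimes>\<^bsub>G\<^esub> h) \<otimes>\<^bsub>E\<^esub> (t k \<otimes>\<^bsub>E\<^esub> \<iota> (act (\<delta> (g, h)) k))"
      using g t \<delta>(1) by (simp add: \<delta>(2)[symmetric] E.m_assoc)
    also have "\<dots> = t (g \<otimes>\<^bsub>G\<^esub> h) \<otimes>\<^bsub>E\<^esub> (\<iota> (\<delta> (g, h)) \<otimes>\<^bsub>E\<^esub> t k)"
      using g t \<delta>(1) by (simp add: swap)
    also have "\<dots> = t g \<otimes>\<^bsub>E\<^esub> t h \<otimes>\<^bsub>E\<^esub> t k"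
      using g t \<delta>(1) by (simp add: \<delta>(2) E.m_assoc)
    also have "\<dots> = t g \<otimes>\<^bsub>E\<^esub> t (h \<otimes>\<^bsub>G\<^esub> k) \<otimes>\<^bsub>E\<^esub> \<iota> (\<delta> (h, k))"
      using g t \<delta>(1) by (simp add: \<delta>(2)[of h k] E.m_assoc)
    also have "\<dots> = t (g \<otimes>\<^bsub>G\<^esub> h \<otimes>\<^bsub>G\<^esub> k) \<otimes>\<^bsub>E\<^esub> \<iota> (\<delta> (h, k) \<otimes>\<^bsub>A\<^esub> \<delta> (g, h \<otimes>\<^bsub>G\<^esub> k))"
      using g t \<delta>(1) \<iota>_comm[of "\<delta> (h, k)" "\<delta> (g, h \<otimes>\<^bsub>G\<^esub> k)"]
      by (simp add: \<delta>(2)[of g "h \<otimes>\<^bsub>G\<^esub> k"] E.m_assoc G.m_assoc)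
    finally show "act (\<delta> (g, h)) k \<otimes>\<^bsub>A\<^esub> \<delta> (g \<otimes>\<^bsub>G\<^esub> h, k) = \<delta> (h, k) \<otimes>\<^bsub>A\<^esub> \<delta> (g, h \<otimes>\<^bsub>G\<^esub> k)"
      by (rule uniq) (use g \<delta>(1) in simp_all)
  next
    fix g assume g: "g \<in> carrier G"
    show "\<delta> (g, \<one>\<^bsub>G\<^esub>) = \<one>\<^bsub>A\<^esub>"
      using g \<delta>[of g "\<one>\<^bsub>G\<^esub>"] t by (intro uniq[of g]) (simp_all add: t1)
    show "\<delta> (\<one>\<^bsub>G\<^esub>, g) = \<one>\<^bsub>A\<^esub>"
      using g \<delta>[of "\<one>\<^bsub>G\<^esub>" g] t by (intro uniq[of g]) (simp_all add: t1)
  qed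
  define f where "f = (\<lambda>(g, a). t g \<otimes>\<^bsub>E\<^esub> \<iota> a)"
  have "f \<in> hom (ext \<delta>) E"
  proof (rule homI)
    fix x assume "x \<in> carrier (ext \<delta>)"
    then show "f x \<in> carrier E" using t by (auto simp: f_def)
  next
    fix x y assume "x \<in> carrier (ext \<delta>)" "y \<in> carrier (ext \<delta>)"
    moreover obtain g a h b where xy: "x = (g, a)" "y = (h, b)" by (cases x; cases y) auto
    ultimately have g: "g \<in> carrier G" "a \<in> carrier A" "h \<in> carrier G" "b \<in> carrier A" by auto
    have "f x \<otimes>\<^bsub>E\<^esub> f y = t g \<otimes>\<^bsub>E\<^esub> (\<iota> a \<otimes>\<^bsub>E\<^esub> t h) \<otimes>\<^bsub>E\<^esub> \<iota> b"
      using g t by (simp add: f_def xy E.m_assoc)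
    also have "\<dots> = t g \<otimes>\<^bsub>E\<^esub> t h \<otimes>\<^bsub>E\<^esub> (\<iota> (act a h) \<otimes>\<^bsub>E\<^esub> \<iota> b)"
      using g t swap[of "t h" a] by (simp add: E.m_assoc)
    also have "\<dots> = t (g \<otimes>\<^bsub>G\<^esub> h) \<otimes>\<^bsub>E\<^esub> \<iota> (\<delta> (g, h) \<otimes>\<^bsub>A\<^esub> (act a h \<otimes>\<^bsub>A\<^esub> b))"
      using g t \<delta>(1) by (simp add: \<delta>(2) E.m_assoc)
    also have "\<delta> (g, h) \<otimes>\<^bsub>A\<^esub> (act a h \<otimes>\<^bsub>A\<^esub> b) = act a h \<otimes>\<^bsub>A\<^esub> b \<otimes>\<^bsub>A\<^esub> \<delta> (g, h)"
      using g \<delta>(1) by (simp add: A.m_ac)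
    finally show "f (x \<otimes>\<^bsub>ext \<delta>\<^esub> y) = f x \<otimes>\<^bsub>E\<^esub> f y"
      by (simp add: f_def xy)
  qed
  moreover have "bij_betw f (carrier (ext \<delta>)) (carrier E)"
    unfolding bij_betw_def
  proof
    show "inj_on f (carrier (ext \<delta>))"
    proof (rule inj_onI)
      fix x y assume x: "x \<in> carrier (ext \<delta>)" "y \<in> carrier (ext \<delta>)" "f x = f y"
      have "\<pi> (f z) = fst z" if "z \<in> carrier (ext \<delta>)" for z
        using that t by (auto simp: f_def \<pi>\<iota>)
      with x have "fst x = fst y" by metis
      with x show "x = y" by (auto simp: f_def intro: uniq)
    qed
    show "f ` carrier (ext \<delta>) = carrier E"
    proof (intro equalityI subsetI)
      fix e assume e: "e \<in> carrier E"
      then obtain a where "a \<in> carrier A" "e = f (\<pi> e, a)" using diff by (auto simp: f_def)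
      then show "e \<in> f ` carrier (ext \<delta>)" using e by (intro image_eqI[of _ _ "(\<pi> e, a)"]) auto
    qed (use t in \<open>auto simp: f_def\<close>)
  qed
  moreover have "f ` ext_embed G ` carrier A = \<iota> ` carrier A"
    by (simp add: image_image f_def ext_embed_def t1 cong: image_cong)
  ultimately show ?thesis using cocycle unfolding iso_def by blast
qed

end


section \<open>Homomorphisms out of a presented group\<close>

primrec word_eval :: "('q, 'n) monoid_scheme \<Rightarrow> ('x \<Rightarrow> 'q) \<Rightarrow> 'x word \<Rightarrow> 'q" where
  "word_eval Q c [] = \<one>\<^bsub>Q\<^esub>"
| "word_eval Q c (l # w) = (if fst l then c (snd l) else inv\<^bsub>Q\<^esub> c (snd l)) \<otimes>\<^bsub>Q\<^esub> word_eval Q c w"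

lemma word_eval_cong:
  "w \<in> lists (UNIV \<times> S) \<Longrightarrow> (\<And>x. x \<in> S \<Longrightarrow> c x = c' x) \<Longrightarrow> word_eval Q c w = word_eval Q c' w"
  by (induction w) auto

lemma (in group) word_eval_closed:
  "w \<in> lists (UNIV \<times> S) \<Longrightarrow> c \<in> S \<rightarrow> carrier G \<Longrightarrow> word_eval G c w \<in> carrier G"
  by (induction w) (auto simp: Pi_iff)

lemma (in group) word_eval_append:
  "\<lbrakk>u \<in> lists (UNIV \<times> S); v \<in> lists (UNIV \<times> S); c \<in> S \<rightarrow> carrier G\<rbrakk>
    \<Longrightarrow> word_eval G c (u @ v) = word_eval G c u \<otimes> word_eval G c v"
proof (induction u)
  case Nil
  then show ?case using word_eval_closed[of v S c] by simp
next
  case (Cons l u)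
  have "word_eval G c u \<in> carrier G" "word_eval G c v \<in> carrier G"
    using word_eval_closed[of _ S c] Cons.prems by auto
  moreover have "c (snd l) \<in> carrier G" using Cons.prems by auto
  ultimately show ?case using Cons by (auto simp: m_assoc)
qed

lemma pres_cong_lists:
  "(u, v) \<in> pres_cong S R \<Longrightarrow> u \<in> lists (UNIV \<times> S) \<and> v \<in> lists (UNIV \<times> S)"
  by (induction rule: pres_cong.induct) auto

lemma equiv_pres_cong: "equiv (lists (UNIV \<times> S)) (pres_cong S R)"
proof (rule equivI)
  show "pres_cong S R \<subseteq> lists (UNIV \<times> S) \<times> lists (UNIV \<times> S)"
    by (auto dest: pres_cong_lists simp del: in_lists_conv_set)
  show "refl_on (lists (UNIV \<times> S)) (pres_cong S R)" by (rule refl_onI) (rule pres_cong.refl)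
  show "sym (pres_cong S R)" by (rule symI) (rule pres_cong.sym)
  show "trans (pres_cong S R)" by (rule transI) (rule pres_cong.trans)
qed

text \<open>The congruence is the least one containing the cancellations and the relations, so it is
  enough that evaluation respects these; concatenation is respected because evaluation is
  multiplicative.\<close>

lemma (in group) word_eval_pres_cong:
  assumes "(u, v) \<in> pres_cong S R" and c: "c \<in> S \<rightarrow> carrier G"
    and R: "\<And>u v. \<lbrakk>(u, v) \<in> R; u \<in> lists (UNIV \<times> S); v \<in> lists (UNIV \<times> S)\<rbrakk>
      \<Longrightarrow> word_eval G c u = word_eval G c v"
  shows "word_eval G c u = word_eval G c v"
  using assms(1)
proof (induction rule: pres_cong.induct)
  case (app u v u' v')
  then show ?case using pres_cong_lists word_eval_append[OF _ _ c] by metis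
next
  case (cancel x b)
  then have "c x \<in> carrier G" using c by auto
  then show ?case by simp
qed (use R in auto)

abbreviation pres_class :: "'x set \<Rightarrow> ('x word \<times> 'x word) set \<Rightarrow> 'x word \<Rightarrow> 'x word set"
  where "pres_class S R w \<equiv> pres_cong S R `` {w}"

lemma presented_group_carrier:
  "carrier (presented_group S R) = pres_class S R ` lists (UNIV \<times> S)"
  unfolding presented_group_def quotient_def by auto

lemma pres_class_eqI: "(u, v) \<in> pres_cong S R \<Longrightarrow> pres_class S R u = pres_class S R v"
  by (rule equiv_class_eq[OF equiv_pres_cong])

text \<open>By congruence all sets in the double union are the class of one concatenation, and by
  reflexivity there is at least one of them.\<close>

lemma pres_class_mult:
  assumes "u \<in> lists (UNIV \<times> S)" "v \<in> lists (UNIV \<times> S)"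
  shows "pres_class S R u \<otimes>\<^bsub>presented_group S R\<^esub> pres_class S R v = pres_class S R (u @ v)"
proof -
  have self: "u \<in> pres_class S R u" "v \<in> pres_class S R v"
    using assms by (auto intro: pres_cong.refl)
  have "pres_class S R (u' @ v') = pres_class S R (u @ v)"
    if "u' \<in> pres_class S R u" "v' \<in> pres_class S R v" for u' v'
    using that by (intro pres_class_eqI pres_cong.app) (auto intro: pres_cong.sym)
  then have "(\<Union>u'\<in>pres_class S R u. \<Union>v'\<in>pres_class S R v. pres_class S R (u' @ v'))
      = (\<Union>u'\<in>pres_class S R u. \<Union>v'\<in>pres_class S R v. pres_class S R (u @ v))"
    by (intro SUP_cong[OF HOL.refl]) blast
  also have "\<dots> = pres_class S R (u @ v)" using self by blast
  finally show ?thesis by (simp add: presented_group_def)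
qed

lemma presented_group_mult_closed:
  assumes "P \<in> carrier (presented_group S R)" "P' \<in> carrier (presented_group S R)"
  shows "P \<otimes>\<^bsub>presented_group S R\<^esub> P' \<in> carrier (presented_group S R)"
proof -
  obtain u v where uv: "u \<in> lists (UNIV \<times> S)" "v \<in> lists (UNIV \<times> S)"
    "P = pres_class S R u" "P' = pres_class S R v"
    using assms unfolding presented_group_carrier by blast
  have "u @ v \<in> lists (UNIV \<times> S)" using uv by simp
  then show ?thesis
    unfolding presented_group_carrier uv(3,4) pres_class_mult[OF uv(1,2)] by (rule imageI)
qed

text \<open>The uniqueness half of the universal property. Membership in \<open>hom\<close> gives
  multiplicativity only, so the values at the empty word and at inverse letters are derived inside
  \<open>Q\<close>.\<close>

lemma hom_presented_group_eq:
  assumes Q: "group Q" and f: "f \<in> hom (presented_group S R) Q" and w: "w \<in> lists (UNIV \<times> S)"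
  shows "f (pres_class S R w) = word_eval Q (\<lambda>x. f (pres_class S R [(True, x)])) w"
proof -
  interpret Q: group Q by (rule Q)
  have cl: "f (pres_class S R w) \<in> carrier Q" if "w \<in> lists (UNIV \<times> S)" for w
    using that hom_in_carrier[OF f] unfolding presented_group_carrier by blast
  have mult: "f (pres_class S R (u @ v)) = f (pres_class S R u) \<otimes>\<^bsub>Q\<^esub> f (pres_class S R v)"
    if "u \<in> lists (UNIV \<times> S)" "v \<in> lists (UNIV \<times> S)" for u v
    using that hom_mult[OF f] unfolding presented_group_carrier
    by (simp add: pres_class_mult[symmetric])
  \<comment> \<open>An idempotent of a group is the unit.\<close>
  have one: "f (pres_class S R []) = \<one>\<^bsub>Q\<^esub>"
    using mult[of "[]" "[]"] cl[of "[]"] by simp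
  have inv: "f (pres_class S R [(False, x)]) = inv\<^bsub>Q\<^esub> f (pres_class S R [(True, x)])" if "x \<in> S" for x
  proof (rule Q.inv_equality[symmetric])
    have "pres_class S R ([(False, x)] @ [(True, x)]) = pres_class S R []"
      using pres_cong.cancel[OF that, of False] by (intro pres_class_eqI) simp
    then show "f (pres_class S R [(False, x)]) \<otimes>\<^bsub>Q\<^esub> f (pres_class S R [(True, x)]) = \<one>\<^bsub>Q\<^esub>"
      using mult[of "[(False, x)]" "[(True, x)]"] one that by simp
  qed (use cl that in auto)
  show ?thesis
    using w
  proof (induction w)
    case (Cons l w)
    have "f (pres_class S R ([l] @ w)) = f (pres_class S R [l]) \<otimes>\<^bsub>Q\<^esub> f (pres_class S R w)"
      using Cons by (intro mult) auto
    moreover have "f (pres_class S R [l]) = (if fst l then f (pres_class S R [(True, snd l)])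
        else inv\<^bsub>Q\<^esub> f (pres_class S R [(True, snd l)]))"
      using inv[of "snd l"] Cons.hyps by (cases l) auto
    ultimately show ?case using Cons.IH by simp
  qed (simp add: one)
qed

text \<open>The existence half of the universal property: evaluate an arbitrary word of the class,
  which is well defined by \<open>word_eval_pres_cong\<close>.\<close>

lemma hom_presented_group_ex:
  assumes Q: "group Q" and c: "c \<in> S \<rightarrow> carrier Q"
    and R: "\<And>u v. \<lbrakk>(u, v) \<in> R; u \<in> lists (UNIV \<times> S); v \<in> lists (UNIV \<times> S)\<rbrakk>
      \<Longrightarrow> word_eval Q c u = word_eval Q c v"
  shows "\<exists>f \<in> hom (presented_group S R) Q. \<forall>x\<in>S. f (pres_class S R [(True, x)]) = c x"
proof
  interpret Q: group Q by (rule Q)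
  define f where "f P = word_eval Q c (SOME u. u \<in> P)" for P
  have f: "f (pres_class S R w) = word_eval Q c w" if "w \<in> lists (UNIV \<times> S)" for w
  proof -
    have "w \<in> pres_class S R w" using that by (auto intro: pres_cong.refl)
    then have "(w, SOME u. u \<in> pres_class S R w) \<in> pres_cong S R"
      using someI[of "\<lambda>u. u \<in> pres_class S R w" w] by simp
    then show ?thesis
      unfolding f_def using Q.word_eval_pres_cong[OF _ c R] by metis
  qed
  show "\<forall>x\<in>S. f (pres_class S R [(True, x)]) = c x"
    using f c by (auto simp: Pi_iff)
  show "f \<in> hom (presented_group S R) Q"
  proof (rule homI)
    fix P assume "P \<in> carrier (presented_group S R)"
    then obtain w where "w \<in> lists (UNIV \<times> S)" "P = pres_class S R w"
      unfolding presented_group_carrier by blast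
    then show "f P \<in> carrier Q" by (simp only: f Q.word_eval_closed[OF _ c])
  next
    fix P P' assume "P \<in> carrier (presented_group S R)" "P' \<in> carrier (presented_group S R)"
    then obtain u v where "P = pres_class S R u" "P' = pres_class S R v"
      and uv: "u \<in> lists (UNIV \<times> S)" "v \<in> lists (UNIV \<times> S)"
      unfolding presented_group_carrier by blast
    moreover have "u @ v \<in> lists (UNIV \<times> S)" using uv by simp
    ultimately show "f (P \<otimes>\<^bsub>presented_group S R\<^esub> P') = f P \<otimes>\<^bsub>Q\<^esub> f P'"
      using uv by (simp only: pres_class_mult f Q.word_eval_append[OF _ _ c])
  qed
qed


section \<open>The exterior square of an abelian group\<close>

text \<open>Serves to evaluate the definite descriptions \<open>comm_map\<close> and
  \<open>kappa_bar\<close>: words in the symbols fill the exterior square, and extensionality fixes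
  the values outside it.\<close>

lemma ext_square_hom_unique:
  assumes "group Q" "f \<in> hom (ext_square N) Q" "f' \<in> hom (ext_square N) Q"
    and "f \<in> extensional (carrier (ext_square N))" "f' \<in> extensional (carrier (ext_square N))"
    and "\<And>g h. \<lbrakk>g \<in> carrier N; h \<in> carrier N\<rbrakk> \<Longrightarrow> f (wedge N g h) = f' (wedge N g h)"
  shows "f = f'"
proof (rule extensionalityI)
  fix P assume "P \<in> carrier (ext_square N)"
  then obtain w where w: "P = pres_class (carrier N \<times> carrier N) (ext_rels N) w"
    "w \<in> lists (UNIV \<times> (carrier N \<times> carrier N))"
    unfolding ext_square_def presented_group_carrier by blast
  show "f P = f' P"
    using assms(2,3,6) unfolding w(1) ext_square_def wedge_def
    by (auto simp: hom_presented_group_eq[OF assms(1) _ w(2)] intro!: word_eval_cong[OF w(2)])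
qed (use assms in auto)

text \<open>Evaluating words in the symbols yields exactly the products of values of
  \<open>c\<close> and their inverses.\<close>

lemma ext_square_hom_image:
  assumes Q: "group Q" and f: "f \<in> hom (ext_square N) Q"
    and c: "\<And>g h. \<lbrakk>g \<in> carrier N; h \<in> carrier N\<rbrakk> \<Longrightarrow> f (wedge N g h) = c (g, h)"
  shows "f ` carrier (ext_square N) = generate Q (c ` (carrier N \<times> carrier N))"
proof -
  interpret Q: group Q by (rule Q)
  let ?S = "carrier N \<times> carrier N"
  have f': "f (pres_class ?S (ext_rels N) w) = word_eval Q c w" if "w \<in> lists (UNIV \<times> ?S)" for w
    using hom_presented_group_eq[OF Q _ that, of f "ext_rels N"] f c
    unfolding ext_square_def wedge_def by (auto intro!: word_eval_cong[OF that])
  have "wedge N g h \<in> carrier (ext_square N)" if "g \<in> carrier N" "h \<in> carrier N" for g h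
    using that unfolding wedge_def ext_square_def presented_group_carrier by auto
  then have cQ: "c \<in> ?S \<rightarrow> carrier Q" using hom_in_carrier[OF f] c by fastforce
  have "f ` carrier (ext_square N) = word_eval Q c ` lists (UNIV \<times> ?S)"
    unfolding ext_square_def presented_group_carrier image_image using f' by (rule image_cong[OF HOL.refl])
  also have "\<dots> = generate Q (c ` ?S)"
  proof (intro equalityI subsetI)
    fix x assume "x \<in> word_eval Q c ` lists (UNIV \<times> ?S)"
    then obtain w where "w \<in> lists (UNIV \<times> ?S)" "x = word_eval Q c w" by blast
    then show "x \<in> generate Q (c ` ?S)"
    proof (induction w arbitrary: x)
      case (Cons l w)
      have "c (snd l) \<in> c ` ?S" using Cons.hyps by auto
      then show ?case
        using Cons by (auto intro: generate.intros)
    qed (auto intro: generate.one)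
  next
    fix x assume "x \<in> generate Q (c ` ?S)"
    then show "x \<in> word_eval Q c ` lists (UNIV \<times> ?S)"
    proof (induction rule: generate.induct)
      case one
      show ?case by (rule image_eqI[of _ _ "[]"]) auto
    next
      case (incl h)
      then obtain y where "y \<in> ?S" "h = c y" by blast
      then show ?case using cQ by (intro image_eqI[of _ _ "[(True, y)]"]) (auto simp: Pi_iff)
    next
      case (inv h)
      then obtain y where "y \<in> ?S" "h = c y" by blast
      then show ?case using cQ by (intro image_eqI[of _ _ "[(False, y)]"]) (auto simp: Pi_iff)
    next
      case (eng h1 h2)
      then obtain u v where "h1 = word_eval Q c u" "h2 = word_eval Q c v"
        "u \<in> lists (UNIV \<times> ?S)" "v \<in> lists (UNIV \<times> ?S)" by blast
      then show ?case using Q.word_eval_append[OF _ _ cQ] by (intro image_eqI[of _ _ "u @ v"]) auto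
    qed
  qed
  finally show ?thesis .
qed

text \<open>Conjugation in an abelian group is trivial, so the defining relations of the exterior
  square become additivity in each argument and vanishing on the diagonal. The reversed order of
  factors in the first relation is harmless as \<open>Q\<close> is commutative.\<close>

lemma ext_square_hom_ex:
  assumes N: "comm_group N" and Q: "comm_group Q" and c: "c \<in> carrier N \<times> carrier N \<rightarrow> carrier Q"
    and mult_left: "\<And>g g' h. \<lbrakk>g \<in> carrier N; g' \<in> carrier N; h \<in> carrier N\<rbrakk>
      \<Longrightarrow> c (g \<otimes>\<^bsub>N\<^esub> g', h) = c (g, h) \<otimes>\<^bsub>Q\<^esub> c (g', h)"
    and mult_right: "\<And>g h h'. \<lbrakk>g \<in> carrier N; h \<in> carrier N; h' \<in> carrier N\<rbrakk>
      \<Longrightarrow> c (g, h \<otimes>\<^bsub>N\<^esub> h') = c (g, h) \<otimes>\<^bsub>Q\<^esub> c (g, h')"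
    and alternating: "\<And>h. h \<in> carrier N \<Longrightarrow> c (h, h) = \<one>\<^bsub>Q\<^esub>"
  shows "\<exists>f. f \<in> hom (ext_square N) Q \<and> f \<in> extensional (carrier (ext_square N)) \<and>
    (\<forall>g\<in>carrier N. \<forall>h\<in>carrier N. f (wedge N g h) = c (g, h))"
proof -
  interpret N: comm_group N by (rule N)
  interpret Q: comm_group Q by (rule Q)
  let ?S = "carrier N \<times> carrier N"
  have conj: "conj_by N h g = g" if "g \<in> carrier N" "h \<in> carrier N" for g h
    using that unfolding conj_by_def by (simp add: N.m_comm[of h g] N.m_assoc)
  have cl: "c (g, h) \<in> carrier Q" if "g \<in> carrier N" "h \<in> carrier N" for g h
    using c that by auto
  have "word_eval Q c u = word_eval Q c v" if "(u, v) \<in> ext_rels N" for u v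
    using that unfolding ext_rels_def
    by (auto simp: conj mult_left mult_right alternating cl Q.m_comm)
  then obtain f where f: "f \<in> hom (ext_square N) Q"
    "\<forall>g\<in>carrier N. \<forall>h\<in>carrier N. f (wedge N g h) = c (g, h)"
    using hom_presented_group_ex[OF Q.group_axioms c, of "ext_rels N"]
    unfolding ext_square_def wedge_def by fastforce
  have wedge: "wedge N g h \<in> carrier (ext_square N)" if "g \<in> carrier N" "h \<in> carrier N" for g h
    using that unfolding wedge_def ext_square_def presented_group_carrier by auto
  \<comment> \<open>Restriction provides the extensionality that the definite descriptions ask for;
    closure of the carrier under products keeps the map multiplicative.\<close>
  have "restrict f (carrier (ext_square N)) \<in> hom (ext_square N) Q"
  proof (rule homI)
    fix x y assume xy: "x \<in> carrier (ext_square N)" "y \<in> carrier (ext_square N)"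
    then have "x \<otimes>\<^bsub>ext_square N\<^esub> y \<in> carrier (ext_square N)"
      unfolding ext_square_def by (rule presented_group_mult_closed)
    then show "restrict f (carrier (ext_square N)) (x \<otimes>\<^bsub>ext_square N\<^esub> y)
      = restrict f (carrier (ext_square N)) x \<otimes>\<^bsub>Q\<^esub> restrict f (carrier (ext_square N)) y"
      using xy hom_mult[OF f(1)] by simp
  qed (use hom_in_carrier[OF f(1)] in auto)
  then show ?thesis using f(2) wedge by (intro exI[of _ "restrict f (carrier (ext_square N))"]) auto
qed

text \<open>For abelian \<open>N\<close> the commutator map is trivial, so its kernel is everything.\<close>

lemma schur_multiplier_abelian:
  assumes N: "comm_group N"
  shows "schur_multiplier N = ext_square N"
proof -
  interpret N: comm_group N by (rule N)
  let ?T = "N\<lparr>carrier := derived N (carrier N)\<rparr>"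
  have der: "derived N (carrier N) = {\<one>\<^bsub>N\<^esub>}" by (rule N.derived_eq_singleton) simp
  have T: "comm_group ?T"
    unfolding der by (rule comm_groupI) auto
  have comm: "g \<otimes>\<^bsub>N\<^esub> h \<otimes>\<^bsub>N\<^esub> inv\<^bsub>N\<^esub> g \<otimes>\<^bsub>N\<^esub> inv\<^bsub>N\<^esub> h = \<one>\<^bsub>N\<^esub>"
    if "g \<in> carrier N" "h \<in> carrier N" for g h
    using that by (simp add: N.m_comm[of g h] N.m_assoc)
  let ?P = "\<lambda>f. f \<in> hom (ext_square N) ?T \<and> f \<in> extensional (carrier (ext_square N)) \<and>
    (\<forall>g\<in>carrier N. \<forall>h\<in>carrier N.
      f (wedge N g h) = g \<otimes>\<^bsub>N\<^esub> h \<otimes>\<^bsub>N\<^esub> inv\<^bsub>N\<^esub> g \<otimes>\<^bsub>N\<^esub> inv\<^bsub>N\<^esub> h)"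
  have "\<exists>f. f \<in> hom (ext_square N) ?T \<and> f \<in> extensional (carrier (ext_square N)) \<and>
    (\<forall>g\<in>carrier N. \<forall>h\<in>carrier N. f (wedge N g h) = \<one>\<^bsub>N\<^esub>)"
    by (rule ext_square_hom_ex[OF N T, of "\<lambda>_. \<one>\<^bsub>N\<^esub>"]) (simp_all add: der)
  then obtain f where f: "?P f" using comm by auto
  have "?P (comm_map N)"
    unfolding comm_map_def
  proof (rule theI[of ?P f])
    show "?P f" by (rule f)
    fix f' assume f': "?P f'"
    show "f' = f"
      by (rule ext_square_hom_unique[OF comm_group.axioms(2)[OF T]]) (use f f' in auto)
  qed
  then have "comm_map N \<in> hom (ext_square N) ?T" by blast
  then have "comm_map N x = \<one>\<^bsub>N\<^esub>" if "x \<in> carrier (ext_square N)" for x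
    using hom_in_carrier[of "comm_map N" _ ?T] that der by fastforce
  then have "kernel (ext_square N) ?T (comm_map N) = carrier (ext_square N)"
    unfolding kernel_def by auto
  then show ?thesis unfolding schur_multiplier_def by simp
qed

text \<open>All members of \<open>C\<close> have the same commutator values \<open>c\<close>, and
  there is at least one member, so the condition in \<open>kappa_bar\<close> prescribes exactly the
  values \<open>c\<close> on the symbols.\<close>

lemma kappa_bar_image:
  assumes N: "comm_group N" and Q: "comm_group Q" and c: "c \<in> carrier N \<times> carrier N \<rightarrow> carrier Q"
    and mult_left: "\<And>g g' h. \<lbrakk>g \<in> carrier N; g' \<in> carrier N; h \<in> carrier N\<rbrakk>
      \<Longrightarrow> c (g \<otimes>\<^bsub>N\<^esub> g', h) = c (g, h) \<otimes>\<^bsub>Q\<^esub> c (g', h)"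
    and mult_right: "\<And>g h h'. \<lbrakk>g \<in> carrier N; h \<in> carrier N; h' \<in> carrier N\<rbrakk>
      \<Longrightarrow> c (g, h \<otimes>\<^bsub>N\<^esub> h') = c (g, h) \<otimes>\<^bsub>Q\<^esub> c (g, h')"
    and alternating: "\<And>h. h \<in> carrier N \<Longrightarrow> c (h, h) = \<one>\<^bsub>Q\<^esub>"
    and C: "C \<noteq> {}" "\<And>\<epsilon> g h. \<lbrakk>\<epsilon> \<in> C; g \<in> carrier N; h \<in> carrier N\<rbrakk>
      \<Longrightarrow> \<epsilon> (g, h) \<otimes>\<^bsub>Q\<^esub> inv\<^bsub>Q\<^esub> \<epsilon> (h, g) = c (g, h)"
  shows "kappa_bar N Q C ` carrier (schur_multiplier N) = generate Q (c ` (carrier N \<times> carrier N))"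
proof -
  have Q': "group Q" by (rule comm_group.axioms(2)[OF Q])
  let ?P = "\<lambda>f. f \<in> hom (ext_square N) Q \<and> f \<in> extensional (carrier (ext_square N)) \<and>
    (\<forall>\<epsilon>\<in>C. \<forall>g\<in>carrier N. \<forall>h\<in>carrier N.
      f (wedge N g h) = \<epsilon> (g, h) \<otimes>\<^bsub>Q\<^esub> inv\<^bsub>Q\<^esub> \<epsilon> (h, g))"
  have P: "?P f \<longleftrightarrow> f \<in> hom (ext_square N) Q \<and> f \<in> extensional (carrier (ext_square N)) \<and>
    (\<forall>g\<in>carrier N. \<forall>h\<in>carrier N. f (wedge N g h) = c (g, h))" for f
    using C by auto
  obtain f where f: "?P f"
    unfolding P using ext_square_hom_ex[OF N Q c mult_left mult_right alternating] by blast
  have "?P (kappa_bar N Q C)"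
    unfolding kappa_bar_def schur_multiplier_abelian[OF N]
  proof (rule theI[of ?P f])
    show "?P f" by (rule f)
    fix f' assume f': "?P f'"
    show "f' = f"
      by (rule ext_square_hom_unique[OF Q']) (use f f' in \<open>auto simp: P\<close>)
  qed
  then show ?thesis
    unfolding P schur_multiplier_abelian[OF N] by (intro ext_square_hom_image[OF Q']) auto
qed

text \<open>This is the multiplicativity of commutators in a central extension of an abelian group,
  expressed by a cocycle. The cocycle identity at (g, g', h), (h, g, g') and (g, h, g') relates the
  nine values involved.\<close>

lemma commutator_pairing_mult:
  assumes N: "comm_group N" and Q: "comm_group Q"
    and e: "\<And>g h. \<lbrakk>g \<in> carrier N; h \<in> carrier N\<rbrakk> \<Longrightarrow> e (g, h) \<in> carrier Q"
    and cocycle: "\<And>g h k. \<lbrakk>g \<in> carrier N; h \<in> carrier N; k \<in> carrier N\<rbrakk>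
      \<Longrightarrow> e (g, h) \<otimes>\<^bsub>Q\<^esub> e (g \<otimes>\<^bsub>N\<^esub> h, k) = e (h, k) \<otimes>\<^bsub>Q\<^esub> e (g, h \<otimes>\<^bsub>N\<^esub> k)"
    and g: "g \<in> carrier N" "g' \<in> carrier N" "h \<in> carrier N"
  shows "e (g \<otimes>\<^bsub>N\<^esub> g', h) \<otimes>\<^bsub>Q\<^esub> inv\<^bsub>Q\<^esub> e (h, g \<otimes>\<^bsub>N\<^esub> g')
    = (e (g, h) \<otimes>\<^bsub>Q\<^esub> inv\<^bsub>Q\<^esub> e (h, g)) \<otimes>\<^bsub>Q\<^esub> (e (g', h) \<otimes>\<^bsub>Q\<^esub> inv\<^bsub>Q\<^esub> e (h, g'))"
proof -
  interpret N: comm_group N by (rule N)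
  interpret Q: comm_group Q by (rule Q)
  define a b p q r s t x y where "a = e (g, g')" and "b = e (g \<otimes>\<^bsub>N\<^esub> g', h)" and "p = e (g', h)"
    and "q = e (g, g' \<otimes>\<^bsub>N\<^esub> h)" and "r = e (h, g)" and "s = e (h \<otimes>\<^bsub>N\<^esub> g, g')"
    and "t = e (h, g \<otimes>\<^bsub>N\<^esub> g')" and "x = e (g, h)" and "y = e (h, g')"
  note defs = this
  have cl: "a \<in> carrier Q" "b \<in> carrier Q" "p \<in> carrier Q" "q \<in> carrier Q" "r \<in> carrier Q"
    "s \<in> carrier Q" "t \<in> carrier Q" "x \<in> carrier Q" "y \<in> carrier Q"
    using g e by (simp_all add: defs)
  have 1: "a \<otimes>\<^bsub>Q\<^esub> b = p \<otimes>\<^bsub>Q\<^esub> q" and 2: "r \<otimes>\<^bsub>Q\<^esub> s = a \<otimes>\<^bsub>Q\<^esub> t" and 3: "x \<otimes>\<^bsub>Q\<^esub> s = y \<otimes>\<^bsub>Q\<^esub> q"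
    using cocycle[of g g' h] cocycle[of h g g'] cocycle[of g h g'] g
    by (simp_all add: defs N.m_comm)
  \<comment> \<open>With \<open>r\<close> and \<open>y\<close> added, equation \<open>1\<close>
    introduces \<open>q\<close>, then \<open>3\<close> trades it for \<open>s\<close>, then
    \<open>2\<close> eliminates \<open>s\<close>, after which \<open>a\<close> cancels.\<close>
  have "a \<otimes>\<^bsub>Q\<^esub> (b \<otimes>\<^bsub>Q\<^esub> (r \<otimes>\<^bsub>Q\<^esub> y)) = (a \<otimes>\<^bsub>Q\<^esub> b) \<otimes>\<^bsub>Q\<^esub> (r \<otimes>\<^bsub>Q\<^esub> y)"
    using cl by (simp add: Q.m_assoc)
  also have "\<dots> = p \<otimes>\<^bsub>Q\<^esub> r \<otimes>\<^bsub>Q\<^esub> (y \<otimes>\<^bsub>Q\<^esub> q)"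
    unfolding 1 using cl by (simp add: Q.m_ac)
  also have "\<dots> = p \<otimes>\<^bsub>Q\<^esub> x \<otimes>\<^bsub>Q\<^esub> (r \<otimes>\<^bsub>Q\<^esub> s)"
    unfolding 3[symmetric] using cl by (simp add: Q.m_ac)
  also have "\<dots> = a \<otimes>\<^bsub>Q\<^esub> (x \<otimes>\<^bsub>Q\<^esub> p \<otimes>\<^bsub>Q\<^esub> t)"
    unfolding 2 using cl by (simp add: Q.m_ac)
  finally have 4: "b \<otimes>\<^bsub>Q\<^esub> (r \<otimes>\<^bsub>Q\<^esub> y) = x \<otimes>\<^bsub>Q\<^esub> p \<otimes>\<^bsub>Q\<^esub> t"
    by (subst (asm) Q.Units_l_cancel) (use cl in simp_all)
  have "b \<otimes>\<^bsub>Q\<^esub> inv\<^bsub>Q\<^esub> t = b \<otimes>\<^bsub>Q\<^esub> (r \<otimes>\<^bsub>Q\<^esub> y) \<otimes>\<^bsub>Q\<^esub> inv\<^bsub>Q\<^esub> (r \<otimes>\<^bsub>Q\<^esub> y) \<otimes>\<^bsub>Q\<^esub> inv\<^bsub>Q\<^esub> t"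
    using cl by (simp add: Q.m_assoc)
  also have "\<dots> = x \<otimes>\<^bsub>Q\<^esub> p \<otimes>\<^bsub>Q\<^esub> (inv\<^bsub>Q\<^esub> (r \<otimes>\<^bsub>Q\<^esub> y) \<otimes>\<^bsub>Q\<^esub> (t \<otimes>\<^bsub>Q\<^esub> inv\<^bsub>Q\<^esub> t))"
    unfolding 4 using cl by (simp only: Q.m_ac Q.m_closed Q.inv_closed)
  also have "\<dots> = (x \<otimes>\<^bsub>Q\<^esub> inv\<^bsub>Q\<^esub> r) \<otimes>\<^bsub>Q\<^esub> (p \<otimes>\<^bsub>Q\<^esub> inv\<^bsub>Q\<^esub> y)"
    using cl by (simp add: Q.inv_mult Q.m_ac)
  finally show ?thesis unfolding defs .
qed


section \<open>The derived series of an extension\<close>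

locale solvable_gmodule = gmodule G A act
  for G :: "('g, 'm) monoid_scheme" and A :: "('a, 'n) monoid_scheme" and act +
  assumes solvable_G: "solvable G"
    and nontrivial_G: "carrier G \<noteq> {\<one>\<^bsub>G\<^esub>}"
    and nontrivial_A: "carrier A \<noteq> {\<one>\<^bsub>A\<^esub>}"
begin

lemma last_term_gam:
  obtains n where "(derived G ^^ n) (carrier G) = gam G" "derived G (gam G) = {\<one>\<^bsub>G\<^esub>}"
    "gam G \<noteq> {\<one>\<^bsub>G\<^esub>}"
  using G.solvable_last_derived[OF solvable_G nontrivial_G] by metis

lemma gam_subgroup: "subgroup (gam G) G"
  using last_term_gam G.exp_of_derived_is_subgroup[OF G.subgroup_self] by metis

lemma gam_closed [simp, intro]: "g \<in> gam G \<Longrightarrow> g \<in> carrier G"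
  using subgroup.mem_carrier[OF gam_subgroup] .

lemma gam_mult_closed [simp, intro]: "g \<in> gam G \<Longrightarrow> h \<in> gam G \<Longrightarrow> g \<otimes>\<^bsub>G\<^esub> h \<in> gam G"
  using subgroup.m_closed[OF gam_subgroup] .

lemma one_in_gam [simp, intro]: "\<one>\<^bsub>G\<^esub> \<in> gam G"
  using subgroup.one_closed[OF gam_subgroup] .

lemma gam_comm:
  assumes "g \<in> gam G" "h \<in> gam G"
  shows "g \<otimes>\<^bsub>G\<^esub> h = h \<otimes>\<^bsub>G\<^esub> g"
proof -
  obtain n where "derived G (gam G) = {\<one>\<^bsub>G\<^esub>}" using last_term_gam by metis
  moreover have "g \<otimes>\<^bsub>G\<^esub> h \<otimes>\<^bsub>G\<^esub> inv\<^bsub>G\<^esub> g \<otimes>\<^bsub>G\<^esub> inv\<^bsub>G\<^esub> h \<in> derived G (gam G)"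
    unfolding derived_def using assms by (intro generate.incl) blast
  ultimately have "g \<otimes>\<^bsub>G\<^esub> h \<otimes>\<^bsub>G\<^esub> inv\<^bsub>G\<^esub> (h \<otimes>\<^bsub>G\<^esub> g) = \<one>\<^bsub>G\<^esub>"
    using assms by (simp add: G.inv_mult_group G.m_assoc)
  then show ?thesis
    using assms G.inv_solve_right'[of "\<one>\<^bsub>G\<^esub>" "g \<otimes>\<^bsub>G\<^esub> h" "h \<otimes>\<^bsub>G\<^esub> g"] by simp
qed

lemma gam_comm_group: "comm_group (gam_group G)"
proof -
  interpret N: group "gam_group G"
    unfolding gam_group_def by (rule subgroup.subgroup_is_group[OF gam_subgroup group_G])
  show ?thesis
    by (rule N.group_comm_groupI) (simp add: gam_group_def gam_comm)
qed

lemma gam_group_simps [simp]: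
  "carrier (gam_group G) = gam G" "mult (gam_group G) = mult G" "one (gam_group G) = one G"
  by (simp_all add: gam_group_def)

section \<open>The derived subgroup of the preimage of \<open>gam G\<close>\<close>

definition U_gens where "U_gens = {act a g \<otimes>\<^bsub>A\<^esub> inv\<^bsub>A\<^esub> a | a g. a \<in> carrier A \<and> g \<in> gam G}"

text \<open>Modulo the subgroup generated by \<open>U_gens\<close>, these are the commutators of
  elements of the extension above \<open>gam G\<close>.\<close>

definition comm_vals where
  "comm_vals \<delta> = {\<delta> (g, h) \<otimes>\<^bsub>A\<^esub> inv\<^bsub>A\<^esub> \<delta> (h, g) | g h. g \<in> gam G \<and> h \<in> gam G}"

lemma U_gens_subset: "U_gens \<subseteq> carrier A"
  unfolding U_gens_def by auto

lemma comm_vals_subset: "\<delta> \<in> cocycles2 G A act \<Longrightarrow> comm_vals \<delta> \<subseteq> carrier A"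
  unfolding comm_vals_def by auto

text \<open>\<open>c\<close> is the difference of the second components of xy and yx. As a left
  factor of yx it has to pass the action of hg, hence the inverse of hg in the result.\<close>

lemma ext_commutator:
  assumes d: "\<delta> \<in> cocycles2 G A act"
    and g: "g \<in> gam G" "h \<in> gam G" and a: "a \<in> carrier A" "b \<in> carrier A"
  defines "c \<equiv> (act a h \<otimes>\<^bsub>A\<^esub> inv\<^bsub>A\<^esub> a) \<otimes>\<^bsub>A\<^esub> inv\<^bsub>A\<^esub> (act b g \<otimes>\<^bsub>A\<^esub> inv\<^bsub>A\<^esub> b)
    \<otimes>\<^bsub>A\<^esub> (\<delta> (g, h) \<otimes>\<^bsub>A\<^esub> inv\<^bsub>A\<^esub> \<delta> (h, g))"
  shows "(g, a) \<otimes>\<^bsub>ext \<delta>\<^esub> (h, b) \<otimes>\<^bsub>ext \<delta>\<^esub> inv\<^bsub>ext \<delta>\<^esub> (g, a) \<otimes>\<^bsub>ext \<delta>\<^esub> inv\<^bsub>ext \<delta>\<^esub> (h, b)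
    = ext_embed G (act c (inv\<^bsub>G\<^esub> (h \<otimes>\<^bsub>G\<^esub> g)))"
proof -
  interpret E: group "ext \<delta>" by (rule group_ext[OF d])
  let ?x = "(g, a)" and ?y = "(h, b)" and ?z = "ext_embed G (act c (inv\<^bsub>G\<^esub> (h \<otimes>\<^bsub>G\<^esub> g)))"
  have cl: "g \<in> carrier G" "h \<in> carrier G" using g by auto
  have c: "c \<in> carrier A" using cl a d by (simp add: c_def)
  have xyz: "?x \<in> carrier (ext \<delta>)" "?y \<in> carrier (ext \<delta>)" "?z \<in> carrier (ext \<delta>)"
    using cl a c by (auto simp: ext_embed_def)
  \<comment> \<open>The right-hand side displays the three pairs that cancel.\<close>
  have "c \<otimes>\<^bsub>A\<^esub> (act b g \<otimes>\<^bsub>A\<^esub> a \<otimes>\<^bsub>A\<^esub> \<delta> (h, g))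
      = (act a h \<otimes>\<^bsub>A\<^esub> b \<otimes>\<^bsub>A\<^esub> \<delta> (g, h)) \<otimes>\<^bsub>A\<^esub> (a \<otimes>\<^bsub>A\<^esub> inv\<^bsub>A\<^esub> a)
        \<otimes>\<^bsub>A\<^esub> (act b g \<otimes>\<^bsub>A\<^esub> inv\<^bsub>A\<^esub> act b g) \<otimes>\<^bsub>A\<^esub> (\<delta> (h, g) \<otimes>\<^bsub>A\<^esub> inv\<^bsub>A\<^esub> \<delta> (h, g))"
    unfolding c_def using cl a d
    by (simp only: A.inv_mult A.inv_inv A.m_ac A.m_closed A.inv_closed act_closed cocycle_closed)
  then have "?x \<otimes>\<^bsub>ext \<delta>\<^esub> ?y = ?z \<otimes>\<^bsub>ext \<delta>\<^esub> (?y \<otimes>\<^bsub>ext \<delta>\<^esub> ?x)"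
    using cl a d c gam_comm[OF g] by (simp add: ext_embed_def)
  then have "?x \<otimes>\<^bsub>ext \<delta>\<^esub> ?y \<otimes>\<^bsub>ext \<delta>\<^esub> inv\<^bsub>ext \<delta>\<^esub> ?x \<otimes>\<^bsub>ext \<delta>\<^esub> inv\<^bsub>ext \<delta>\<^esub> ?y
      = ?z \<otimes>\<^bsub>ext \<delta>\<^esub> (?y \<otimes>\<^bsub>ext \<delta>\<^esub> ?x) \<otimes>\<^bsub>ext \<delta>\<^esub> inv\<^bsub>ext \<delta>\<^esub> (?y \<otimes>\<^bsub>ext \<delta>\<^esub> ?x)"
    using xyz by (simp only: E.inv_mult_group E.m_assoc E.m_closed E.inv_closed)
  also have "\<dots> = ?z"
    using xyz by (simp only: E.m_assoc E.m_closed E.inv_closed E.r_inv E.r_one)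
  finally show ?thesis .
qed

text \<open>Moving c by the inverse of hg alters it by an element of U, because hg lies in
  \<open>gam G\<close>; so all commutators are in the generated subgroup. Conversely, commutators of
  \<open>A\<close> with elements above \<open>gam G\<close> produce U, and with U available the same
  correction recovers the members of \<open>comm_vals\<close>.\<close>

lemma derived_preimage:
  assumes d: "\<delta> \<in> cocycles2 G A act"
  shows "derived (ext \<delta>) (gam G \<times> carrier A) = ext_embed G ` generate A (U_gens \<union> comm_vals \<delta>)"
proof
  interpret E: group "ext \<delta>" by (rule group_ext[OF d])
  interpret emb: group_hom A "ext \<delta>" "ext_embed G" by (rule ext_embed_group_hom[OF d])
  let ?W = "U_gens \<union> comm_vals \<delta>" and ?D = "derived (ext \<delta>) (gam G \<times> carrier A)"
  have W: "?W \<subseteq> carrier A" using U_gens_subset comm_vals_subset[OF d] by blast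
  interpret W: subgroup "generate A ?W" A by (rule A.generate_is_subgroup[OF W])
  have U: "act a g \<otimes>\<^bsub>A\<^esub> inv\<^bsub>A\<^esub> a \<in> generate A ?W" if "a \<in> carrier A" "g \<in> gam G" for a g
    by (rule generate.incl) (use that in \<open>auto simp: U_gens_def\<close>)
  have V: "\<delta> (g, h) \<otimes>\<^bsub>A\<^esub> inv\<^bsub>A\<^esub> \<delta> (h, g) \<in> generate A ?W" if "g \<in> gam G" "h \<in> gam G" for g h
    by (rule generate.incl) (use that in \<open>auto simp: comm_vals_def\<close>)
  show "?D \<subseteq> ext_embed G ` generate A ?W"
    unfolding derived_def
  proof (rule E.generate_subgroup_incl)
    show "subgroup (ext_embed G ` generate A ?W) (ext \<delta>)"
      by (rule emb.subgroup_img_is_subgroup[OF W.subgroup_axioms])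
    show "derived_set (ext \<delta>) (gam G \<times> carrier A) \<subseteq> ext_embed G ` generate A ?W"
    proof
      fix z assume "z \<in> derived_set (ext \<delta>) (gam G \<times> carrier A)"
      then obtain g a h b where g: "g \<in> gam G" "h \<in> gam G" and a: "a \<in> carrier A" "b \<in> carrier A"
        and z: "z = (g, a) \<otimes>\<^bsub>ext \<delta>\<^esub> (h, b) \<otimes>\<^bsub>ext \<delta>\<^esub> inv\<^bsub>ext \<delta>\<^esub> (g, a) \<otimes>\<^bsub>ext \<delta>\<^esub> inv\<^bsub>ext \<delta>\<^esub> (h, b)"
        by auto
      define c where "c = (act a h \<otimes>\<^bsub>A\<^esub> inv\<^bsub>A\<^esub> a) \<otimes>\<^bsub>A\<^esub> inv\<^bsub>A\<^esub> (act b g \<otimes>\<^bsub>A\<^esub> inv\<^bsub>A\<^esub> b)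
        \<otimes>\<^bsub>A\<^esub> (\<delta> (g, h) \<otimes>\<^bsub>A\<^esub> inv\<^bsub>A\<^esub> \<delta> (h, g))"
      define c' where "c' = act c (inv\<^bsub>G\<^esub> (h \<otimes>\<^bsub>G\<^esub> g))"
      have c: "c \<in> generate A ?W" unfolding c_def using U V g a by simp
      then have cA: "c \<in> carrier A" by simp
      then have c'A: "c' \<in> carrier A" "act c' (h \<otimes>\<^bsub>G\<^esub> g) = c" using g by (simp_all add: c'_def)
      \<comment> \<open>Expresses c' as c minus a generator a^k - a of U, with a = c' and k =
        hg.\<close>
      have "c' = c \<otimes>\<^bsub>A\<^esub> inv\<^bsub>A\<^esub> (act c' (h \<otimes>\<^bsub>G\<^esub> g) \<otimes>\<^bsub>A\<^esub> inv\<^bsub>A\<^esub> c')"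
        unfolding c'A(2) using cA c'A(1) by (simp add: A.inv_mult A.m_assoc[symmetric])
      moreover have "c \<otimes>\<^bsub>A\<^esub> inv\<^bsub>A\<^esub> (act c' (h \<otimes>\<^bsub>G\<^esub> g) \<otimes>\<^bsub>A\<^esub> inv\<^bsub>A\<^esub> c') \<in> generate A ?W"
        using c U[OF c'A(1)] g by simp
      ultimately have "c' \<in> generate A ?W" by simp
      moreover have "z = ext_embed G c'"
        unfolding z c'_def c_def by (rule ext_commutator[OF d g a])
      ultimately show "z \<in> ext_embed G ` generate A ?W" by simp
    qed
  qed
  have sub: "gam G \<times> carrier A \<subseteq> carrier (ext \<delta>)" by auto
  interpret D: subgroup ?D "ext \<delta>" by (rule E.derived_is_subgroup[OF sub])
  have comm: "x \<otimes>\<^bsub>ext \<delta>\<^esub> y \<otimes>\<^bsub>ext \<delta>\<^esub> inv\<^bsub>ext \<delta>\<^esub> x \<otimes>\<^bsub>ext \<delta>\<^esub> inv\<^bsub>ext \<delta>\<^esub> y \<in> ?D"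
    if "x \<in> gam G \<times> carrier A" "y \<in> gam G \<times> carrier A" for x y
    unfolding derived_def by (rule generate.incl) (use that in blast)
  \<comment> \<open>The partner of (g, 0) is a^g rather than a: the action of g^-1 in
    \<open>ext_commutator\<close> then returns a^g - a.\<close>
  have U_D: "ext_embed G (act a g \<otimes>\<^bsub>A\<^esub> inv\<^bsub>A\<^esub> a) \<in> ?D" if a: "a \<in> carrier A" and g: "g \<in> gam G" for a g
    using comm[of "(\<one>\<^bsub>G\<^esub>, act a g)" "(g, \<one>\<^bsub>A\<^esub>)"] a g d
      ext_commutator[OF d one_in_gam g, of "act a g" "\<one>\<^bsub>A\<^esub>"]
    by (simp add: act_mult_distrib act_inv)
  have V_D: "ext_embed G (\<delta> (g, h) \<otimes>\<^bsub>A\<^esub> inv\<^bsub>A\<^esub> \<delta> (h, g)) \<in> ?D" if g: "g \<in> gam G" "h \<in> gam G" for g h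
  proof -
    define c where "c = \<delta> (g, h) \<otimes>\<^bsub>A\<^esub> inv\<^bsub>A\<^esub> \<delta> (h, g)"
    define c' where "c' = act c (inv\<^bsub>G\<^esub> (h \<otimes>\<^bsub>G\<^esub> g))"
    have c: "c \<in> carrier A" using g d by (simp add: c_def)
    then have c': "c' \<in> carrier A" "act c' (h \<otimes>\<^bsub>G\<^esub> g) = c" using g by (simp_all add: c'_def)
    have "ext_embed G c' \<in> ?D"
      using comm[of "(g, \<one>\<^bsub>A\<^esub>)" "(h, \<one>\<^bsub>A\<^esub>)"] ext_commutator[OF d g, of "\<one>\<^bsub>A\<^esub>" "\<one>\<^bsub>A\<^esub>"] g d
      by (simp add: c'_def c_def)
    moreover have "ext_embed G (c \<otimes>\<^bsub>A\<^esub> inv\<^bsub>A\<^esub> c') \<in> ?D"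
      using U_D[OF c'(1), of "h \<otimes>\<^bsub>G\<^esub> g"] g c'(2) by simp
    ultimately have "ext_embed G (c \<otimes>\<^bsub>A\<^esub> inv\<^bsub>A\<^esub> c') \<otimes>\<^bsub>ext \<delta>\<^esub> ext_embed G c' \<in> ?D"
      by (intro D.m_closed)
    also have "ext_embed G (c \<otimes>\<^bsub>A\<^esub> inv\<^bsub>A\<^esub> c') \<otimes>\<^bsub>ext \<delta>\<^esub> ext_embed G c' = ext_embed G c"
      using c c' emb.hom_mult[of "c \<otimes>\<^bsub>A\<^esub> inv\<^bsub>A\<^esub> c'" c'] by (simp add: A.m_assoc del: emb.hom_mult)
    finally show ?thesis by (simp add: c_def)
  qed
  have "ext_embed G ` ?W \<subseteq> ?D"
    using U_D V_D by (auto simp: U_gens_def comm_vals_def)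
  then show "ext_embed G ` generate A ?W \<subseteq> ?D"
    unfolding emb.generate_img[OF W, symmetric]
    by (rule E.generate_subgroup_incl[OF _ D.subgroup_axioms])
qed

text \<open>If \<open>A\<close> is the derived subgroup of the preimage of \<open>gam G\<close>, then by induction every term of the
  derived series of the extension down to the one above \<open>\<one>\<close> contains \<open>A\<close>, hence contains
  the preimage of the corresponding term for \<open>G\<close>.\<close>

lemma last_derived_ext_iff:
  assumes d: "\<delta> \<in> cocycles2 G A act"
  shows "is_last_derived (ext \<delta>) (ext_embed G ` carrier A)
    \<longleftrightarrow> derived (ext \<delta>) (gam G \<times> carrier A) = ext_embed G ` carrier A" (is "_ \<longleftrightarrow> ?D = ?A")
proof -
  interpret E: group "ext \<delta>" by (rule group_ext[OF d])
  interpret emb: group_hom A "ext \<delta>" "ext_embed G" by (rule ext_embed_group_hom[OF d])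
  interpret pr: group_hom "ext \<delta>" G fst by (rule fst_group_hom[OF d])
  obtain n where n: "(derived G ^^ n) (carrier G) = gam G" "derived G (gam G) = {\<one>\<^bsub>G\<^esub>}"
    "gam G \<noteq> {\<one>\<^bsub>G\<^esub>}"
    using last_term_gam by blast
  define S where "S k = (derived (ext \<delta>) ^^ k) (carrier (ext \<delta>))" for k
  have A_eq: "?A = {\<one>\<^bsub>G\<^esub>} \<times> carrier A" by (rule image_ext_embed)
  have SSuc: "S (Suc k) = derived (ext \<delta>) (S k)" for k by (simp add: S_def)
  have S_sub: "subgroup (S k) (ext \<delta>)" for k
    unfolding S_def by (rule E.exp_of_derived_is_subgroup[OF E.subgroup_self])
  have S_carrier: "S k \<subseteq> carrier G \<times> carrier A" for k
    using subgroup.subset[OF S_sub] by simp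
  have fst_carrier: "fst ` carrier (ext \<delta>) = carrier G"
    using A.one_closed by (auto simp: image_iff)
  have fst_S: "fst ` S k = (derived G ^^ k) (carrier G)" for k
    using pr.exp_of_derived_img[OF subset_refl, of k] fst_carrier by (simp add: S_def)
  have S_subset: "S k \<subseteq> (derived G ^^ k) (carrier G) \<times> carrier A" for k
  proof
    fix x assume x: "x \<in> S k"
    have "fst x \<in> (derived G ^^ k) (carrier G)" using imageI[OF x, of fst] unfolding fst_S .
    then show "x \<in> (derived G ^^ k) (carrier G) \<times> carrier A"
      using subsetD[OF S_carrier x] by (cases x) auto
  qed
  \<comment> \<open>Index n + 1 is the first at which the projection to \<open>G\<close> is trivial,
    so the term lies inside \<open>A\<close> for every cocycle.\<close>
  have S_Suc_n: "S (Suc n) \<subseteq> ?A"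
    using S_subset[of "Suc n"] unfolding A_eq by (simp only: funpow.simps o_apply n)
  have A_ne: "?A \<noteq> {\<one>\<^bsub>ext \<delta>\<^esub>}" unfolding A_eq using nontrivial_A by auto
  have D_sub: "?D \<subseteq> ?A"
    unfolding derived_preimage[OF d]
    using A.generate_incl[of "U_gens \<union> comm_vals \<delta>"] U_gens_subset comm_vals_subset[OF d] by blast
  show ?thesis
  proof
    assume last: "is_last_derived (ext \<delta>) ?A"
    then obtain k where k: "?A = S k" unfolding is_last_derived_def S_def by blast
    \<comment> \<open>Down to index n a term projects onto a group containing \<open>gam G\<close>,
      whereas \<open>A\<close> projects to the unit.\<close>
    have "\<not> k \<le> n"
    proof
      assume "k \<le> n"
      then have "gam G \<subseteq> fst ` S k" unfolding fst_S n(1)[symmetric] by (rule G.derived_series_antimono)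
      then have "gam G \<subseteq> {\<one>\<^bsub>G\<^esub>}" unfolding k[symmetric] A_eq by (auto split: if_splits)
      then show False using n(3) one_in_gam by blast
    qed
    then have "?A \<subseteq> S (Suc n)"
      unfolding k unfolding S_def by (intro E.derived_series_antimono) simp
    also have "S n \<subseteq> gam G \<times> carrier A"
      using S_subset[of n] unfolding n(1) .
    then have "S (Suc n) \<subseteq> ?D" unfolding SSuc by (rule E.mono_derived)
    finally show "?D = ?A" using D_sub by blast
  next
    assume D: "?D = ?A"
    have "?A \<subseteq> S k" if "k \<le> Suc n" for k
      using that
    proof (induction k)
      case 0
      show ?case unfolding A_eq S_def by auto
    next
      case (Suc k)
      then have IH: "?A \<subseteq> S k" and k: "k \<le> n" by simp_all
      have "gam G \<times> carrier A \<subseteq> S k"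
      proof (rule subsetI)
        fix x assume "x \<in> gam G \<times> carrier A"
        then obtain g a where x: "x = (g, a)" "g \<in> gam G" "a \<in> carrier A" by blast
        have "g \<in> fst ` S k"
          unfolding fst_S using G.derived_series_antimono[OF k] x(2) n(1) by blast
        then obtain b where b: "(g, b) \<in> S k" by force
        then have bA: "b \<in> carrier A" using S_carrier by blast
        \<comment> \<open>Surjectivity only yields some second component b; as the term already
          contains \<open>A\<close>, b can be corrected to the desired a.\<close>
        have "(\<one>\<^bsub>G\<^esub>, inv\<^bsub>A\<^esub> b \<otimes>\<^bsub>A\<^esub> a) \<in> S k"
          by (rule subsetD[OF IH]) (use x bA in \<open>simp add: A_eq\<close>)
        then have "(g, b) \<otimes>\<^bsub>ext \<delta>\<^esub> (\<one>\<^bsub>G\<^esub>, inv\<^bsub>A\<^esub> b \<otimes>\<^bsub>A\<^esub> a) \<in> S k"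
          using b subgroup.m_closed[OF S_sub] by blast
        then show "x \<in> S k"
          using x bA d by (simp add: act_one A.m_assoc[symmetric])
      qed
      then show ?case unfolding SSuc D[symmetric] by (rule E.mono_derived)
    qed
    then have S: "S (Suc n) = ?A" using S_Suc_n by blast
    moreover have "derived (ext \<delta>) ?A = {\<one>\<^bsub>ext \<delta>\<^esub>}"
      using emb.derived_img[OF subset_refl] A.derived_eq_singleton[OF subset_refl] by simp
    ultimately show "is_last_derived (ext \<delta>) ?A"
      using E.is_last_derivedI[of "Suc n"] A_ne unfolding S_def by simp
  qed
qed

lemma last_derived_ext_iff_generate:
  assumes d: "\<delta> \<in> cocycles2 G A act"
  shows "is_last_derived (ext \<delta>) (ext_embed G ` carrier A)
    \<longleftrightarrow> generate A (U_gens \<union> comm_vals \<delta>) = carrier A"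
proof -
  have "inj (ext_embed G)" by (simp add: inj_def ext_embed_def)
  then show ?thesis
    unfolding last_derived_ext_iff[OF d] derived_preimage[OF d] by (rule inj_image_eq_iff)
qed

end


section \<open>The image of the commutator pairing\<close>

text \<open>Coboundary terms of an abelian group with trivial action are symmetric in the two
  arguments, so they disappear from commutator values.\<close>

lemma (in comm_group) sym_factor_cancel:
  assumes "s \<in> carrier G" "x \<in> carrier G" "y \<in> carrier G"
  shows "(s \<otimes> x) \<otimes> inv (s \<otimes> y) = x \<otimes> inv y"
proof -
  have "(s \<otimes> x) \<otimes> inv (s \<otimes> y) = (s \<otimes> inv s) \<otimes> (x \<otimes> inv y)"
    using assms by (simp only: inv_mult m_ac m_closed inv_closed)
  then show ?thesis using assms by simp
qed

context solvable_gmodule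
begin

abbreviation U where "U \<equiv> commU G A act"
abbreviation Q where "Q \<equiv> quot_A G A act"
abbreviation proj where "proj a \<equiv> U #>\<^bsub>A\<^esub> a"

lemma U_generate: "U = generate A U_gens"
  by (simp add: commU_def U_gens_def)

lemma U_subgroup: "subgroup U A"
  unfolding U_generate by (rule A.generate_is_subgroup[OF U_gens_subset])

lemma Q_comm_group: "comm_group Q"
  unfolding quot_A_def by (rule A.abelian_FactGroup[OF U_subgroup])

lemma proj_group_hom: "group_hom A Q proj"
  using normal.r_coset_hom_Mod[OF A.subgroup_imp_normal[OF U_subgroup]] Q_comm_group
  by (simp add: group_hom_def group_hom_axioms_def comm_group_def quot_A_def)

lemma Q_carrier: "carrier Q = proj ` carrier A"
  by (simp add: quot_A_def carrier_FactGroup)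

lemma proj_U_gens:
  assumes "u \<in> U_gens"
  shows "proj u = \<one>\<^bsub>Q\<^esub>"
proof -
  have "u \<in> U" unfolding U_generate by (rule generate.incl[OF assms])
  then have "proj u = U"
    using A.coset_join2[OF _ U_subgroup] subgroup.mem_carrier[OF U_subgroup] by blast
  then show ?thesis by (simp add: quot_A_def)
qed

lemma proj_act:
  assumes a: "a \<in> carrier A" and g: "g \<in> gam G"
  shows "proj (act a g) = proj a"
proof -
  interpret Q: comm_group Q by (rule Q_comm_group)
  interpret proj: group_hom A Q proj by (rule proj_group_hom)
  have "proj (act a g) \<otimes>\<^bsub>Q\<^esub> inv\<^bsub>Q\<^esub> proj a = proj (act a g \<otimes>\<^bsub>A\<^esub> inv\<^bsub>A\<^esub> a)"
    using a g by simp
  also have "\<dots> = \<one>\<^bsub>Q\<^esub>"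
    by (rule proj_U_gens) (use a g in \<open>auto simp: U_gens_def\<close>)
  finally show ?thesis
    using a g Q.inv_solve_right'[of "\<one>\<^bsub>Q\<^esub>" "proj (act a g)" "proj a"] by simp
qed

text \<open>An element of \<open>gam G\<close> changes a representative of a coset by an element of
  U only, so every set in the union defining \<open>quot_act\<close> is \<open>S\<close>
  itself.\<close>

lemma quot_act_trivial:
  assumes "S \<in> carrier Q" "g \<in> gam G"
  shows "quot_act G A act S g = S"
proof -
  obtain a where a: "a \<in> carrier A" "S = proj a" using assms(1) unfolding Q_carrier by blast
  have S: "b \<in> carrier A \<and> proj b = S" if "b \<in> S" for b
  proof
    show "b \<in> carrier A"
      using that a A.r_coset_subset_G[OF subgroup.subset[OF U_subgroup]] by blast
    show "proj b = S"
      using A.repr_independence[OF _ _ U_subgroup, of b a] that a by simp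
  qed
  have "a \<in> S" unfolding a(2) by (rule A.rcos_self[OF a(1) U_subgroup])
  moreover have "proj (act b g) = S" if "b \<in> S" for b
    using S[OF that] proj_act[OF _ assms(2)] by simp
  ultimately show ?thesis unfolding quot_act_def by auto
qed

text \<open>An element of \<open>sigma_bar\<close> involves two choices, a representative over
  \<open>G\<close> and a coboundary over \<open>gam G\<close>. Each contributes a term symmetric in
  g and h, and such terms cancel from the difference.\<close>

lemma sigma_bar_commutator:
  assumes d: "\<delta> \<in> cocycles2 G A act" and e: "e \<in> sigma_bar G A act (coh_class G A act \<delta>)"
    and g: "g \<in> gam G" "h \<in> gam G"
  shows "e (g, h) \<otimes>\<^bsub>Q\<^esub> inv\<^bsub>Q\<^esub> e (h, g) = proj (\<delta> (g, h)) \<otimes>\<^bsub>Q\<^esub> inv\<^bsub>Q\<^esub> proj (\<delta> (h, g))"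
proof -
  interpret Q: comm_group Q by (rule Q_comm_group)
  interpret proj: group_hom A Q proj by (rule proj_group_hom)
  obtain \<delta>' where "\<delta>' \<in> coh_class G A act \<delta>"
    and e1: "e \<in> coh_class (gam_group G) Q (quot_act G A act) (sigma G A act \<delta>')"
    using e unfolding sigma_bar_def by blast
  then obtain \<epsilon> where d': "\<delta>' \<in> cocycles2 G A act" and t: "cohom \<epsilon> \<delta>' \<delta>"
    unfolding coh_class_eq[OF d] by blast
  obtain \<zeta> where z: "\<zeta> \<in> gam G \<rightarrow> carrier Q"
    and e2: "e = coboundary (gam_group G) Q (quot_act G A act) \<zeta>
      \<otimes>\<^bsub>Z2 (gam_group G) Q (quot_act G A act)\<^esub> sigma G A act \<delta>'"
    using e1 unfolding coh_class_def B2_def r_coset_def by auto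
  have z': "\<zeta> g \<in> carrier Q" if "g \<in> gam G" for g using z that by auto
  \<comment> \<open>The coboundary of \<zeta>, with the trivial action of \<open>gam G\<close> on
    the quotient already inserted.\<close>
  define s where "s g h = \<zeta> g \<otimes>\<^bsub>Q\<^esub> \<zeta> h \<otimes>\<^bsub>Q\<^esub> inv\<^bsub>Q\<^esub> \<zeta> (g \<otimes>\<^bsub>G\<^esub> h)" for g h
  have e3: "e (g, h) = s g h \<otimes>\<^bsub>Q\<^esub> proj (\<delta>' (g, h))" if "g \<in> gam G" "h \<in> gam G" for g h
    using that z' by (simp add: e2 Z2_def coboundary_def sigma_def quot_act_trivial s_def)
  have s: "s g h \<in> carrier Q" "s h g = s g h"
    using g z' gam_comm[OF g] by (simp_all add: s_def Q.m_comm)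
  have \<epsilon>: "proj (\<epsilon> g) \<in> carrier Q" if "g \<in> gam G" for g
    using twistD(2)[OF t] that by simp
  \<comment> \<open>The counterpart of \<open>s\<close> for the change of representative over
    \<open>G\<close>, projected modulo U.\<close>
  define r where "r g h = proj (\<epsilon> g) \<otimes>\<^bsub>Q\<^esub> proj (\<epsilon> h) \<otimes>\<^bsub>Q\<^esub> inv\<^bsub>Q\<^esub> proj (\<epsilon> (g \<otimes>\<^bsub>G\<^esub> h))" for g h
  have r: "r g h \<in> carrier Q" "r h g = r g h"
    using g \<epsilon> gam_comm[OF g] by (simp_all add: r_def Q.m_comm)
  have e4: "proj (\<delta>' (g, h)) = r g h \<otimes>\<^bsub>Q\<^esub> proj (\<delta> (g, h))" if gh: "g \<in> gam G" "h \<in> gam G" for g h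
  proof -
    have "\<delta>' (g, h) \<otimes>\<^bsub>A\<^esub> \<epsilon> (g \<otimes>\<^bsub>G\<^esub> h) = act (\<epsilon> g) h \<otimes>\<^bsub>A\<^esub> \<epsilon> h \<otimes>\<^bsub>A\<^esub> \<delta> (g, h)"
      using twistD(3)[OF t, of g h] gh d' by simp
    from arg_cong[OF this, of proj]
    have "proj (\<delta>' (g, h)) \<otimes>\<^bsub>Q\<^esub> proj (\<epsilon> (g \<otimes>\<^bsub>G\<^esub> h))
        = proj (\<epsilon> g) \<otimes>\<^bsub>Q\<^esub> proj (\<epsilon> h) \<otimes>\<^bsub>Q\<^esub> proj (\<delta> (g, h))"
      using gh d d' twistD(2)[OF t] by (simp add: proj_act)
    then have "proj (\<delta>' (g, h)) = proj (\<epsilon> g) \<otimes>\<^bsub>Q\<^esub> proj (\<epsilon> h) \<otimes>\<^bsub>Q\<^esub> proj (\<delta> (g, h))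
        \<otimes>\<^bsub>Q\<^esub> inv\<^bsub>Q\<^esub> proj (\<epsilon> (g \<otimes>\<^bsub>G\<^esub> h))"
      using gh d d' \<epsilon> by (subst Q.inv_solve_right) simp_all
    then show ?thesis
      using gh d \<epsilon> unfolding r_def
      by (simp only: Q.m_ac Q.m_closed Q.inv_closed gam_mult_closed proj.hom_closed cocycle_closed gam_closed)
  qed
  have "e (g, h) \<otimes>\<^bsub>Q\<^esub> inv\<^bsub>Q\<^esub> e (h, g)
      = (r g h \<otimes>\<^bsub>Q\<^esub> proj (\<delta> (g, h))) \<otimes>\<^bsub>Q\<^esub> inv\<^bsub>Q\<^esub> (r g h \<otimes>\<^bsub>Q\<^esub> proj (\<delta> (h, g)))"
    using g s r d
    by (simp only: e3 e4 Q.sym_factor_cancel proj.hom_closed Q.m_closed cocycle_closed gam_closed)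
  also have "\<dots> = proj (\<delta> (g, h)) \<otimes>\<^bsub>Q\<^esub> inv\<^bsub>Q\<^esub> proj (\<delta> (h, g))"
    using g r(1) d by (intro Q.sym_factor_cancel) simp_all
  finally show ?thesis .
qed

lemma sigma_bar_nonempty:
  assumes d: "\<delta> \<in> cocycles2 G A act"
  shows "sigma_bar G A act (coh_class G A act \<delta>) \<noteq> {}"
proof -
  interpret Q: comm_group Q by (rule Q_comm_group)
  have "coboundary (gam_group G) Q (quot_act G A act) (\<lambda>_. \<one>\<^bsub>Q\<^esub>)
    \<in> B2 (gam_group G) Q (quot_act G A act)"
    unfolding B2_def by auto
  then have "coh_class (gam_group G) Q (quot_act G A act) (sigma G A act \<delta>) \<noteq> {}"
    unfolding coh_class_def r_coset_def by blast
  then show ?thesis unfolding sigma_bar_def using coh_class_self[OF d] by blast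
qed

text \<open>Modulo U the action disappears from the cocycle identity, so the commutator values form
  an alternating bilinear pairing on \<open>gam G\<close>, to which \<open>kappa_bar_image\<close>
  applies.\<close>

lemma kappa_sigma_image:
  assumes d: "\<delta> \<in> cocycles2 G A act"
  shows "kappa_bar (gam_group G) Q (sigma_bar G A act (coh_class G A act \<delta>))
      ` carrier (schur_multiplier (gam_group G)) = generate Q (proj ` comm_vals \<delta>)"
proof -
  interpret Q: comm_group Q by (rule Q_comm_group)
  interpret proj: group_hom A Q proj by (rule proj_group_hom)
  define c where "c = (\<lambda>(g, h). proj (\<delta> (g, h)) \<otimes>\<^bsub>Q\<^esub> inv\<^bsub>Q\<^esub> proj (\<delta> (h, g)))"
  have cocycle: "proj (\<delta> (g, h)) \<otimes>\<^bsub>Q\<^esub> proj (\<delta> (g \<otimes>\<^bsub>G\<^esub> h, k))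
      = proj (\<delta> (h, k)) \<otimes>\<^bsub>Q\<^esub> proj (\<delta> (g, h \<otimes>\<^bsub>G\<^esub> k))"
    if "g \<in> gam G" "h \<in> gam G" "k \<in> gam G" for g h k
    using arg_cong[OF cocycle_eq[OF d, of g h k], of proj] that d by (simp add: proj_act)
  have cl: "c (g, h) \<in> carrier Q" if "g \<in> gam G" "h \<in> gam G" for g h
    using that d by (simp add: c_def)
  have left: "c (g \<otimes>\<^bsub>G\<^esub> g', h) = c (g, h) \<otimes>\<^bsub>Q\<^esub> c (g', h)"
    if "g \<in> gam G" "g' \<in> gam G" "h \<in> gam G" for g g' h
    using commutator_pairing_mult[OF gam_comm_group Q_comm_group, of "\<lambda>x. proj (\<delta> x)" g g' h]
      cocycle that d by (simp add: c_def)
  have anti: "c (g, h) = inv\<^bsub>Q\<^esub> c (h, g)" if "g \<in> gam G" "h \<in> gam G" for g h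
    using that d by (simp add: c_def Q.inv_mult Q.m_comm)
  \<comment> \<open>Additivity in the second argument follows from that in the first by
    antisymmetry.\<close>
  have right: "c (g, h \<otimes>\<^bsub>G\<^esub> h') = c (g, h) \<otimes>\<^bsub>Q\<^esub> c (g, h')"
    if "g \<in> gam G" "h \<in> gam G" "h' \<in> gam G" for g h h'
    using that cl by (simp add: anti[of g] left Q.inv_mult)
  have alt: "c (h, h) = \<one>\<^bsub>Q\<^esub>" if "h \<in> gam G" for h
    using that d by (simp add: c_def)
  have "c ` (gam G \<times> gam G) = proj ` comm_vals \<delta>"
  proof -
    have c: "c (g, h) = proj (\<delta> (g, h) \<otimes>\<^bsub>A\<^esub> inv\<^bsub>A\<^esub> \<delta> (h, g))" if "g \<in> gam G" "h \<in> gam G" for g h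
      using that d by (simp add: c_def)
    have "comm_vals \<delta> = (\<lambda>(g, h). \<delta> (g, h) \<otimes>\<^bsub>A\<^esub> inv\<^bsub>A\<^esub> \<delta> (h, g)) ` (gam G \<times> gam G)"
      unfolding comm_vals_def by auto
    then show ?thesis using c by (auto simp: image_image intro!: image_cong)
  qed
  moreover have "kappa_bar (gam_group G) Q (sigma_bar G A act (coh_class G A act \<delta>))
      ` carrier (schur_multiplier (gam_group G)) = generate Q (c ` (carrier (gam_group G) \<times> carrier (gam_group G)))"
  proof (rule kappa_bar_image[OF gam_comm_group Q_comm_group])
    show "sigma_bar G A act (coh_class G A act \<delta>) \<noteq> {}" by (rule sigma_bar_nonempty[OF d])
  qed (use cl left right alt sigma_bar_commutator[OF d] in \<open>auto simp: c_def\<close>)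
  ultimately show ?thesis by simp
qed

text \<open>The correspondence between subgroups of the quotient and subgroups containing U;
  adjoining \<open>U_gens\<close> accounts for the kernel of \<open>proj\<close>.\<close>

lemma generate_proj_iff:
  assumes C: "C \<subseteq> carrier A"
  shows "generate Q (proj ` C) = carrier Q \<longleftrightarrow> generate A (U_gens \<union> C) = carrier A"
proof -
  interpret Q: comm_group Q by (rule Q_comm_group)
  interpret proj: group_hom A Q proj by (rule proj_group_hom)
  have W: "U_gens \<union> C \<subseteq> carrier A" using C U_gens_subset by blast
  interpret W: subgroup "generate A (U_gens \<union> C)" A by (rule A.generate_is_subgroup[OF W])
  have CQ: "proj ` C \<subseteq> carrier Q" using C unfolding Q_carrier by blast
  show ?thesis
  proof
    assume gen: "generate Q (proj ` C) = carrier Q"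
    have "carrier A \<subseteq> generate A (U_gens \<union> C)"
    proof
      fix a assume a: "a \<in> carrier A"
      have "proj a \<in> proj ` generate A C"
        unfolding proj.generate_img[OF C, symmetric] gen Q_carrier using a by (rule imageI)
      then obtain w where w: "w \<in> generate A C" "proj a = proj w" by (rule imageE)
      \<comment> \<open>Equal cosets: a differs from w by an element of U, which is generated by
        \<open>U_gens\<close>.\<close>
      have "a \<in> proj w" unfolding w(2)[symmetric] by (rule A.rcos_self[OF a U_subgroup])
      then obtain u where u: "u \<in> U" "a = u \<otimes>\<^bsub>A\<^esub> w" unfolding r_coset_def by blast
      have "u \<in> generate A (U_gens \<union> C)"
        using u(1) A.mono_generate[of U_gens "U_gens \<union> C"] unfolding U_generate by blast
      moreover have "w \<in> generate A (U_gens \<union> C)"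
        using w(1) A.mono_generate[of C "U_gens \<union> C"] by blast
      ultimately show "a \<in> generate A (U_gens \<union> C)" unfolding u(2) by (rule W.m_closed)
    qed
    then show "generate A (U_gens \<union> C) = carrier A" using W.subset by blast
  next
    assume gen: "generate A (U_gens \<union> C) = carrier A"
    have "carrier Q = generate Q (proj ` (U_gens \<union> C))"
      unfolding Q_carrier gen[symmetric] by (rule proj.generate_img[OF W, symmetric])
    also have "\<dots> \<subseteq> generate Q (proj ` C)"
    proof (rule Q.generate_subgroup_incl[OF _ Q.generate_is_subgroup[OF CQ]])
      show "proj ` (U_gens \<union> C) \<subseteq> generate Q (proj ` C)"
        using proj_U_gens by (auto intro: generate.one generate.incl)
    qed
    finally show "generate Q (proj ` C) = carrier Q" using Q.generate_incl[OF CQ] by blast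
  qed
qed

text \<open>The left side depends on the class only, so the right side holds for every
  representative as soon as it holds for one.\<close>

lemma Delta_iff:
  assumes d: "\<delta> \<in> cocycles2 G A act"
  shows "coh_class G A act \<delta> \<in> Delta G A act
    \<longleftrightarrow> is_last_derived (ext \<delta>) (ext_embed G ` carrier A)"
  unfolding last_derived_ext_iff_generate[OF d] generate_proj_iff[OF comm_vals_subset[OF d], symmetric]
  using d by (simp add: Delta_def H2_carrier kappa_sigma_image[OF d])

lemma Delta_carrier: "C \<in> Delta G A act \<Longrightarrow> C \<in> carrier (H2 G A act)"
  by (simp add: Delta_def)

lemma Delta_last_derived:
  assumes "C \<in> Delta G A act" "\<delta> \<in> C"
  shows "\<delta> \<in> cocycles2 G A act" "C = coh_class G A act \<delta>"
    "is_last_derived (ext \<delta>) (ext_embed G ` carrier A)"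
  using H2_repr[OF Delta_carrier[OF assms(1)] assms(2)] Delta_iff assms(1) by simp_all

lemma Delta_nonempty:
  assumes "C \<in> Delta G A act"
  obtains \<delta> where "\<delta> \<in> C"
  using Delta_carrier[OF assms] coh_class_self unfolding H2_carrier by blast

lemma iso_ext_embed:
  assumes d: "\<delta> \<in> cocycles2 G A act" "\<delta>' \<in> cocycles2 G A act"
    and last: "is_last_derived (ext \<delta>) (ext_embed G ` carrier A)"
      "is_last_derived (ext \<delta>') (ext_embed G ` carrier A)"
    and f: "f \<in> iso (ext \<delta>) (ext \<delta>')"
  shows "f ` ext_embed G ` carrier A = ext_embed G ` carrier A"
  using is_last_derived_iso[OF group_ext[OF d(1)] group_ext[OF d(2)] f last(1)] last(2)
  by (rule is_last_derived_unique)

text \<open>Argued with extensions instead of \<open>kappa_bar\<close>: the transformed cocycle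
  defines an isomorphic extension, by an isomorphism that matches the two copies of
  \<open>A\<close>, and being the last derived term is transported along it.\<close>

lemma H2_act_Delta:
  assumes p: "p \<in> carrier (Comp G A act)" and C: "C \<in> Delta G A act"
  shows "H2_act G A act p C \<in> Delta G A act"
proof -
  obtain \<eta> \<nu> where p': "p = (\<eta>, \<nu>)" "(\<eta>, \<nu>) \<in> carrier (Comp G A act)" using p by (cases p) auto
  obtain \<delta> where "\<delta> \<in> C" using Delta_nonempty[OF C] .
  note d = Delta_last_derived[OF C this]
  let ?D = "Z2_act G (\<eta>, \<nu>) \<delta>"
  note D = Z2_act_cocycle[OF p'(2) d(1)]
  have "H2_act G A act p C = coh_class G A act ?D"
    unfolding p'(1) d(2) using H2_act_eq_iff[OF p'(2) d(1) D(1)] D(2) by blast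
  moreover have "coh_class G A act ?D \<in> Delta G A act"
    unfolding Delta_iff[OF D(1)]
    using is_last_derived_iso[OF group_ext[OF d(1)] group_ext[OF D(1)]
        iso_of_twist(1)[OF p'(2) d(1) D] d(3)]
    by (simp only: iso_of_twist(2)[OF p'(2) d(1) D])
  ultimately show ?thesis by simp
qed

end


section \<open>Automorphisms of extensions\<close>

lemma AutoGroup_simps:
  "carrier (AutoGroup E) = auto E" "\<one>\<^bsub>AutoGroup E\<^esub> = (\<lambda>x\<in>carrier E. x)"
  "\<alpha> \<in> auto E \<Longrightarrow> \<beta> \<in> auto E \<Longrightarrow> \<alpha> \<otimes>\<^bsub>AutoGroup E\<^esub> \<beta> = compose (carrier E) \<alpha> \<beta>"
  by (simp_all add: AutoGroup_def BijGroup_def auto_def)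

lemma auto_iso: "\<alpha> \<in> auto E \<longleftrightarrow> \<alpha> \<in> iso E E \<and> \<alpha> \<in> extensional (carrier E)"
  by (auto simp: auto_def iso_def Bij_def)

context gmodule
begin

lemma Z1_simps [simp]:
  "\<epsilon> \<in> carrier (Z1 G A act) \<longleftrightarrow> \<epsilon> \<in> carrier G \<rightarrow>\<^sub>E carrier A \<and>
    (\<forall>g\<in>carrier G. \<forall>h\<in>carrier G. \<epsilon> (g \<otimes>\<^bsub>G\<^esub> h) = act (\<epsilon> g) h \<otimes>\<^bsub>A\<^esub> \<epsilon> h)"
  "\<epsilon> \<otimes>\<^bsub>Z1 G A act\<^esub> \<epsilon>' = (\<lambda>g\<in>carrier G. \<epsilon> g \<otimes>\<^bsub>A\<^esub> \<epsilon>' g)"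
  "\<one>\<^bsub>Z1 G A act\<^esub> = (\<lambda>g\<in>carrier G. \<one>\<^bsub>A\<^esub>)"
  by (simp_all add: Z1_def)

lemma Z1_closed: "\<epsilon> \<in> carrier (Z1 G A act) \<Longrightarrow> g \<in> carrier G \<Longrightarrow> \<epsilon> g \<in> carrier A"
  by auto

lemma Z1_eq:
  "\<lbrakk>\<epsilon> \<in> carrier (Z1 G A act); g \<in> carrier G; h \<in> carrier G\<rbrakk>
    \<Longrightarrow> \<epsilon> (g \<otimes>\<^bsub>G\<^esub> h) = act (\<epsilon> g) h \<otimes>\<^bsub>A\<^esub> \<epsilon> h"
  by simp

lemma Z1_extensional: "\<epsilon> \<in> carrier (Z1 G A act) \<Longrightarrow> \<epsilon> \<in> extensional (carrier G)"
  by (simp add: PiE_def)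

lemma Z1I:
  assumes "\<And>g. g \<in> carrier G \<Longrightarrow> \<epsilon> g \<in> carrier A"
    "\<And>g h. \<lbrakk>g \<in> carrier G; h \<in> carrier G\<rbrakk> \<Longrightarrow> \<epsilon> (g \<otimes>\<^bsub>G\<^esub> h) = act (\<epsilon> g) h \<otimes>\<^bsub>A\<^esub> \<epsilon> h"
  shows "(\<lambda>g\<in>carrier G. \<epsilon> g) \<in> carrier (Z1 G A act)"
  using assms by auto

lemma Z1_group: "group (Z1 G A act)"
proof (rule groupI)
  fix \<epsilon> \<zeta> assume e: "\<epsilon> \<in> carrier (Z1 G A act)" "\<zeta> \<in> carrier (Z1 G A act)"
  show "\<epsilon> \<otimes>\<^bsub>Z1 G A act\<^esub> \<zeta> \<in> carrier (Z1 G A act)"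
    unfolding Z1_simps(2)
    by (rule Z1I) (use e in \<open>simp_all add: Z1_closed Z1_eq act_mult_distrib A.m_ac del: Z1_simps\<close>)
next
  fix \<epsilon> \<zeta> \<xi> assume "\<epsilon> \<in> carrier (Z1 G A act)" "\<zeta> \<in> carrier (Z1 G A act)" "\<xi> \<in> carrier (Z1 G A act)"
  then show "\<epsilon> \<otimes>\<^bsub>Z1 G A act\<^esub> \<zeta> \<otimes>\<^bsub>Z1 G A act\<^esub> \<xi> = \<epsilon> \<otimes>\<^bsub>Z1 G A act\<^esub> (\<zeta> \<otimes>\<^bsub>Z1 G A act\<^esub> \<xi>)"
    unfolding Z1_simps(2)
    by (intro restrict_ext) (simp add: Z1_closed A.m_assoc del: Z1_simps)
next
  show "\<one>\<^bsub>Z1 G A act\<^esub> \<in> carrier (Z1 G A act)"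
    unfolding Z1_simps(3) by (rule Z1I) simp_all
next
  fix \<epsilon> assume e: "\<epsilon> \<in> carrier (Z1 G A act)"
  show "\<one>\<^bsub>Z1 G A act\<^esub> \<otimes>\<^bsub>Z1 G A act\<^esub> \<epsilon> = \<epsilon>"
    unfolding Z1_simps(2,3)
    by (rule extensionalityI[OF restrict_extensional Z1_extensional[OF e]])
      (use Z1_closed[OF e] in simp)
  show "\<exists>\<zeta>\<in>carrier (Z1 G A act). \<zeta> \<otimes>\<^bsub>Z1 G A act\<^esub> \<epsilon> = \<one>\<^bsub>Z1 G A act\<^esub>"
  proof
    show "(\<lambda>g\<in>carrier G. inv\<^bsub>A\<^esub> \<epsilon> g) \<in> carrier (Z1 G A act)"
      by (rule Z1I) (use e in \<open>simp_all add: Z1_closed Z1_eq act_inv A.inv_mult del: Z1_simps\<close>)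
    show "(\<lambda>g\<in>carrier G. inv\<^bsub>A\<^esub> \<epsilon> g) \<otimes>\<^bsub>Z1 G A act\<^esub> \<epsilon> = \<one>\<^bsub>Z1 G A act\<^esub>"
      unfolding Z1_simps(2,3)
      by (intro restrict_ext) (use Z1_closed[OF e] in simp)
  qed
qed

text \<open>These are the \<eta> and \<nu> that \<open>twist_of_iso\<close> reads off from an
  automorphism.\<close>

definition aut_pair where
  "aut_pair \<alpha> = (\<lambda>g\<in>carrier G. fst (\<alpha> (g, \<one>\<^bsub>A\<^esub>)), \<lambda>a\<in>carrier A. snd (\<alpha> (\<one>\<^bsub>G\<^esub>, a)))"

text \<open>The map of \<open>iso_of_twist\<close> for the identity pair.\<close>

definition Z1_aut where
  "Z1_aut \<epsilon> = (\<lambda>(g, a)\<in>carrier G \<times> carrier A. (g, a \<otimes>\<^bsub>A\<^esub> \<epsilon> g))"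

text \<open>The cocycles \<open>\<epsilon>\<close> are exactly those cochains for which \<open>Z1_aut \<epsilon>\<close> is a homomorphism, because
  \<open>\<delta>\<close> cancels from the condition \<^const>\<open>twist\<close>.\<close>

lemma cohom_self_iff:
  assumes d: "\<delta> \<in> cocycles2 G A act"
  shows "cohom \<epsilon> \<delta> \<delta> \<longleftrightarrow> (\<lambda>g\<in>carrier G. \<epsilon> g) \<in> carrier (Z1 G A act)"
proof
  assume t: "cohom \<epsilon> \<delta> \<delta>"
  show "(\<lambda>g\<in>carrier G. \<epsilon> g) \<in> carrier (Z1 G A act)"
  proof (rule Z1I)
    fix g h assume g: "g \<in> carrier G" "h \<in> carrier G"
    have "\<delta> (g, h) \<otimes>\<^bsub>A\<^esub> \<epsilon> (g \<otimes>\<^bsub>G\<^esub> h) = \<delta> (g, h) \<otimes>\<^bsub>A\<^esub> (act (\<epsilon> g) h \<otimes>\<^bsub>A\<^esub> \<epsilon> h)"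
      using twistD(3)[OF t g] g d twistD(2)[OF t] by (simp add: A.m_comm)
    then show "\<epsilon> (g \<otimes>\<^bsub>G\<^esub> h) = act (\<epsilon> g) h \<otimes>\<^bsub>A\<^esub> \<epsilon> h"
      using g d twistD(2)[OF t] by simp
  qed (rule twistD(2)[OF t])
next
  assume e: "(\<lambda>g\<in>carrier G. \<epsilon> g) \<in> carrier (Z1 G A act)"
  have cl: "\<epsilon> g \<in> carrier A" if "g \<in> carrier G" for g
    using Z1_closed[OF e that] that by simp
  show "cohom \<epsilon> \<delta> \<delta>"
    unfolding twist_def
  proof (intro conjI ballI funcsetI)
    fix g h assume g: "g \<in> carrier G" "h \<in> carrier G"
    show "(\<lambda>x\<in>carrier A. x) (\<delta> (g, h)) \<otimes>\<^bsub>A\<^esub> \<epsilon> (g \<otimes>\<^bsub>G\<^esub> h)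
      = act (\<epsilon> g) ((\<lambda>x\<in>carrier G. x) h) \<otimes>\<^bsub>A\<^esub> \<epsilon> h
        \<otimes>\<^bsub>A\<^esub> \<delta> ((\<lambda>x\<in>carrier G. x) g, (\<lambda>x\<in>carrier G. x) h)"
      using Z1_eq[OF e g] g d cl by (simp add: A.m_comm)
  qed (rule cl)
qed

lemma Z1_aut_auto:
  assumes d: "\<delta> \<in> cocycles2 G A act" and e: "\<epsilon> \<in> carrier (Z1 G A act)"
  shows "Z1_aut \<epsilon> \<in> auto (ext \<delta>)"
proof -
  have "restrict \<epsilon> (carrier G) = \<epsilon>"
    by (rule extensional_restrict[OF Z1_extensional[OF e]])
  then have t: "cohom \<epsilon> \<delta> \<delta>" unfolding cohom_self_iff[OF d] using e by simp
  \<comment> \<open>Restricted identities are inserted to match the shape of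
    \<open>iso_of_twist\<close>.\<close>
  have "Z1_aut \<epsilon> = (\<lambda>(g, a)\<in>carrier G \<times> carrier A.
      ((\<lambda>x\<in>carrier G. x) g, (\<lambda>x\<in>carrier A. x) a \<otimes>\<^bsub>A\<^esub> \<epsilon> g))"
    unfolding Z1_aut_def by (intro restrict_ext) auto
  then have "Z1_aut \<epsilon> \<in> iso (ext \<delta>) (ext \<delta>)"
    using iso_of_twist(1)[OF id_Comp d d t] by simp
  then show ?thesis by (simp add: auto_iso Z1_aut_def)
qed

text \<open>By \<open>stab\<close> the pair of every automorphism is compatible, and the twist it
  carries shows that the pair fixes the class. Conversely, a stabilizing pair is lifted by a twist
  from \<delta> to itself; above the identity pair such twists are the elements of
  \<open>Z1\<close>.\<close>

lemma aut_sequence: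
  assumes d: "\<delta> \<in> cocycles2 G A act"
    and stab: "\<And>\<alpha>. \<alpha> \<in> auto (ext \<delta>) \<Longrightarrow> \<alpha> ` ext_embed G ` carrier A = ext_embed G ` carrier A"
  shows "short_exact (Z1 G A act) (AutoGroup (ext \<delta>)) (Stab G A act (coh_class G A act \<delta>))
    Z1_aut aut_pair"
proof -
  interpret E: group "ext \<delta>" by (rule group_ext[OF d])
  \<comment> \<open>The homomorphism is first taken into the full direct product. The stabilizer is
    then a subgroup because it is the image.\<close>
  let ?B = "AutoGroup G \<times>\<times> AutoGroup A"
  let ?S = "Stab G A act (coh_class G A act \<delta>)"
  define eps where "eps \<alpha> = (\<lambda>g\<in>carrier G. snd (\<alpha> (g, \<one>\<^bsub>A\<^esub>)))" for \<alpha> :: "'g \<times> 'a \<Rightarrow> 'g \<times> 'a"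
  have B: "group ?B" by (rule DirProd_group[OF G.AutoGroup A.AutoGroup])
  have Aut: "group (AutoGroup (ext \<delta>))" by (rule E.AutoGroup)
  have iso: "\<alpha> \<in> iso (ext \<delta>) (ext \<delta>)" if "\<alpha> \<in> auto (ext \<delta>)" for \<alpha>
    using that by (simp add: auto_iso)
  have pair: "aut_pair \<alpha> \<in> carrier (Comp G A act)"
    "twist (fst (aut_pair \<alpha>)) (snd (aut_pair \<alpha>)) (eps \<alpha>) \<delta> \<delta>"
    "\<lbrakk>g \<in> carrier G; a \<in> carrier A\<rbrakk> \<Longrightarrow>
      \<alpha> (g, a) = (fst (aut_pair \<alpha>) g, snd (aut_pair \<alpha>) a \<otimes>\<^bsub>A\<^esub> eps \<alpha> g)"
    if "\<alpha> \<in> auto (ext \<delta>)" for \<alpha> g a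
    unfolding aut_pair_def eps_def fst_conv snd_conv
    by (rule twist_of_iso[OF d d iso[OF that] stab[OF that]]; assumption?)+
  have cl: "fst (aut_pair \<alpha>) g \<in> carrier G" "eps \<alpha> g \<in> carrier A"
    if "\<alpha> \<in> auto (ext \<delta>)" "g \<in> carrier G" for \<alpha> g
    using twistD(2)[OF pair(2)[OF that(1)] that(2)]
      group_hom.hom_closed[OF CompD(3), of "fst (aut_pair \<alpha>)" "snd (aut_pair \<alpha>)" g] pair(1)[OF that(1)] that
    by simp_all
  have cl': "snd (aut_pair \<alpha>) a \<in> carrier A"
    if "\<alpha> \<in> auto (ext \<delta>)" "a \<in> carrier A" for \<alpha> a
    using group_hom.hom_closed[OF CompD(4), of "fst (aut_pair \<alpha>)" "snd (aut_pair \<alpha>)" a]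
      pair(1)[OF that(1)] that by simp
  have eps_one: "eps \<alpha> \<one>\<^bsub>G\<^esub> = \<one>\<^bsub>A\<^esub>" if "\<alpha> \<in> auto (ext \<delta>)" for \<alpha>
    using twist_one[OF _ d d pair(2)[OF that]] pair(1)[OF that] by simp
  have pair_one: "fst (aut_pair \<alpha>) \<one>\<^bsub>G\<^esub> = \<one>\<^bsub>G\<^esub>" if "\<alpha> \<in> auto (ext \<delta>)" for \<alpha>
    using group_hom.hom_one[OF CompD(3), of "fst (aut_pair \<alpha>)" "snd (aut_pair \<alpha>)"] pair(1)[OF that] by simp
  have auto_pair: "fst (aut_pair \<alpha>) \<in> auto G" "snd (aut_pair \<alpha>) \<in> auto A"
    if "\<alpha> \<in> auto (ext \<delta>)" for \<alpha>
    using CompD(1,2)[of "fst (aut_pair \<alpha>)" "snd (aut_pair \<alpha>)"] pair(1)[OF that] by simp_all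
  have hom_B: "aut_pair \<in> hom (AutoGroup (ext \<delta>)) ?B"
  proof (rule homI)
    fix \<alpha> assume "\<alpha> \<in> carrier (AutoGroup (ext \<delta>))"
    then show "aut_pair \<alpha> \<in> carrier ?B"
      using auto_pair by (simp add: AutoGroup_simps mem_Times_iff)
  next
    fix \<alpha> \<beta> assume "\<alpha> \<in> carrier (AutoGroup (ext \<delta>))" "\<beta> \<in> carrier (AutoGroup (ext \<delta>))"
    then have a: "\<alpha> \<in> auto (ext \<delta>)" "\<beta> \<in> auto (ext \<delta>)" by (simp_all add: AutoGroup_simps)
    have "aut_pair (compose (carrier (ext \<delta>)) \<alpha> \<beta>)
      = (compose (carrier G) (fst (aut_pair \<alpha>)) (fst (aut_pair \<beta>)),
         compose (carrier A) (snd (aut_pair \<alpha>)) (snd (aut_pair \<beta>)))"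
    proof (rule prod_eqI)
      show "fst (aut_pair (compose (carrier (ext \<delta>)) \<alpha> \<beta>))
        = fst (compose (carrier G) (fst (aut_pair \<alpha>)) (fst (aut_pair \<beta>)),
          compose (carrier A) (snd (aut_pair \<alpha>)) (snd (aut_pair \<beta>)))"
      proof (rule extensionalityI)
        fix g assume g: "g \<in> carrier G"
        have "fst (aut_pair (compose (carrier (ext \<delta>)) \<alpha> \<beta>)) g = fst (\<alpha> (\<beta> (g, \<one>\<^bsub>A\<^esub>)))"
          using g by (simp add: aut_pair_def[of "compose _ _ _"] compose_eq)
        \<comment> \<open>The first component of a value of \<alpha> depends on the
          \<open>G\<close>-part of the argument only, so the cochain of \<beta> leaves no trace
          here.\<close>
        also have "\<dots> = fst (aut_pair \<alpha>) (fst (aut_pair \<beta>) g)"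
          using g a cl cl' by (simp add: pair(3))
        finally show "fst (aut_pair (compose (carrier (ext \<delta>)) \<alpha> \<beta>)) g
          = fst (compose (carrier G) (fst (aut_pair \<alpha>)) (fst (aut_pair \<beta>)),
            compose (carrier A) (snd (aut_pair \<alpha>)) (snd (aut_pair \<beta>))) g"
          using g by (simp add: compose_eq)
      qed (simp_all add: aut_pair_def[of "compose _ _ _"] compose_extensional)
      show "snd (aut_pair (compose (carrier (ext \<delta>)) \<alpha> \<beta>))
        = snd (compose (carrier G) (fst (aut_pair \<alpha>)) (fst (aut_pair \<beta>)),
          compose (carrier A) (snd (aut_pair \<alpha>)) (snd (aut_pair \<beta>)))"
      proof (rule extensionalityI)
        fix b assume b: "b \<in> carrier A"
        \<comment> \<open>The cochain vanishes at the unit of \<open>G\<close>, so on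
          \<open>A\<close> an automorphism acts by the second member of its pair alone.\<close>
        have "\<beta> (\<one>\<^bsub>G\<^esub>, b) = (\<one>\<^bsub>G\<^esub>, snd (aut_pair \<beta>) b)"
          using b cl'[OF a(2) b] by (simp only: pair(3)[OF a(2) G.one_closed b] eps_one[OF a(2)] pair_one[OF a(2)] A.r_one)
        moreover have "\<alpha> (\<one>\<^bsub>G\<^esub>, snd (aut_pair \<beta>) b) = (\<one>\<^bsub>G\<^esub>, snd (aut_pair \<alpha>) (snd (aut_pair \<beta>) b))"
          using cl'[OF a(1) cl'[OF a(2) b]]
          by (simp only: pair(3)[OF a(1) G.one_closed cl'[OF a(2) b]] eps_one[OF a(1)] pair_one[OF a(1)] A.r_one)
        moreover have "snd (aut_pair (compose (carrier (ext \<delta>)) \<alpha> \<beta>)) b = snd (\<alpha> (\<beta> (\<one>\<^bsub>G\<^esub>, b)))"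
          using b by (simp add: aut_pair_def[of "compose _ _ _"] compose_eq)
        ultimately show "snd (aut_pair (compose (carrier (ext \<delta>)) \<alpha> \<beta>)) b
          = snd (compose (carrier G) (fst (aut_pair \<alpha>)) (fst (aut_pair \<beta>)),
            compose (carrier A) (snd (aut_pair \<alpha>)) (snd (aut_pair \<beta>))) b"
          using b by (simp add: compose_eq)
      qed (simp_all add: aut_pair_def[of "compose _ _ _"] compose_extensional)
    qed
    then show "aut_pair (\<alpha> \<otimes>\<^bsub>AutoGroup (ext \<delta>)\<^esub> \<beta>) = aut_pair \<alpha> \<otimes>\<^bsub>?B\<^esub> aut_pair \<beta>"
      using a auto_pair by (simp add: AutoGroup_simps mult_DirProd')
  qed
  have S_eq: "?S = ?B\<lparr>carrier := carrier ?S\<rparr>" by (simp add: Stab_def Comp_def)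
  have S_carrier: "carrier ?S = {p \<in> carrier (Comp G A act).
      H2_act G A act p (coh_class G A act \<delta>) = coh_class G A act \<delta>}"
    by (simp add: Stab_def stabilizer_def)
  have image: "aut_pair ` auto (ext \<delta>) = carrier ?S"
  proof (intro equalityI subsetI)
    fix p assume "p \<in> aut_pair ` auto (ext \<delta>)"
    then obtain \<alpha> where a: "\<alpha> \<in> auto (ext \<delta>)" "p = aut_pair \<alpha>" by blast
    obtain \<eta> \<nu> where p: "aut_pair \<alpha> = (\<eta>, \<nu>)" by (cases "aut_pair \<alpha>")
    have c: "(\<eta>, \<nu>) \<in> carrier (Comp G A act)" using pair(1)[OF a(1)] p by simp
    have "\<exists>\<epsilon>. twist \<eta> \<nu> \<epsilon> \<delta> \<delta>" by (rule exI) (use pair(2)[OF a(1)] p in simp)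
    then show "p \<in> carrier ?S"
      unfolding S_carrier a(2) p using c H2_act_eq_iff[OF c d d] by simp
  next
    fix p assume p: "p \<in> carrier ?S"
    obtain \<eta> \<nu> where p': "p = (\<eta>, \<nu>)" by (cases p)
    have c: "(\<eta>, \<nu>) \<in> carrier (Comp G A act)" using p p' unfolding S_carrier by simp
    obtain \<epsilon> where t: "twist \<eta> \<nu> \<epsilon> \<delta> \<delta>"
      using p p' H2_act_eq_iff[OF c d d] unfolding S_carrier by auto
    define f where "f = (\<lambda>(g, a)\<in>carrier G \<times> carrier A. (\<eta> g, \<nu> a \<otimes>\<^bsub>A\<^esub> \<epsilon> g))"
    have "f \<in> auto (ext \<delta>)"
      using iso_of_twist(1)[OF c d d t] by (simp add: auto_iso f_def)
    moreover have "aut_pair f = (\<eta>, \<nu>)"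
    proof (rule prod_eqI)
      have ex: "\<eta> \<in> extensional (carrier G)" "\<nu> \<in> extensional (carrier A)"
        using CompD(1,2)[OF c] by (simp_all add: auto_iso)
      show "fst (aut_pair f) = fst (\<eta>, \<nu>)"
        by (rule extensionalityI[of _ "carrier G"]) (use ex in \<open>simp_all add: aut_pair_def f_def\<close>)
      have "\<nu> a \<in> carrier A" if "a \<in> carrier A" for a
        using group_hom.hom_closed[OF CompD(4)[OF c] that] .
      then show "snd (aut_pair f) = snd (\<eta>, \<nu>)"
        by (intro extensionalityI[of _ "carrier A"])
          (use ex twist_one[OF c d d t] in \<open>simp_all add: aut_pair_def f_def\<close>)
    qed
    ultimately show "p \<in> aut_pair ` auto (ext \<delta>)" unfolding p' by (metis imageI)
  qed
  have "group_hom (AutoGroup (ext \<delta>)) ?B aut_pair"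
    using Aut B hom_B by (simp add: group_hom_def group_hom_axioms_def)
  from group_hom.img_is_subgroup[OF this]
  have S: "subgroup (carrier ?S) ?B" by (simp only: AutoGroup_simps(1) image)
  have "group ?S" by (subst S_eq) (rule group.subgroup_imp_group[OF B S])
  moreover have "aut_pair \<in> hom (AutoGroup (ext \<delta>)) ?S"
  proof (subst S_eq, rule homI)
    fix \<alpha> assume "\<alpha> \<in> carrier (AutoGroup (ext \<delta>))"
    then show "aut_pair \<alpha> \<in> carrier (?B\<lparr>carrier := carrier ?S\<rparr>)"
      using image by (auto simp: AutoGroup_simps)
  qed (use hom_mult[OF hom_B] in simp)
  moreover have "Z1_aut \<in> hom (Z1 G A act) (AutoGroup (ext \<delta>))"
  proof (rule homI)
    fix \<epsilon> assume "\<epsilon> \<in> carrier (Z1 G A act)"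
    then show "Z1_aut \<epsilon> \<in> carrier (AutoGroup (ext \<delta>))"
      unfolding AutoGroup_simps by (rule Z1_aut_auto[OF d])
  next
    fix \<epsilon> \<zeta> assume e: "\<epsilon> \<in> carrier (Z1 G A act)" "\<zeta> \<in> carrier (Z1 G A act)"
    have "Z1_aut (\<epsilon> \<otimes>\<^bsub>Z1 G A act\<^esub> \<zeta>) = compose (carrier (ext \<delta>)) (Z1_aut \<epsilon>) (Z1_aut \<zeta>)"
      unfolding compose_def Z1_aut_def Z1_simps(2) ext_simps(1)
      by (intro restrict_ext) (use e in \<open>auto simp: Z1_closed A.m_ac simp del: Z1_simps\<close>)
    then show "Z1_aut (\<epsilon> \<otimes>\<^bsub>Z1 G A act\<^esub> \<zeta>) = Z1_aut \<epsilon> \<otimes>\<^bsub>AutoGroup (ext \<delta>)\<^esub> Z1_aut \<zeta>"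
      using Z1_aut_auto[OF d] e by (simp only: AutoGroup_simps)
  qed
  moreover have "inj_on Z1_aut (carrier (Z1 G A act))"
  proof (rule inj_onI)
    fix \<epsilon> \<zeta> assume e: "\<epsilon> \<in> carrier (Z1 G A act)" "\<zeta> \<in> carrier (Z1 G A act)" "Z1_aut \<epsilon> = Z1_aut \<zeta>"
    show "\<epsilon> = \<zeta>"
    proof (rule extensionalityI[OF Z1_extensional[OF e(1)] Z1_extensional[OF e(2)]])
      fix g assume g: "g \<in> carrier G"
      then show "\<epsilon> g = \<zeta> g"
        using fun_cong[OF e(3), of "(g, \<one>\<^bsub>A\<^esub>)"] Z1_closed[OF e(1) g] Z1_closed[OF e(2) g]
        by (simp add: Z1_aut_def)
    qed
  qed
  moreover have "Z1_aut ` carrier (Z1 G A act) = kernel (AutoGroup (ext \<delta>)) ?S aut_pair"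
  proof -
    have one_S: "\<one>\<^bsub>?S\<^esub> = (\<lambda>x\<in>carrier G. x, \<lambda>x\<in>carrier A. x)"
      by (subst S_eq) (simp add: AutoGroup_simps)
    show ?thesis
    proof (intro equalityI subsetI)
      fix \<alpha> assume "\<alpha> \<in> Z1_aut ` carrier (Z1 G A act)"
      then obtain \<epsilon> where e: "\<epsilon> \<in> carrier (Z1 G A act)" "\<alpha> = Z1_aut \<epsilon>" by blast
      have "\<epsilon> \<one>\<^bsub>G\<^esub> = \<one>\<^bsub>A\<^esub>"
        using Z1_eq[OF e(1), of "\<one>\<^bsub>G\<^esub>" "\<one>\<^bsub>G\<^esub>"] Z1_closed[OF e(1), of "\<one>\<^bsub>G\<^esub>"] by (simp add: act_one)
      then have "aut_pair \<alpha> = \<one>\<^bsub>?S\<^esub>"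
        unfolding one_S aut_pair_def e(2) Z1_aut_def
        by (auto intro!: restrict_ext)
      then show "\<alpha> \<in> kernel (AutoGroup (ext \<delta>)) ?S aut_pair"
        unfolding kernel_def e(2) using Z1_aut_auto[OF d e(1)] by (simp add: AutoGroup_simps)
    next
      fix \<alpha> assume "\<alpha> \<in> kernel (AutoGroup (ext \<delta>)) ?S aut_pair"
      then have a: "\<alpha> \<in> auto (ext \<delta>)" and p: "aut_pair \<alpha> = (\<lambda>x\<in>carrier G. x, \<lambda>x\<in>carrier A. x)"
        unfolding kernel_def one_S by (simp_all add: AutoGroup_simps)
      \<comment> \<open>In the kernel the pair is the identity, which turns the twist carried by
        \<alpha> into a cohomology from \<delta> to itself.\<close>
      have "cohom (eps \<alpha>) \<delta> \<delta>" using pair(2)[OF a] unfolding p by simp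
      then have "eps \<alpha> \<in> carrier (Z1 G A act)"
        unfolding cohom_self_iff[OF d] eps_def by (simp only: restrict_restrict Int_absorb)
      moreover have "\<alpha> = Z1_aut (eps \<alpha>)"
      proof (rule extensionalityI)
        show "\<alpha> \<in> extensional (carrier G \<times> carrier A)" using a by (simp add: auto_iso)
        fix x assume "x \<in> carrier G \<times> carrier A"
        then show "\<alpha> x = Z1_aut (eps \<alpha>) x"
          using pair(3)[OF a] p by (auto simp: Z1_aut_def)
      qed (simp add: Z1_aut_def)
      ultimately show "\<alpha> \<in> Z1_aut ` carrier (Z1 G A act)" by blast
    qed
  qed
  ultimately show ?thesis
    using Z1_group Aut image unfolding short_exact_def AutoGroup_simps(1) by blast
qed

end


section \<open>Classification\<close>

context solvable_gmodule
begin

text \<open>The isomorphism of \<open>extension_iso_ext\<close> matches the two copies of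
  \<open>A\<close>, so the position of \<open>A\<close> in the derived series carries over to the
  cocycle extension.\<close>

lemma derived_series_extension_iso:
  assumes "derived_series_extension G A act E \<iota> \<pi>"
  shows "\<exists>\<delta>\<in>cocycles2 G A act. coh_class G A act \<delta> \<in> Delta G A act \<and> E \<cong> ext \<delta>"
proof -
  have ext: "extension G A act E \<iota> \<pi>" and last: "is_last_derived E (\<iota> ` carrier A)"
    using assms unfolding derived_series_extension_def by auto
  have E: "group E" using ext unfolding extension_def short_exact_def by blast
  obtain \<delta> f where d: "\<delta> \<in> cocycles2 G A act" and f: "f \<in> iso (ext \<delta>) E"
    and img: "f ` ext_embed G ` carrier A = \<iota> ` carrier A"
    using extension_iso_ext[OF ext] by blast
  interpret D: group "ext \<delta>" by (rule group_ext[OF d])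
  \<comment> \<open>The property is known for \<open>E\<close> and wanted for the cocycle extension,
    hence the inverse map.\<close>
  let ?f = "inv_into (carrier (ext \<delta>)) f"
  have f': "?f \<in> iso E (ext \<delta>)" by (rule D.iso_set_sym[OF f])
  have "ext_embed G ` carrier A \<subseteq> carrier (ext \<delta>)" by (auto simp: ext_embed_def)
  then have "?f ` \<iota> ` carrier A = ext_embed G ` carrier A"
    unfolding img[symmetric] using f inv_into_image_cancel by (force simp: iso_def bij_betw_def)
  then have "coh_class G A act \<delta> \<in> Delta G A act"
    unfolding Delta_iff[OF d] using is_last_derived_iso[OF E D.is_group f' last] by simp
  then show ?thesis using d is_isoI[OF f'] by blast
qed

text \<open>The copies of \<open>A\<close> are the last derived terms on both sides, so every
  isomorphism matches them and comes from a twist.\<close>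

lemma ext_iso_imp_H2_act:
  assumes C: "C \<in> Delta G A act" "C' \<in> Delta G A act" and d: "\<delta> \<in> C" "\<delta>' \<in> C'"
    and iso: "ext \<delta> \<cong> ext \<delta>'"
  shows "\<exists>p\<in>carrier (Comp G A act). H2_act G A act p C = C'"
proof -
  note D = Delta_last_derived[OF C(1) d(1)] and D' = Delta_last_derived[OF C(2) d(2)]
  obtain f where f: "f \<in> iso (ext \<delta>) (ext \<delta>')" using iso unfolding is_iso_def by blast
  note t = twist_of_iso[OF D(1) D'(1) f iso_ext_embed[OF D(1) D'(1) D(3) D'(3) f]]
  show ?thesis
    unfolding D(2) D'(2) using H2_act_eq_iff[OF t(1) D(1) D'(1)] t(1,2) by blast
qed

lemma H2_act_imp_ext_iso:
  assumes p: "p \<in> carrier (Comp G A act)" and d: "\<delta> \<in> cocycles2 G A act" "\<delta>' \<in> cocycles2 G A act"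
    and eq: "H2_act G A act p (coh_class G A act \<delta>) = coh_class G A act \<delta>'"
  shows "ext \<delta> \<cong> ext \<delta>'"
proof -
  obtain \<eta> \<nu> where p': "p = (\<eta>, \<nu>)" by (cases p)
  then obtain \<epsilon> where "twist \<eta> \<nu> \<epsilon> \<delta> \<delta>'" using H2_act_eq_iff[OF _ d] p eq by blast
  then show ?thesis using iso_of_twist(1)[OF _ d] p p' is_isoI by blast
qed

text \<open>Places every class in its own orbit, which is used to show that two representatives
  share an orbit.\<close>

lemma H2_act_id:
  assumes "C \<in> carrier (H2 G A act)"
  shows "H2_act G A act (\<lambda>x\<in>carrier G. x, \<lambda>x\<in>carrier A. x) C = C"
proof -
  obtain \<delta> where d: "\<delta> \<in> cocycles2 G A act" "C = coh_class G A act \<delta>"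
    using assms unfolding H2_carrier by blast
  show ?thesis
    unfolding d(2) H2_act_eq_iff[OF id_Comp d(1) d(1)] by (rule exI, rule cohom_refl[OF d(1)])
qed

end

theorem theorem10:
  fixes G :: "('g, 'm) monoid_scheme" and A :: "('a, 'n) monoid_scheme"
    and act :: "'a \<Rightarrow> 'g \<Rightarrow> 'a"
  assumes module: "gmodule G A act"
    and solvable: "solvable G"
    and nontrivial_G: "carrier G \<noteq> {\<one>\<^bsub>G\<^esub>}"
    and nontrivial_A: "carrier A \<noteq> {\<one>\<^bsub>A\<^esub>}"
  shows
    "(\<forall>p\<in>carrier (Comp G A act). \<forall>C\<in>Delta G A act. H2_act G A act p C \<in> Delta G A act)
     \<and>
     (\<forall>\<Omega>. orbit_representatives (Comp G A act) (H2_act G A act) (Delta G A act) \<Omega> \<longrightarrow>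
        (\<forall>C\<in>\<Omega>. \<forall>\<delta>\<in>C.
           derived_series_extension G A act (cocycle_ext G A act \<delta>) (ext_embed G) fst) \<and>
        (\<forall>(E :: ('e, 'o) monoid_scheme) \<iota> \<pi>. derived_series_extension G A act E \<iota> \<pi> \<longrightarrow>
           (\<exists>C\<in>\<Omega>. \<forall>\<delta>\<in>C. E \<cong> cocycle_ext G A act \<delta>)) \<and>
        (\<forall>C\<in>\<Omega>. \<forall>C'\<in>\<Omega>. C \<noteq> C' \<longrightarrow>
           (\<forall>\<delta>\<in>C. \<forall>\<delta>'\<in>C'. \<not> cocycle_ext G A act \<delta> \<cong> cocycle_ext G A act \<delta>')))
     \<and>
     (\<forall>\<delta>\<in>carrier (Z2 G A act). coh_class G A act \<delta> \<in> Delta G A act \<longrightarrow>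
        auto (cocycle_ext G A act \<delta>)
          = auto_stabilizing (cocycle_ext G A act \<delta>) (ext_embed G ` carrier A) \<and>
        (\<exists>i p. short_exact (Z1 G A act) (AutoGroup (cocycle_ext G A act \<delta>))
                 (Stab G A act (coh_class G A act \<delta>)) i p))"
proof -
  interpret solvable_gmodule G A act
    by (intro solvable_gmodule.intro solvable_gmodule_axioms.intro) fact+
  show ?thesis
  proof (intro conjI allI impI ballI)
    fix p C assume "p \<in> carrier (Comp G A act)" "C \<in> Delta G A act"
    then show "H2_act G A act p C \<in> Delta G A act" by (rule H2_act_Delta)
  next
    fix \<Omega> C \<delta>
    assume "orbit_representatives (Comp G A act) (H2_act G A act) (Delta G A act) \<Omega>" "C \<in> \<Omega>" "\<delta> \<in> C"
    then have "C \<in> Delta G A act" unfolding orbit_representatives_def by blast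
    note d = Delta_last_derived[OF this \<open>\<delta> \<in> C\<close>]
    show "derived_series_extension G A act (ext \<delta>) (ext_embed G) fst"
      unfolding derived_series_extension_def using extension_ext[OF d(1)] d(3) by simp
  next
    fix \<Omega> and E :: "('e, 'o) monoid_scheme" and \<iota> \<pi>
    assume reps: "orbit_representatives (Comp G A act) (H2_act G A act) (Delta G A act) \<Omega>"
      and E: "derived_series_extension G A act E \<iota> \<pi>"
    have grp: "group E"
      using E unfolding derived_series_extension_def extension_def short_exact_def by blast
    obtain \<delta> where d: "\<delta> \<in> cocycles2 G A act" "coh_class G A act \<delta> \<in> Delta G A act"
      and iso: "E \<cong> ext \<delta>"
      using derived_series_extension_iso[OF E] by blast
    \<comment> \<open>The representative of this orbit is the class sought; all its cocycles are
      reached by the same pair.\<close>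
    have "orbit (Comp G A act) (H2_act G A act) (coh_class G A act \<delta>)
      \<in> orbits (Comp G A act) (Delta G A act) (H2_act G A act)"
      unfolding orbits_def using d(2) by blast
    then obtain C where C: "C \<in> \<Omega>" "C \<in> orbit (Comp G A act) (H2_act G A act) (coh_class G A act \<delta>)"
      using reps unfolding orbit_representatives_def by blast
    then obtain p where p: "p \<in> carrier (Comp G A act)" "H2_act G A act p (coh_class G A act \<delta>) = C"
      unfolding orbit_def by blast
    have CD: "C \<in> Delta G A act" using C(1) reps unfolding orbit_representatives_def by blast
    have "E \<cong> ext \<delta>'" if "\<delta>' \<in> C" for \<delta>'
    proof -
      note d' = Delta_last_derived[OF CD that]
      have "ext \<delta> \<cong> ext \<delta>'" using H2_act_imp_ext_iso[OF p(1) d(1) d'(1)] p(2) d'(2) by simp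
      with iso show ?thesis unfolding is_iso_def using iso_set_trans by blast
    qed
    with C(1) show "\<exists>C\<in>\<Omega>. \<forall>\<delta>\<in>C. E \<cong> ext \<delta>" by blast
  next
    fix \<Omega> C C' \<delta> \<delta>'
    assume reps: "orbit_representatives (Comp G A act) (H2_act G A act) (Delta G A act) \<Omega>"
      and C: "C \<in> \<Omega>" "C' \<in> \<Omega>" "C \<noteq> C'" and d: "\<delta> \<in> C" "\<delta>' \<in> C'"
    have D: "C \<in> Delta G A act" "C' \<in> Delta G A act"
      using C reps unfolding orbit_representatives_def by blast+
    show "\<not> ext \<delta> \<cong> ext \<delta>'"
    proof
      assume "ext \<delta> \<cong> ext \<delta>'"
      then obtain p where p: "p \<in> carrier (Comp G A act)" "H2_act G A act p C = C'"
        using ext_iso_imp_H2_act[OF D d] by blast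
      \<comment> \<open>Both representatives lie in this orbit, against the uniqueness in
        \<open>orbit_representatives\<close>.\<close>
      let ?O = "orbit (Comp G A act) (H2_act G A act) C"
      have "?O \<in> orbits (Comp G A act) (Delta G A act) (H2_act G A act)"
        unfolding orbits_def using D(1) by blast
      then have "\<exists>!\<omega>. \<omega> \<in> \<Omega> \<inter> ?O" using reps unfolding orbit_representatives_def by blast
      moreover have "C \<in> ?O"
        unfolding orbit_def using H2_act_id[OF Delta_carrier[OF D(1)]] id_Comp by force
      moreover have "C' \<in> ?O" unfolding orbit_def using p by blast
      ultimately show False using C by blast
    qed
  next
    fix \<delta> assume "\<delta> \<in> carrier (Z2 G A act)" and D: "coh_class G A act \<delta> \<in> Delta G A act"
    then have d: "\<delta> \<in> cocycles2 G A act" by (simp add: Z2_def)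
    have last: "is_last_derived (ext \<delta>) (ext_embed G ` carrier A)" using D Delta_iff[OF d] by simp
    have stab: "\<alpha> ` ext_embed G ` carrier A = ext_embed G ` carrier A" if "\<alpha> \<in> auto (ext \<delta>)" for \<alpha>
      by (rule iso_ext_embed[OF d d last last]) (use that in \<open>simp add: auto_iso\<close>)
    show "auto (ext \<delta>) = auto_stabilizing (ext \<delta>) (ext_embed G ` carrier A)"
      unfolding auto_stabilizing_def using stab by blast
    show "\<exists>i p. short_exact (Z1 G A act) (AutoGroup (ext \<delta>)) (Stab G A act (coh_class G A act \<delta>)) i p"
      using aut_sequence[OF d stab] by blast
  qed
qed

end
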